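(* Let $\mathcal M$ and $\mathcal N$ be moon polyominoes such that $\mathcal N$ is obtained from $\mathcal M$ by a shift of down-diagonals with respect to a maximal rectangle $R$ of $\mathcal M$. Then $\Omega_{\mathcal M\to\mathcal N}$ is a piecewise-linear, volume-preserving, continuous map $\mathbb R^{\mathcal M}\to\mathbb R^{\mathcal N}$ such that: (a) for all $d\in\mathbb Z_{\ge 0}$, all $x\in\mathbb R^{\mathcal M}$, and every maximal rectangle $S$ of $\mathcal M$ with corresponding maximal rectangle $S'$ of $\mathcal N$, $H_S(x;d)=H_{S'}(\Omega_{\mathcal M\to\mathcal N}(x);d)$; (b) for all $k\in\mathbb Z_{\ge0}$, $\Omega_{\mathcal M\to\mathcal N}(k\,\mathrm{QSTAB}(\mathcal M))=k\,\mathrm{QSTAB}(\mathcal N)$; (c) for all $k\in\mathbb Z_{\ge0}$, $\Omega_{\mathcal M\to\mathcal N}$ restricts to a bijection $k\,\mathrm{QSTAB}(\mathcal M)\cap\mathbb Z^{\mathcal M}\to k\,\mathrm{QSTAB}(\mathcal N)\cap\mathbb Z^{\mathcal N}$. In particular, $\mathrm{Ehr}_{\mathrm{QSTAB}(\mathcal M)}(t)=\mathrm{Ehr}_{\mathrm{QSTAB}(\mathcal N)}(t)$.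
   Context: **Moon polyominoes.** A polyomino is a finite subset of $\mathbb Z\times\mathbb Z$; its elements are boxes. Its $i$th up-diagonal is the set of its boxes $(i,j)$ with $i$ fixed; its $j$th down-diagonal is the set of its boxes $(i,j)$ with $j$ fixed. It is convex if every up-diagonal and every down-diagonal is connected (the varying coordinate runs over an interval of integers), and intersection-free if for any $i_1,i_2$ the sets $\{j:(i_1,j)\in\mathcal M\}$ and $\{j:(i_2,j)\in\mathcal M\}$ are comparable under inclusion. A moon polyomino is a convex intersection-free polyomino. A rectangle is a set $[i_1,i_2]\times[j_1,j_2]$ (integer intervals); it is maximal in $\mathcal M$ if it is inclusion-maximal among rectangles contained in $\mathcal M$. **Shift of down-diagonals.** Let $R=[i_1,i_2]\times[j_1,j_2]$ be a maximal rectangle of $\mathcal M$ and let $\mathcal D$ be the union of all down-diagonals of $\mathcal M$ that intersect $R$. $\mathcal N$ is obtained from $\mathcal M$ by a shift of down-diagonals (w.r.t. $R$) if $\mathcal N$ is a moon polyomino that is the image of the map on $\mathcal M$ sending $(i,j)\mapsto(i,j-1)$ if $(i,j)\in\mathcal D\setminus R$ and $(i,j)\mapsto(i,j)$ otherwise. For a maximal rectangle $S=[a,b]\times[c,d]$ of $\mathcal M$, the corresponding maximal rectangle $S'$ of $\mathcal N$ is $[a,b]\times[c-1,d-1]$ if $[a,b]\not\subseteq[i_1,i_2]$, and $S'=S$ otherwise (it is the maximal rectangle of $\mathcal N$ with the same dimensions as $S$). **Toggles, RSK, promotion.** Let $R=[r]\times[s]$ with the product order, $[n]=\{1,\dots,n\}$;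 write $p\lessdot q$ for cover relations. For $p\in R$ the toggle $t_p:\mathbb R^R\to\mathbb R^R$ replaces $x_p$ by $\min_{q\gtrdot p}x_q+\max_{q\lessdot p}x_q-x_p$ and fixes all other labels (empty $\max=0$, empty $\min=1$). The transfer map $\phi:\mathbb R^R\to\mathbb R^R$ is the bijection $\phi(x)_p=x_p-\max_{q\lessdot p}x_q$ (empty $\max=0$). For $I\subseteq R$ with $n$ elements and any linear extension $L:I\to[n]$ (order-preserving bijection), $\rho_I=t_{L^{-1}(1)}\circ\cdots\circ t_{L^{-1}(n)}$ (independent of $L$); $\rho_{i,j}=\rho_{[i]\times[j]}$. With $m=\min(r,s)$, $\mathrm{RSK}=\rho^{-1}_{r-m+1,s-m+1}\circ\cdots\circ\rho^{-1}_{r-2,s-2}\circ\rho^{-1}_{r-1,s-1}\circ\phi^{-1}$ (equal to $\phi^{-1}$ if $m=1$). With $F_k=\{(i,j)\in R:i-j=k\}$, $\mathrm{Pro}^P=\rho_{F_{r-s+1}}\circ\cdots\circ\rho_{F_{r-2}}\circ\rho_{F_{r-1}}$ (identity if $s=1$). Set $\Omega=\mathrm{RSK}^{-1}\circ\mathrm{Pro}^P\circ\mathrm{RSK}:\mathbb R^R\to\mathbb R^R$. For a rectangle $[i_1,i_2]\times[j_1,j_2]$, $\Omega$ is defined by translating it to $[i_2-i_1+1]\times[j_2-j_1+1]$. **The map $\Omega_{\mathcal M\to\mathcal N}$.** Let $\mathcal E$ be the union of the down-diagonals of $\mathcal N$ intersecting $R$. For $x\in\mathbb R^{\mathcal M}$,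 $\Omega_{\mathcal M\to\mathcal N}(x)_{ij}$ equals $\Omega(x|_R)_{ij}$ if $(i,j)\in R$; $x_{i,j+1}$ if $(i,j)\in\mathcal E\setminus R$; $x_{ij}$ if $(i,j)\in\mathcal N\setminus\mathcal E$. **Path statistics.** For a rectangle $S=[u_1,u_2]\times[v_1,v_2]$ and a labeling $x$ of a set containing $S$, let $H_S(x;k)$, for $0\le k\le\min(u_2-u_1+1,v_2-v_1+1)$, be the maximum, over all systems of $k$ pairwise vertex-disjoint lattice paths (steps $(1,0)$ and $(0,1)$) from $(u_1,v_1),\dots,(u_1,v_1+k-1)$ to $(u_2,v_2-k+1),\dots,(u_2,v_2)$, of the sum of the labels of all vertices on the paths; for larger $k$, $H_S(x;k)$ is constant, equal to its value at $k=\min(u_2-u_1+1,v_2-v_1+1)$. **Polytope.** $G_{\mathcal M}$ is the graph on the boxes of $\mathcal M$ in which distinct boxes $(u_1,v_1),(u_2,v_2)$ are adjacent if (after possibly swapping them) $u_1\le u_2$, $v_1\le v_2$ and $[u_1,u_2]\times[v_1,v_2]\subseteq\mathcal M$. $\mathrm{QSTAB}(\mathcal M)\subseteq\mathbb R^{\mathcal M}$ is defined by $x_v\ge0$ for all $v\in\mathcal M$ and $\sum_{v\in C}x_v\le1$ for all cliques $C$ of $G_{\mathcal M}$. For a polytope $P\subseteq\mathbb R^n$, $i_P(k)=\#(\mathbb Z^n\cap kP)$ for $k\in\mathbb Z_{\ge0}$, and $\mathrm{Ehr}_P(t)=\sum_{k\ge0}i_P(k)t^k$. *)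

theory Defs
  imports "HOL-Analysis.Analysis" "HOL-Computational_Algebra.Formal_Power_Series"
begin

type_synonym box = "int \<times> int"
type_synonym labeling = "box \<Rightarrow> real"

text \<open>A labeling in \<open>\<real>\<^sup>V\<close> is an extensional function: it takes the value
  \<open>undefined\<close> outside \<open>V\<close>. This matches the underlying sets of \<open>product_topology\<close> and \<open>Pi\<^sub>M\<close>.\<close>

abbreviation labelings :: "box set \<Rightarrow> labeling set" where
  "labelings V \<equiv> V \<rightarrow>\<^sub>E UNIV"

definition int_labelings :: "box set \<Rightarrow> labeling set" where
  "int_labelings V = V \<rightarrow>\<^sub>E \<int>"


subsection \<open>Moon polyominoes and shifts\<close>

definition int_interval :: "int set \<Rightarrow> bool" where
  "int_interval A \<longleftrightarrow> (\<forall>a\<in>A. \<forall>b\<in>A. {a..b} \<subseteq> A)"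

definition up_diagonal :: "box set \<Rightarrow> int \<Rightarrow> int set" where
  "up_diagonal M i = {j. (i, j) \<in> M}"

definition down_diagonal :: "box set \<Rightarrow> int \<Rightarrow> int set" where
  "down_diagonal M j = {i. (i, j) \<in> M}"

definition convex_polyomino :: "box set \<Rightarrow> bool" where
  "convex_polyomino M \<longleftrightarrow>
     (\<forall>i. int_interval (up_diagonal M i)) \<and> (\<forall>j. int_interval (down_diagonal M j))"

definition intersection_free :: "box set \<Rightarrow> bool" where
  "intersection_free M \<longleftrightarrow>
     (\<forall>i1 i2. up_diagonal M i1 \<subseteq> up_diagonal M i2 \<or> up_diagonal M i2 \<subseteq> up_diagonal M i1)"

definition moon_polyomino :: "box set \<Rightarrow> bool" where
  "moon_polyomino M \<longleftrightarrow> finite M \<and> convex_polyomino M \<and> intersection_free M"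

text \<open>The tuple \<open>(i1, i2, j1, j2)\<close> stands for the rectangle \<open>[i1, i2] \<times> [j1, j2]\<close>.\<close>

type_synonym rect = "int \<times> int \<times> int \<times> int"

fun boxes :: "rect \<Rightarrow> box set" where
  "boxes (i1, i2, j1, j2) = {i1..i2} \<times> {j1..j2}"

text \<open>The first two conditions exclude the empty rectangle. They only matter for the
  empty polyomino, which thus has no maximal rectangle.\<close>

fun maximal_rect :: "box set \<Rightarrow> rect \<Rightarrow> bool" where
  "maximal_rect M (i1, i2, j1, j2) \<longleftrightarrow>
     i1 \<le> i2 \<and> j1 \<le> j2 \<and> boxes (i1, i2, j1, j2) \<subseteq> M \<and>
     (\<forall>S. boxes (i1, i2, j1, j2) \<subseteq> boxes S \<and> boxes S \<subseteq> M \<longrightarrow> boxes S = boxes (i1, i2, j1, j2))"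

text \<open>The union of the down-diagonals of \<open>M\<close> that intersect \<open>R\<close>.\<close>

definition down_diagonals_meeting :: "box set \<Rightarrow> box set \<Rightarrow> box set" where
  "down_diagonals_meeting M R = {(i, j). (i, j) \<in> M \<and> (\<exists>i'. (i', j) \<in> M \<and> (i', j) \<in> R)}"

definition shift_box :: "box set \<Rightarrow> rect \<Rightarrow> box \<Rightarrow> box" where
  "shift_box M R = (\<lambda>(i, j).
     if (i, j) \<in> down_diagonals_meeting M (boxes R) - boxes R then (i, j - 1) else (i, j))"

definition obtained_by_shift :: "box set \<Rightarrow> rect \<Rightarrow> box set \<Rightarrow> bool" where
  "obtained_by_shift M R N \<longleftrightarrow> moon_polyomino N \<and> N = shift_box M R ` M"

fun corresponding_rect :: "rect \<Rightarrow> rect \<Rightarrow> rect" where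
  "corresponding_rect (i1, i2, j1, j2) (a, b, c, d) =
     (if \<not> {a..b} \<subseteq> {i1..i2} then (a, b, c - 1, d - 1) else (a, b, c, d))"


subsection \<open>Toggles, RSK and promotion\<close>

text \<open>The order on boxes is the product order of \<open>HOL-Library.Product_Order\<close>;
  \<open>covers P p q\<close> means that \<open>q\<close> covers \<open>p\<close> in the induced poset \<open>P\<close>.\<close>

definition covers :: "box set \<Rightarrow> box \<Rightarrow> box \<Rightarrow> bool" where
  "covers P p q \<longleftrightarrow> p \<in> P \<and> q \<in> P \<and> p < q \<and> \<not> (\<exists>z\<in>P. p < z \<and> z < q)"

definition max_below :: "box set \<Rightarrow> labeling \<Rightarrow> box \<Rightarrow> real" where
  "max_below P x p = (let A = {q. covers P q p} in if A = {} then 0 else Max (x ` A))"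

definition min_above :: "box set \<Rightarrow> labeling \<Rightarrow> box \<Rightarrow> real" where
  "min_above P x p = (let A = {q. covers P p q} in if A = {} then 1 else Min (x ` A))"

definition toggle :: "box set \<Rightarrow> box \<Rightarrow> labeling \<Rightarrow> labeling" where
  "toggle P p x = x(p := min_above P x p + max_below P x p - x p)"

definition transfer :: "box set \<Rightarrow> labeling \<Rightarrow> labeling" where
  "transfer P x = (\<lambda>p\<in>P. x p - max_below P x p)"

definition inverse_on :: "box set \<Rightarrow> (labeling \<Rightarrow> labeling) \<Rightarrow> labeling \<Rightarrow> labeling" where
  "inverse_on P f = inv_into (labelings P) f"

text \<open>\<open>compose_list [f\<^sub>1, \<dots>, f\<^sub>n] = f\<^sub>1 \<circ> \<dots> \<circ> f\<^sub>n\<close>\<close>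

definition compose_list :: "(labeling \<Rightarrow> labeling) list \<Rightarrow> labeling \<Rightarrow> labeling" where
  "compose_list fs = foldr (\<circ>) fs id"

definition linear_extension :: "box set \<Rightarrow> (box \<Rightarrow> nat) \<Rightarrow> bool" where
  "linear_extension I L \<longleftrightarrow>
     bij_betw L I {1..card I} \<and> (\<forall>p\<in>I. \<forall>q\<in>I. p \<le> q \<longrightarrow> L p \<le> L q)"

text \<open>The composition does not depend on the linear extension.\<close>

definition rho :: "box set \<Rightarrow> box set \<Rightarrow> labeling \<Rightarrow> labeling" where
  "rho P I =
     (let L = SOME L. linear_extension I L
      in compose_list (map (\<lambda>k. toggle P (inv_into I L k)) [1..<Suc (card I)]))"

abbreviation grid :: "int \<Rightarrow> int \<Rightarrow> box set" where
  "grid r s \<equiv> {1..r} \<times> {1..s}"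

definition RSK :: "int \<Rightarrow> int \<Rightarrow> labeling \<Rightarrow> labeling" where
  "RSK r s =
     compose_list (map (\<lambda>k. inverse_on (grid r s) (rho (grid r s) (grid (r - k) (s - k))))
       (rev [1..min r s - 1]))
     \<circ> inverse_on (grid r s) (transfer (grid r s))"

definition grid_file :: "int \<Rightarrow> int \<Rightarrow> int \<Rightarrow> box set" where
  "grid_file r s k = {(i, j). (i, j) \<in> grid r s \<and> i - j = k}"

definition promotion :: "int \<Rightarrow> int \<Rightarrow> labeling \<Rightarrow> labeling" where
  "promotion r s =
     compose_list (map (\<lambda>k. rho (grid r s) (grid_file r s k)) [r - s + 1..r - 1])"

definition Omega_grid :: "int \<Rightarrow> int \<Rightarrow> labeling \<Rightarrow> labeling" where
  "Omega_grid r s = inverse_on (grid r s) (RSK r s) \<circ> promotion r s \<circ> RSK r s"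

text \<open>The argument may be a labeling of any superset of the rectangle; it is restricted to
  the rectangle.\<close>

fun Omega_rect :: "rect \<Rightarrow> labeling \<Rightarrow> labeling" where
  "Omega_rect (i1, i2, j1, j2) x =
     (let r = i2 - i1 + 1; s = j2 - j1 + 1;
          y = Omega_grid r s (\<lambda>(a, b)\<in>grid r s. x (a + i1 - 1, b + j1 - 1))
      in (\<lambda>(i, j)\<in>boxes (i1, i2, j1, j2). y (i - i1 + 1, j - j1 + 1)))"

definition Omega_shift :: "rect \<Rightarrow> box set \<Rightarrow> labeling \<Rightarrow> labeling" where
  "Omega_shift R N x = (\<lambda>(i, j)\<in>N.
     if (i, j) \<in> boxes R then Omega_rect R x (i, j)
     else if (i, j) \<in> down_diagonals_meeting N (boxes R) then x (i, j + 1)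
     else x (i, j))"


subsection \<open>Path statistics\<close>

definition lattice_path :: "box \<Rightarrow> box \<Rightarrow> box list \<Rightarrow> bool" where
  "lattice_path p q w \<longleftrightarrow> w \<noteq> [] \<and> hd w = p \<and> last w = q \<and>
     successively (\<lambda>(i, j) (i', j'). (i', j') = (i + 1, j) \<or> (i', j') = (i, j + 1)) w"

text \<open>The paths are numbered from 0; the first start is joined to the first end, and so on.
  Since the paths are vertex-disjoint, no other way of joining the starts to the ends is
  possible.\<close>

fun path_system :: "rect \<Rightarrow> nat \<Rightarrow> (nat \<Rightarrow> box list) \<Rightarrow> bool" where
  "path_system (u1, u2, v1, v2) k w \<longleftrightarrow>
     (\<forall>l<k. lattice_path (u1, v1 + int l) (u2, v2 - int k + 1 + int l) (w l)) \<and>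
     (\<forall>l<k. \<forall>l'<k. l \<noteq> l' \<longrightarrow> set (w l) \<inter> set (w l') = {})"

definition max_path_sum :: "rect \<Rightarrow> labeling \<Rightarrow> nat \<Rightarrow> real" where
  "max_path_sum S x k = Max {\<Sum>l<k. \<Sum>v\<in>set (w l). x v | w. path_system S k w}"

fun path_stat :: "rect \<Rightarrow> labeling \<Rightarrow> nat \<Rightarrow> real" where
  "path_stat (u1, u2, v1, v2) x k =
     max_path_sum (u1, u2, v1, v2) x (min k (nat (min (u2 - u1 + 1) (v2 - v1 + 1))))"


subsection \<open>The polytope and its Ehrhart series\<close>

definition box_le_within :: "box set \<Rightarrow> box \<Rightarrow> box \<Rightarrow> bool" where
  "box_le_within M = (\<lambda>(u1, v1) (u2, v2). u1 \<le> u2 \<and> v1 \<le> v2 \<and> {u1..u2} \<times> {v1..v2} \<subseteq> M)"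

definition adjacent :: "box set \<Rightarrow> box \<Rightarrow> box \<Rightarrow> bool" where
  "adjacent M p q \<longleftrightarrow> p \<in> M \<and> q \<in> M \<and> p \<noteq> q \<and> (box_le_within M p q \<or> box_le_within M q p)"

definition clique :: "box set \<Rightarrow> box set \<Rightarrow> bool" where
  "clique M C \<longleftrightarrow> C \<subseteq> M \<and> (\<forall>p\<in>C. \<forall>q\<in>C. p \<noteq> q \<longrightarrow> adjacent M p q)"

definition QSTAB :: "box set \<Rightarrow> labeling set" where
  "QSTAB M = {x \<in> labelings M. (\<forall>v\<in>M. 0 \<le> x v) \<and> (\<forall>C. clique M C \<longrightarrow> (\<Sum>v\<in>C. x v) \<le> 1)}"

definition dilate :: "box set \<Rightarrow> nat \<Rightarrow> labeling set \<Rightarrow> labeling set" where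
  "dilate V k P = (\<lambda>x. \<lambda>v\<in>V. real k * x v) ` P"

definition ehrhart_count :: "box set \<Rightarrow> labeling set \<Rightarrow> nat \<Rightarrow> nat" where
  "ehrhart_count V P k = card (int_labelings V \<inter> dilate V k P)"

definition ehrhart_series :: "box set \<Rightarrow> labeling set \<Rightarrow> int fps" where
  "ehrhart_series V P = Abs_fps (\<lambda>k. int (ehrhart_count V P k))"


subsection \<open>Analytic properties of maps between spaces of labelings\<close>

definition continuous_labeling_map ::
    "box set \<Rightarrow> box set \<Rightarrow> (labeling \<Rightarrow> labeling) \<Rightarrow> bool" where
  "continuous_labeling_map V W f \<longleftrightarrow>
     continuous_map (product_topology (\<lambda>_. euclidean) V) (product_topology (\<lambda>_. euclidean) W) f"

text \<open>A finite intersection of half-spaces; the pair \<open>(a, b)\<close> encodes the inequality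
  \<open>\<langle>a, x\<rangle> \<le> b\<close>.\<close>

definition polyhedron_in :: "box set \<Rightarrow> labeling set \<Rightarrow> bool" where
  "polyhedron_in V Q \<longleftrightarrow> (\<exists>F :: (labeling \<times> real) set.
     finite F \<and> Q = {x \<in> labelings V. \<forall>(a, b)\<in>F. (\<Sum>v\<in>V. a v * x v) \<le> b})"

text \<open>Finitely many polyhedra cover \<open>\<real>\<^sup>V\<close>, and on each of them the map is given by a matrix.\<close>

definition piecewise_linear ::
    "box set \<Rightarrow> box set \<Rightarrow> (labeling \<Rightarrow> labeling) \<Rightarrow> bool" where
  "piecewise_linear V W f \<longleftrightarrow> f \<in> labelings V \<rightarrow> labelings W \<and>
     (\<exists>\<Q>. finite \<Q> \<and> (\<forall>Q\<in>\<Q>. polyhedron_in V Q) \<and> \<Union>\<Q> = labelings V \<and>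
       (\<forall>Q\<in>\<Q>. \<exists>A :: box \<Rightarrow> box \<Rightarrow> real.
          \<forall>x\<in>Q. \<forall>w\<in>W. f x w = (\<Sum>v\<in>V. A w v * x v)))"

text \<open>The image of every Borel set is a Borel set of the same Lebesgue measure.\<close>

definition volume_preserving ::
    "box set \<Rightarrow> box set \<Rightarrow> (labeling \<Rightarrow> labeling) \<Rightarrow> bool" where
  "volume_preserving V W f \<longleftrightarrow>
     (\<forall>A \<in> sets (Pi\<^sub>M V (\<lambda>_. lborel)).
        f ` A \<in> sets (Pi\<^sub>M W (\<lambda>_. lborel)) \<and>
        emeasure (Pi\<^sub>M W (\<lambda>_. lborel)) (f ` A) = emeasure (Pi\<^sub>M V (\<lambda>_. lborel)) A)"

end

theory Submission
  imports Defs
begin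

text \<open>Read a rectangle row by row: \<open>k\<close> disjoint lattice paths become \<open>k\<close> separated positions that move
  to the right in every row, and each row is a level weighted by its partial sums. The intermediate
  positions of two consecutive levels vary independently over disjoint intervals, so exchanging the
  two levels by the local RSK rule preserves all weights between fixed ends (Pitman's identity).
  Iterating the exchange turns the rows of \<open>x\<close> into a triangular normal form whose levels are the
  diagonals of \<open>RSK x\<close>, and the columns of \<open>x\<close> likewise. Promotion does not touch the diagonals that
  govern the columns, so \<open>\<Omega>\<close> preserves all column weights; on the normal form of the rows with its
  first column removed, restoring normal form performs exactly the promotion toggles, so the rows of
  \<open>x\<close> on the columns \<open>2..s\<close> are equivalent to the rows of \<open>\<Omega> x\<close> on the columns \<open>1..s - 1\<close>. A maximal
  rectangle of \<open>M\<close> crosses \<open>R\<close> horizontally or vertically, which gives (a). Toggles are unimodular,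
  integral and preserve the cone of nonnegative order-preserving labelings, and cliques are contained
  in single lattice paths of rectangles, which gives the rest.\<close>

subsection \<open>Systems of positions moving through levels\<close>

text \<open>A maximal rectangle contains only a part of \<open>R\<close>, so invariance of the path
  maxima of \<open>R\<close> itself would not suffice. What must survive is the behaviour of a stack
  of rows between arbitrary end positions; \<open>net_eqv\<close> expresses this and is a congruence
  for stacking, so that the part inside \<open>R\<close> can be replaced within a larger rectangle.
  Levels carry thresholds because the \<open>l\<close>-th part of a shape exists only from column
  \<open>l\<close> on: a position to the left of the threshold has to stand still. With this
  convention one move, from thresholds \<open>k\<close>, \<open>k\<close> to \<open>k + 1\<close>,
  \<open>k\<close>, keeps the number of levels and serves both the construction of the normal form
  and promotion. The top box \<open>(r, s)\<close> lies on file \<open>r - s\<close> and in no inner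
  rectangle, so it is never toggled. The value 1 of an empty minimum therefore never enters, which
  makes all maps homogeneous: piecewise linear rather than piecewise affine.\<close>

type_synonym net = "(int \<times> (int \<Rightarrow> real)) list"

text \<open>One row of a system of \<open>K\<close> disjoint paths: path \<open>i\<close> enters the
  row in column \<open>A i\<close> and leaves it in column \<open>B i\<close>. Disjointness within
  the row is the clause \<open>B i < A (Suc i)\<close>.\<close>

definition nstep :: "nat \<Rightarrow> int \<Rightarrow> (nat \<Rightarrow> int) \<Rightarrow> (nat \<Rightarrow> int) \<Rightarrow> bool" where
  "nstep K k A B \<longleftrightarrow> (\<forall>i<K. if A i < k then B i = A i else A i \<le> B i) \<and>
     (\<forall>i. Suc i < K \<longrightarrow> B i < A (Suc i))"

text \<open>\<open>U\<close> is a partial-sum function, so each summand is the sum of the labels in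
  columns \<open>A i\<close> to \<open>B i\<close>.\<close>

definition nweight :: "nat \<Rightarrow> (int \<Rightarrow> real) \<Rightarrow> (nat \<Rightarrow> int) \<Rightarrow> (nat \<Rightarrow> int) \<Rightarrow> real" where
  "nweight K U A B = (\<Sum>i<K. U (B i) - U (A i - 1))"

text \<open>The empty net asks for equality of whole functions, including indices from
  \<open>K\<close> on; as soon as there is a level, the values at those indices are free.\<close>

fun reach :: "nat \<Rightarrow> net \<Rightarrow> (nat \<Rightarrow> int) \<Rightarrow> (nat \<Rightarrow> int) \<Rightarrow> real \<Rightarrow> bool" where
  "reach K [] A B w \<longleftrightarrow> A = B \<and> w = 0"
| "reach K ((k, U) # n) A B w \<longleftrightarrow>
     (\<exists>C w'. nstep K k A C \<and> reach K n C B w' \<and> w = nweight K U A C + w')"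

text \<open>Domination replaces equality of maxima, so nets can be rewritten before anything is
  known about the existence of a maximum.\<close>

definition net_le :: "nat \<Rightarrow> int \<Rightarrow> int \<Rightarrow> net \<Rightarrow> net \<Rightarrow> bool" where
  "net_le K lo hi n n' \<longleftrightarrow> (\<forall>A B w. (\<forall>i<K. lo \<le> A i \<and> B i \<le> hi) \<longrightarrow> reach K n A B w \<longrightarrow>
     (\<exists>w'\<ge>w. reach K n' A B w'))"

definition net_eqv :: "nat \<Rightarrow> int \<Rightarrow> int \<Rightarrow> net \<Rightarrow> net \<Rightarrow> bool" where
  "net_eqv K lo hi n n' \<longleftrightarrow> net_le K lo hi n n' \<and> net_le K lo hi n' n"

lemma nstep_mono: "nstep K k A B \<Longrightarrow> i < K \<Longrightarrow> A i \<le> B i"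
  unfolding nstep_def by (metis linorder_not_less nle_le)

lemma reach_mono: "reach K n A B w \<Longrightarrow> i < K \<Longrightarrow> A i \<le> B i"
proof (induction n arbitrary: A w)
  case (Cons p n)
  then obtain k U where p: "p = (k, U)" by (cases p)
  with Cons.prems obtain C w' where "nstep K k A C" "reach K n C B w'" by auto
  then show ?case using Cons.IH Cons.prems(2) nstep_mono by (meson order_trans)
qed simp

lemma reach_append:
  "reach K (n1 @ n2) A B w \<longleftrightarrow>
     (\<exists>C w1 w2. reach K n1 A C w1 \<and> reach K n2 C B w2 \<and> w = w1 + w2)"
proof (induction n1 arbitrary: A w)
  case Nil
  show ?case by auto
next
  case (Cons p n1)
  obtain k U where p: "p = (k, U)" by (cases p)
  show ?case (is "?L \<longleftrightarrow> ?R")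
  proof
    assume ?L
    then obtain C w' where 1: "nstep K k A C" "reach K (n1 @ n2) C B w'" "w = nweight K U A C + w'"
      by (auto simp: p)
    then obtain D w1 w2 where "reach K n1 C D w1" "reach K n2 D B w2" "w' = w1 + w2"
      using Cons.IH by blast
    then show ?R
      using 1 by (intro exI[of _ D] exI[of _ "nweight K U A C + w1"] exI[of _ w2]) (auto simp: p)
  next
    assume ?R
    then obtain C w1 w2 where 1: "reach K (p # n1) A C w1" "reach K n2 C B w2" "w = w1 + w2"
      by blast
    then obtain D w' where 2: "nstep K k A D" "reach K n1 D C w'" "w1 = nweight K U A D + w'"
      by (auto simp: p)
    have "reach K (n1 @ n2) D B (w' + w2)" unfolding Cons.IH using 1(2) 2(2) by metis
    moreover have "w = nweight K U A D + (w' + w2)" using 1(3) 2(3) by simp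
    ultimately show ?L unfolding p append_Cons reach.simps using 2(1) by metis
  qed
qed

section \<open>Equivalence of nets is a congruence\<close>

lemma net_leI:
  assumes "\<And>A B w. (\<And>i. i < K \<Longrightarrow> lo \<le> A i \<and> B i \<le> hi) \<Longrightarrow> reach K n A B w \<Longrightarrow>
    \<exists>w'\<ge>w. reach K n' A B w'"
  shows "net_le K lo hi n n'"
  unfolding net_le_def by (intro allI impI assms) simp_all

lemma net_leD:
  assumes "net_le K lo hi n n'" "reach K n A B w" "\<And>i. i < K \<Longrightarrow> lo \<le> A i \<and> B i \<le> hi"
  shows "\<exists>w'\<ge>w. reach K n' A B w'"
  using assms(1)[unfolded net_le_def, rule_format, OF _ assms(2)] assms(3) by simp

lemma net_le_refl: "net_le K lo hi n n"
proof (rule net_leI)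
  show "\<exists>w'\<ge>w. reach K n A B w'" if "reach K n A B w" for A B w
    using that by (intro exI[of _ w]) simp
qed

lemma net_le_trans:
  assumes "net_le K lo hi n1 n2" "net_le K lo hi n2 n3"
  shows "net_le K lo hi n1 n3"
proof (rule net_leI)
  fix A B w assume b: "\<And>i. i < K \<Longrightarrow> lo \<le> A i \<and> B i \<le> hi" and r: "reach K n1 A B w"
  obtain w' where w': "w \<le> w'" "reach K n2 A B w'" using net_leD[OF assms(1) r b] by metis
  obtain w'' where "w' \<le> w''" "reach K n3 A B w''" using net_leD[OF assms(2) w'(2) b] by metis
  with w'(1) show "\<exists>w''\<ge>w. reach K n3 A B w''" by (intro exI[of _ w'']) simp
qed

text \<open>Positions only move to the right, so the positions \<open>C\<close> between the two nets
  inherit the bounds from the ends, and both hypotheses apply.\<close>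

lemma net_le_append:
  assumes "net_le K lo hi n1 n1'" "net_le K lo hi n2 n2'"
  shows "net_le K lo hi (n1 @ n2) (n1' @ n2')"
proof (rule net_leI)
  fix A B w assume b: "\<And>i. i < K \<Longrightarrow> lo \<le> A i \<and> B i \<le> hi" and "reach K (n1 @ n2) A B w"
  then obtain C w1 w2 where C: "reach K n1 A C w1" "reach K n2 C B w2" "w = w1 + w2"
    unfolding reach_append by blast
  have "lo \<le> A i \<and> C i \<le> hi" "lo \<le> C i \<and> B i \<le> hi" if "i < K" for i
    using reach_mono[OF C(1) that] reach_mono[OF C(2) that] b that by force+
  then obtain w1' w2' where 1: "w1' \<ge> w1" "reach K n1' A C w1'" and 2: "w2' \<ge> w2" "reach K n2' C B w2'"
    using net_leD[OF assms(1) C(1)] net_leD[OF assms(2) C(2)] by metis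
  from 1 2 C(3) show "\<exists>w'\<ge>w. reach K (n1' @ n2') A B w'"
    unfolding reach_append by (intro exI[of _ "w1' + w2'"]) auto
qed

lemma net_eqv_refl: "net_eqv K lo hi n n"
  unfolding net_eqv_def by (simp add: net_le_refl)

lemma net_eqv_sym: "net_eqv K lo hi n1 n2 \<Longrightarrow> net_eqv K lo hi n2 n1"
  unfolding net_eqv_def by simp

lemma net_eqv_trans [trans]:
  "net_eqv K lo hi n1 n2 \<Longrightarrow> net_eqv K lo hi n2 n3 \<Longrightarrow> net_eqv K lo hi n1 n3"
  unfolding net_eqv_def by (meson net_le_trans)

lemma net_eqv_append:
  "net_eqv K lo hi n1 n1' \<Longrightarrow> net_eqv K lo hi n2 n2' \<Longrightarrow> net_eqv K lo hi (n1 @ n2) (n1' @ n2')"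
  unfolding net_eqv_def by (simp add: net_le_append)

lemma net_eqv_mono:
  assumes "net_eqv K lo hi n n'" "lo \<le> lo'" "hi' \<le> hi"
  shows "net_eqv K lo' hi' n n'"
proof -
  have "net_le K lo' hi' n n'" if le: "net_le K lo hi n n'" for n n'
  proof (rule net_leI)
    fix A B w assume b: "\<And>i. i < K \<Longrightarrow> lo' \<le> A i \<and> B i \<le> hi'" and r: "reach K n A B w"
    show "\<exists>w'\<ge>w. reach K n' A B w'"
      by (rule net_leD[OF le r]) (use b assms(2,3) in force)
  qed
  with assms(1) show ?thesis unfolding net_eqv_def by simp
qed

text \<open>Domination in both directions becomes equality of greatest weights as soon as one side
  has a greatest weight.\<close>

lemma net_eqv_best:
  assumes "net_eqv K lo hi n n'" "\<And>i. i < K \<Longrightarrow> lo \<le> A i \<and> B i \<le> hi"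
  shows "(reach K n A B W \<and> (\<forall>w. reach K n A B w \<longrightarrow> w \<le> W)) \<longleftrightarrow>
         (reach K n' A B W \<and> (\<forall>w. reach K n' A B w \<longrightarrow> w \<le> W))"
proof -
  have "reach K n' A B W \<and> (\<forall>w. reach K n' A B w \<longrightarrow> w \<le> W)"
    if "net_eqv K lo hi n n'" and W: "reach K n A B W" "\<forall>w. reach K n A B w \<longrightarrow> w \<le> W" for n n'
  proof -
    have le: "\<exists>w'\<ge>w. reach K n' A B w'" if "reach K n A B w" for w
      using net_leD[OF _ that assms(2), of n'] \<open>net_eqv K lo hi n n'\<close> unfolding net_eqv_def by metis
    have ge: "\<exists>w'\<ge>w. reach K n A B w'" if "reach K n' A B w" for w
      using net_leD[OF _ that assms(2), of n] \<open>net_eqv K lo hi n n'\<close> unfolding net_eqv_def by metis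
    obtain w' where w': "w' \<ge> W" "reach K n' A B w'" using le W by metis
    from ge[OF this(2)] W w'(1) have "w' = W" by (metis order.trans order.antisym)
    with w' ge W show ?thesis by (metis order.trans)
  qed
  from this[of n n'] this[of n' n] assms(1) net_eqv_sym[OF assms(1)] show ?thesis by metis
qed

section \<open>Changing a single level, and translation of columns\<close>

lemma reach_singleton: "reach K [(k, U)] A B w \<longleftrightarrow> nstep K k A B \<and> w = nweight K U A B"
  by auto

lemma reach_twoI:
  "nstep K k A C \<Longrightarrow> nstep K k' C B \<Longrightarrow>
     reach K [(k, U), (k', V)] A B (nweight K U A C + nweight K V C B)"
  by (simp, rule exI[of _ C]) simp

text \<open>Weights are sums of increments of \<open>U\<close> over columns in
  \<open>{lo..hi}\<close>; additive constants and the behaviour elsewhere do not matter.\<close>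

lemma net_eqv_single:
  assumes "\<And>c. lo \<le> c \<Longrightarrow> c \<le> hi \<Longrightarrow> U c - U (c - 1) = U' c - U' (c - 1)"
    and "\<And>A B. (\<And>i. i < K \<Longrightarrow> lo \<le> A i \<and> B i \<le> hi) \<Longrightarrow> nstep K k A B \<longleftrightarrow> nstep K k' A B"
  shows "net_eqv K lo hi [(k, U)] [(k', U')]"
proof -
  have *: "U b - U (a - 1) = U' b - U' (a - 1)" if "a \<le> b" "lo \<le> a" "b \<le> hi" for a b
    using that
  proof (induction b rule: int_ge_induct)
    case base
    then show ?case using assms(1) by auto
  next
    case (step b)
    then show ?case using assms(1)[of "b + 1"] by auto
  qed
  have w: "nweight K U A B = nweight K U' A B"
    if "\<And>i. i < K \<Longrightarrow> lo \<le> A i \<and> B i \<le> hi" "nstep K k A B" for A B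
    unfolding nweight_def using that nstep_mono[OF that(2)] by (intro sum.cong refl *) auto
  then show ?thesis
    unfolding net_eqv_def net_le_def reach_singleton using assms(2) by (metis order_refl)
qed

text \<open>No position lies to the left of \<open>lo\<close>, so a threshold that is at most
  \<open>lo\<close> freezes nothing and may be replaced by any other such threshold.\<close>

lemma net_eqv_low:
  assumes "\<And>c. lo \<le> c \<Longrightarrow> c \<le> hi \<Longrightarrow> U c - U (c - 1) = U' c - U' (c - 1)" "k \<le> lo" "k' \<le> lo"
  shows "net_eqv K lo hi [(k, U)] [(k', U')]"
  using assms(2,3) by (intro net_eqv_single assms(1)) (force simp: nstep_def)+

lemma net_eqv_map:
  assumes "\<And>i. i \<in> set is \<Longrightarrow> net_eqv K lo hi [f i] [g i]"
  shows "net_eqv K lo hi (map f is) (map g is)"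
  using assms
proof (induction "is")
  case (Cons i "is")
  then have "net_eqv K lo hi ([f i] @ map f is) ([g i] @ map g is)"
    by (intro net_eqv_append) auto
  then show ?case by simp
qed (simp add: net_eqv_refl)

lemma reach_shift:
  "reach K (map (\<lambda>(k, U). (k + t, \<lambda>c. U (c - t))) n) (\<lambda>i. A i + t) (\<lambda>i. B i + t) w \<longleftrightarrow> reach K n A B w"
proof (induction n arbitrary: A w)
  case Nil
  show ?case by (auto simp: fun_eq_iff)
next
  case (Cons p n)
  obtain k U where p: "p = (k, U)" by (cases p)
  let ?n = "map (\<lambda>(k, U). (k + t, \<lambda>c. U (c - t))) n"
  have st: "nstep K (k + t) (\<lambda>i. A i + t) (\<lambda>i. C i + t) \<longleftrightarrow> nstep K k A C" for C
    unfolding nstep_def by auto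
  have we: "nweight K (\<lambda>c. U (c - t)) (\<lambda>i. A i + t) (\<lambda>i. C i + t) = nweight K U A C" for C
    unfolding nweight_def by (simp add: algebra_simps)
  \<comment> \<open>Every choice of next positions is a translate by \<open>t\<close>, so the
    existential quantifier in \<open>reach\<close> may range over translates.\<close>
  have ex: "(\<exists>C. P C) \<longleftrightarrow> (\<exists>C. P (\<lambda>i. C i + t))" for P :: "(nat \<Rightarrow> int) \<Rightarrow> bool"
  proof
    assume "\<exists>C. P C" then obtain C where "P C" ..
    then have "P (\<lambda>i. (C i - t) + t)" by simp
    then show "\<exists>C. P (\<lambda>i. C i + t)" by (rule exI[of _ "\<lambda>i. C i - t"])
  qed auto
  show ?case
    by (simp add: p, subst ex) (simp add: st we Cons.IH)
qed

lemma net_eqv_shift: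
  assumes "net_eqv K lo hi n n'"
  shows "net_eqv K (lo + t) (hi + t) (map (\<lambda>(k, U). (k + t, \<lambda>c. U (c - t))) n)
           (map (\<lambda>(k, U). (k + t, \<lambda>c. U (c - t))) n')"
proof -
  let ?s = "map (\<lambda>(k, U). (k + t, \<lambda>c. U (c - t :: int) :: real))"
  have "net_le K (lo + t) (hi + t) (?s n) (?s n')" if le: "net_le K lo hi n n'" for n n'
  proof (rule net_leI)
    fix A B w assume b: "\<And>i. i < K \<Longrightarrow> lo + t \<le> A i \<and> B i \<le> hi + t" and r: "reach K (?s n) A B w"
    have "reach K n (\<lambda>i. A i - t) (\<lambda>i. B i - t) w"
      using r reach_shift[of K t n "\<lambda>i. A i - t" "\<lambda>i. B i - t" w] by simp
    then have r': "reach K n (\<lambda>i. A i - t) (\<lambda>i. B i - t) w" .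
    have c: "lo \<le> A i - t \<and> B i - t \<le> hi" if "i < K" for i
      using b[OF that] by auto
    from net_leD[OF le r' c] obtain w' where "w' \<ge> w" "reach K n' (\<lambda>i. A i - t) (\<lambda>i. B i - t) w'"
      by metis
    then show "\<exists>w'\<ge>w. reach K (?s n') A B w'"
      using reach_shift[of K t n' "\<lambda>i. A i - t" "\<lambda>i. B i - t" w'] by auto
  qed
  with assms show ?thesis unfolding net_eqv_def by blast
qed

section \<open>Running maxima\<close>

lemma run_max_attained:
  fixes \<mu> g :: "int \<Rightarrow> real"
  assumes "\<And>c. t < c \<Longrightarrow> c \<le> q \<Longrightarrow> \<mu> c = max (\<mu> (c - 1)) (g c)" "t \<le> q"
  shows "\<mu> q = \<mu> t \<or> (\<exists>c. t < c \<and> c \<le> q \<and> g c = \<mu> q)"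
  using assms(2,1)
proof (induction q rule: int_ge_induct)
  case (step q)
  then have IH: "\<mu> q = \<mu> t \<or> (\<exists>c. t < c \<and> c \<le> q \<and> g c = \<mu> q)" by auto
  have "\<mu> (q + 1) = max (\<mu> q) (g (q + 1))" using step.prems[of "q + 1"] step.hyps by simp
  then consider "\<mu> (q + 1) = \<mu> q" | "g (q + 1) = \<mu> (q + 1)" by linarith
  then show ?case
  proof cases
    case 1 with IH show ?thesis by force
  next
    case 2 with step.hyps show ?thesis by force
  qed
qed simp

lemma run_max_mono:
  fixes \<mu> g :: "int \<Rightarrow> real"
  assumes "\<And>c. t < c \<Longrightarrow> c \<le> q \<Longrightarrow> \<mu> c = max (\<mu> (c - 1)) (g c)" "t \<le> q"
  shows "\<mu> t \<le> \<mu> q"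
  using assms(2,1)
proof (induction q rule: int_ge_induct)
  case (step q)
  then have "\<mu> t \<le> \<mu> q" by auto
  moreover have "\<mu> (q + 1) = max (\<mu> q) (g (q + 1))" using step.prems[of "q + 1"] step.hyps by simp
  ultimately show ?case by linarith
qed simp

text \<open>The witness is the first rise of the maximum above its initial value. In the exchange
  move, \<open>g c - mu c - mu (c - 1)\<close> equals \<open>- mu t\<close> there, the value that
  Pitman's identity asks for.\<close>

lemma run_max_first:
  fixes \<mu> g :: "int \<Rightarrow> real"
  assumes "\<And>c. t < c \<Longrightarrow> c \<le> q \<Longrightarrow> \<mu> c = max (\<mu> (c - 1)) (g c)" "t \<le> q" "\<mu> t < \<mu> q"
  shows "\<exists>c. t < c \<and> c \<le> q \<and> \<mu> (c - 1) = \<mu> t \<and> \<mu> c = g c"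
  using assms(2,1,3)
proof (induction q rule: int_ge_induct)
  case (step q)
  show ?case
  proof (cases "\<mu> t < \<mu> q")
    case True
    then have "\<exists>c>t. c \<le> q \<and> \<mu> (c - 1) = \<mu> t \<and> \<mu> c = g c" using step by auto
    then show ?thesis by force
  next
    case False
    have "\<mu> t \<le> \<mu> q" using run_max_mono[of t q \<mu> g] step by auto
    with False have "\<mu> q = \<mu> t" by simp
    moreover have "\<mu> (q + 1) = max (\<mu> q) (g (q + 1))" using step.prems(1)[of "q + 1"] step.hyps by simp
    ultimately show ?thesis using step.prems(2) step.hyps by (intro exI[of _ "q + 1"]) auto
  qed
qed simp

text \<open>The exchange move. With \<open>\<mu> = V' - V\<close>, the running maximum of \<open>g c = U c - V (c - 1)\<close>, the
  intermediate positions of a system in two levels vary independently over disjoint intervals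
  \<open>{p..q}\<close>, and Pitman's identity says that the maximum of \<open>g' c = U' c - V' (c - 1)\<close> over such an
  interval is the maximum of \<open>g\<close> diminished by \<open>\<mu> (p - 1) + \<mu> q\<close>.\<close>

locale exchange =
  fixes k hi :: int and U V U' V' :: "int \<Rightarrow> real"
  assumes zero: "\<And>c. c < k \<Longrightarrow> U c = 0 \<and> V c = 0 \<and> U' c = 0 \<and> V' c = 0"
    and total: "\<And>c. k \<le> c \<Longrightarrow> c \<le> hi \<Longrightarrow> U' c + V' c = U c + V c"
    and start: "k \<le> hi \<Longrightarrow> V' k = U k + V k"
    and rec: "\<And>c. k < c \<Longrightarrow> c \<le> hi \<Longrightarrow> V' c = V c - V (c - 1) + max (V' (c - 1)) (U c)"
begin

definition "mu c = V' c - V c"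
definition "g c = U c - V (c - 1)"
definition "g' c = U' c - V' (c - 1)"

lemma mu_rec: "k < c \<Longrightarrow> c \<le> hi \<Longrightarrow> mu c = max (mu (c - 1)) (g c)"
  using rec[of c] unfolding mu_def g_def by (simp add: max_def)

lemma mu_low: "c < k \<Longrightarrow> mu c = 0"
  using zero unfolding mu_def by auto

lemma mu_start: "k \<le> hi \<Longrightarrow> mu k = g k"
  using start zero[of "k - 1"] unfolding mu_def g_def by auto

text \<open>Conservation of the total gives \<open>U' c = U c - mu c\<close>, and
  \<open>V' (c - 1) = V (c - 1) + mu (c - 1)\<close> by definition.\<close>

lemma g'_eq: "c \<le> hi \<Longrightarrow> g' c = g c - mu c - mu (c - 1)"
  using total[of c] zero[of c] unfolding g'_def g_def mu_def by (cases "k \<le> c") auto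

text \<open>For \<open>k < p\<close>: if the running maximum rises on the interval, the place of the
  first rise is a good \<open>c'\<close>, since \<open>g' c' = - mu (p - 1)\<close>; otherwise
  \<open>mu\<close> is constant from \<open>p - 1\<close> to \<open>q\<close> and
  \<open>c' = c\<close> works. The clause \<open>c' = p\<close> for \<open>p \<le> k\<close> is what
  the raised threshold \<open>k + 1\<close> of the first new level demands.\<close>

lemma forward:
  assumes "p \<le> c" "c \<le> q" "q \<le> hi" "q < k \<longrightarrow> p = q" "p \<le> k \<longrightarrow> p = k \<or> q < k"
  shows "\<exists>c'. p \<le> c' \<and> c' \<le> q \<and> (p \<le> k \<longrightarrow> c' = p) \<and> g c \<le> g' c' + mu (p - 1) + mu q"
proof -
  consider "q < k" | "p = k" "k \<le> q" | "k < p" using assms by linarith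
  then show ?thesis
  proof cases
    case 1
    with assms(1,2,4) have [simp]: "q = c" "p = c" by auto
    have "mu c = 0" "mu (c - 1) = 0" "g' c = g c - mu c - mu (c - 1)"
      using 1 assms(3) by (auto intro!: mu_low g'_eq)
    then show ?thesis by (intro exI[of _ c]) simp
  next
    case 2
    have "g c \<le> mu c"
      using mu_rec[of c] mu_start assms(1-3) 2 by (cases "c = k") auto
    also have "mu c \<le> mu q"
      by (rule run_max_mono[of _ _ mu g]) (use assms(1-3) 2 in \<open>auto intro!: mu_rec\<close>)
    finally have "g c \<le> mu q" .
    \<comment> \<open>Hence \<open>g' k = 0\<close>: at the left border the right-hand side is just
      \<open>mu q\<close>.\<close>
    moreover have "mu (k - 1) = 0" "g' k = g k - mu k - mu (k - 1)" "mu k = g k"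
      using 2 assms(3) by (auto intro!: mu_low g'_eq mu_start)
    ultimately show ?thesis using 2 by (intro exI[of _ k]) simp
  next
    case 3
    have rec: "mu c' = max (mu (c' - 1)) (g c')" if "p - 1 < c'" "c' \<le> q" for c'
      by (rule mu_rec) (use that 3 assms(3) in auto)
    have g'c: "g' c' = g c' - mu c' - mu (c' - 1)" if "c' \<le> q" for c'
      by (rule g'_eq) (use that assms(3) in simp)
    have m1: "mu (p - 1) \<le> mu (c - 1)"
      by (rule run_max_mono[of _ _ mu g]) (use assms(1,2) in \<open>auto intro!: rec\<close>)
    have m2: "mu (c - 1) \<le> mu c" "g c \<le> mu c" using rec[of c] assms(1,2) by auto
    have m3: "mu c \<le> mu q"
      by (rule run_max_mono[of _ _ mu g]) (use assms(1,2) in \<open>auto intro!: rec\<close>)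
    show ?thesis
    proof (cases "mu (p - 1) < mu q")
      case True
      then obtain c' where "p - 1 < c'" "c' \<le> q" "mu (c' - 1) = mu (p - 1)" "mu c' = g c'"
        using run_max_first[of "p - 1" q mu g] rec assms(1,2) by auto
      then show ?thesis using m2 m3 3 g'c[of c'] by (intro exI[of _ c']) simp
    next
      case False
      then show ?thesis using m1 m2 m3 assms(1,2) 3 g'c[of c] by (intro exI[of _ c]) simp
    qed
  qed
qed

text \<open>For \<open>k < p\<close>: if \<open>mu q\<close> is attained by \<open>g\<close> at some
  \<open>c' > c\<close>, then \<open>g c \<le> mu c\<close> and
  \<open>mu (p - 1) \<le> mu (c - 1)\<close> bound the left-hand side by \<open>mu q = g c'\<close>.
  Otherwise \<open>mu q = mu c\<close>, and \<open>c' = c\<close> works.\<close>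

lemma backward:
  assumes "p \<le> c" "c \<le> q" "q \<le> hi" "q < k \<longrightarrow> p = q" "p \<le> k \<longrightarrow> c = p" "p \<le> k \<longrightarrow> p = k \<or> q < k"
  shows "\<exists>c'. p \<le> c' \<and> c' \<le> q \<and> g' c + mu (p - 1) + mu q \<le> g c'"
proof -
  consider "q < k" | "p = k" "k \<le> q" | "k < p" using assms by linarith
  then show ?thesis
  proof cases
    case 1
    with assms(1,2,4) have [simp]: "q = c" "p = c" by auto
    have "mu c = 0" "mu (c - 1) = 0" "g' c = g c - mu c - mu (c - 1)"
      using 1 assms(3) by (auto intro!: mu_low g'_eq)
    then show ?thesis by (intro exI[of _ c]) simp
  next
    case 2
    have "mu q = mu k \<or> (\<exists>c. k < c \<and> c \<le> q \<and> g c = mu q)"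
      by (rule run_max_attained) (use assms(3) 2 in \<open>auto intro!: mu_rec\<close>)
    moreover have "mu k = g k" using mu_start 2 assms(3) by simp
    ultimately obtain c' where c': "k \<le> c'" "c' \<le> q" "g c' = mu q"
      using 2 by (metis order.refl less_imp_le)
    have "mu (k - 1) = 0" "g' k = g k - mu k - mu (k - 1)"
      using 2 assms(3) by (auto intro!: mu_low g'_eq)
    then have "g' c + mu (p - 1) + mu q \<le> g c'" using c'(3) \<open>mu k = g k\<close> 2 assms(5) by simp
    with c' 2 show ?thesis by (intro exI[of _ c']) simp
  next
    case 3
    have rec: "mu c' = max (mu (c' - 1)) (g c')" if "p - 1 < c'" "c' \<le> q" for c'
      by (rule mu_rec) (use that 3 assms(3) in auto)
    have g'c: "g' c' = g c' - mu c' - mu (c' - 1)" if "c' \<le> q" for c'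
      by (rule g'_eq) (use that assms(3) in simp)
    have m1: "mu (p - 1) \<le> mu (c - 1)"
      by (rule run_max_mono[of _ _ mu g]) (use assms(1,2) in \<open>auto intro!: rec\<close>)
    have m2: "mu (c - 1) \<le> mu c" "g c \<le> mu c" using rec[of c] assms(1,2) by auto
    have "mu q = mu c \<or> (\<exists>c'. c < c' \<and> c' \<le> q \<and> g c' = mu q)"
      by (rule run_max_attained) (use assms(1,2) in \<open>auto intro!: rec\<close>)
    then show ?thesis
    proof
      assume "mu q = mu c"
      then show ?thesis using m1 assms(1,2) g'c[of c] by (intro exI[of _ c]) simp
    next
      assume "\<exists>c'. c < c' \<and> c' \<le> q \<and> g c' = mu q"
      then obtain c' where "c < c'" "c' \<le> q" "g c' = mu q" by blast
      then show ?thesis using m1 m2 assms(1,2) g'c[of c] by (intro exI[of _ c']) simp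
    qed
  qed
qed

text \<open>With \<open>upper\<close>, the range of the \<open>i\<close>-th intermediate position
  \<open>C i\<close> between given ends: besides \<open>A i \<le> C i \<le> B i\<close>, separation
  in the two levels asks for \<open>B (i - 1) < C i\<close> and \<open>C i < A (i + 1)\<close>. No
  condition links two intermediate positions.\<close>

definition lower :: "(nat \<Rightarrow> int) \<Rightarrow> (nat \<Rightarrow> int) \<Rightarrow> nat \<Rightarrow> int" where
  "lower A B i = (if i = 0 then A 0 else max (A i) (B (i - 1) + 1))"
definition upper :: "nat \<Rightarrow> (nat \<Rightarrow> int) \<Rightarrow> (nat \<Rightarrow> int) \<Rightarrow> nat \<Rightarrow> int" where
  "upper K A B i = (if Suc i < K then min (B i) (A (Suc i) - 1) else B i)"

text \<open>\<open>upper i\<close> and \<open>lower (i + 1) - 1\<close> are the minimum and the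
  maximum of the two numbers \<open>B i\<close> and \<open>A (i + 1) - 1\<close>, so both sums have
  the same terms.\<close>

lemma sum_bounds:
  fixes A B :: "nat \<Rightarrow> int"
  shows "(\<Sum>i<K. mu (B i) + mu (A i - 1)) = (\<Sum>i<K. mu (upper K A B i) + mu (lower A B i - 1))"
proof (cases K)
  case (Suc n)
  have pt: "mu (upper K A B i) + mu (lower A B (Suc i) - 1) = mu (B i) + mu (A (Suc i) - 1)" if "i < n" for i
    using that Suc by (cases "A (Suc i) = B i + 1") (auto simp: upper_def lower_def max_def min_def)
  have "(\<Sum>i<K. mu (upper K A B i) + mu (lower A B i - 1))
      = (\<Sum>i<K. mu (upper K A B i)) + (\<Sum>i<K. mu (lower A B i - 1))" by (rule sum.distrib)
  also have "\<dots> = (\<Sum>i<n. mu (upper K A B i)) + mu (B n) + (mu (A 0 - 1) + (\<Sum>i<n. mu (lower A B (Suc i) - 1)))"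
    unfolding Suc sum.lessThan_Suc_shift[of "\<lambda>i. mu (lower A B i - 1)"] by (simp add: upper_def lower_def)
  also have "\<dots> = (\<Sum>i<n. mu (B i) + mu (A (Suc i) - 1)) + mu (B n) + mu (A 0 - 1)"
    using pt by (simp add: sum.distrib[symmetric])
  also have "\<dots> = (\<Sum>i<K. mu (B i)) + (\<Sum>i<K. mu (A i - 1))"
    unfolding Suc sum.lessThan_Suc_shift[of "\<lambda>i. mu (A i - 1)"] by (simp add: sum.distrib)
  finally show ?thesis by (simp add: sum.distrib)
qed simp

lemma weights:
  fixes A B C C' :: "nat \<Rightarrow> int"
  assumes "\<And>i. i < K \<Longrightarrow> B i \<le> hi" "\<And>i. i < K \<Longrightarrow> A i \<le> B i"
  shows "nweight K U' A C' + nweight K V' C' B - (nweight K U A C + nweight K V C B) =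
    (\<Sum>i<K. g' (C' i) + mu (lower A B i - 1) + mu (upper K A B i) - g (C i))"
proof -
  \<comment> \<open>At the ends \<open>V' = V + mu\<close> and \<open>U' = U - mu\<close>; this is
    where the correction terms come from.\<close>
  have 1: "V' (B i) - U' (A i - 1) = V (B i) - U (A i - 1) + (mu (B i) + mu (A i - 1))" if "i < K" for i
    using total[of "A i - 1"] zero[of "A i - 1"] assms[OF that] by (cases "k \<le> A i - 1") (auto simp: mu_def)
  have "nweight K U' A C' + nweight K V' C' B - (nweight K U A C + nweight K V C B) =
    (\<Sum>i<K. (V' (B i) - U' (A i - 1) - (V (B i) - U (A i - 1))) + (g' (C' i) - g (C i)))"
    unfolding nweight_def by (simp add: sum.distrib sum_subtractf g_def g'_def)
  also have "\<dots> = (\<Sum>i<K. (mu (B i) + mu (A i - 1)) + (g' (C' i) - g (C i)))"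
    using 1 by (intro sum.cong) auto
  also have "\<dots> = (\<Sum>i<K. mu (upper K A B i) + mu (lower A B i - 1)) + (\<Sum>i<K. g' (C' i) - g (C i))"
    using sum_bounds[of B A K] by (subst sum.distrib) (rule arg_cong2[of _ _ _ _ "(+)"], auto)
  finally show ?thesis unfolding sum.distrib sum_subtractf by linarith
qed

text \<open>Both thresholds of the first level are treated at once: \<open>l = k\<close> before and
  \<open>l = k + 1\<close> after the exchange. A start \<open>A i \<le> k\<close> is its own lower
  bound because the preceding position lies further left, is frozen and cannot push.\<close>

lemma two_steps:
  assumes AC: "nstep K l A C" and CB: "nstep K l' C B" and l: "l = k \<or> l = k + 1" "l' = k"
    and i: "i < K"
  shows "lower A B i \<le> C i" "C i \<le> upper K A B i" "upper K A B i < k \<longrightarrow> lower A B i = upper K A B i"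
    "lower A B i \<le> k \<longrightarrow> lower A B i = k \<or> upper K A B i < k"
    "lower A B i \<le> k \<longrightarrow> A i \<le> k"
    "A i \<le> k \<longrightarrow> lower A B i = A i"
proof -
  have le: "A i \<le> C i" "C i \<le> B i" using nstep_mono[OF AC i] nstep_mono[OF CB i] .
  show l1: "lower A B i \<le> C i"
  proof (cases i)
    case (Suc j)
    with CB i have "B j < C i" unfolding nstep_def by simp
    with le Suc show ?thesis by (simp add: lower_def)
  qed (use le in \<open>simp add: lower_def\<close>)
  show u: "C i \<le> upper K A B i"
    using le AC i unfolding upper_def nstep_def by simp
  have stay: "A j = C j \<and> C j = B j" if "A j < k" "j < K" for j
  proof -
    have "C j = A j" using AC that l(1) unfolding nstep_def by (auto split: if_splits)
    moreover from this have "B j = C j" using CB that l(2) unfolding nstep_def by (auto split: if_splits)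
    ultimately show ?thesis by simp
  qed
  show "A i \<le> k \<longrightarrow> lower A B i = A i"
  proof
    assume Ai: "A i \<le> k"
    show "lower A B i = A i"
    proof (cases i)
      case (Suc j)
      then have j: "C j < A i" "j < K" using AC i unfolding nstep_def by auto
      then have "C j < k" using Ai by simp
      then have "B j = C j" using CB j(2) l(2) unfolding nstep_def by (auto split: if_splits)
      with j Suc show ?thesis by (simp add: lower_def)
    qed (simp add: lower_def)
  qed
  have uB: "upper K A B i \<le> B i" by (simp add: upper_def)
  have lA: "A i \<le> lower A B i" by (simp add: lower_def)
  show "upper K A B i < k \<longrightarrow> lower A B i = upper K A B i"
    using stay[OF _ i] l1 u uB lA le by linarith
  show "lower A B i \<le> k \<longrightarrow> lower A B i = k \<or> upper K A B i < k"
    using stay[OF _ i] l1 uB lA by linarith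
  show "lower A B i \<le> k \<longrightarrow> A i \<le> k" using lA by simp
qed

text \<open>Conversely to \<open>two_steps\<close>, positions chosen one by one within their ranges
  satisfy the order and separation conditions of both levels.\<close>

lemma in_bounds_step:
  assumes bd: "\<forall>i<K. lower A B i \<le> C i \<and> C i \<le> upper K A B i" and i: "i < K"
  shows "A i \<le> C i" "C i \<le> B i" "Suc i < K \<Longrightarrow> C i < A (Suc i)" "Suc i < K \<Longrightarrow> B i < C (Suc i)"
proof -
  have "A i \<le> lower A B i" "upper K A B i \<le> B i" by (simp_all add: lower_def upper_def)
  then show "A i \<le> C i" "C i \<le> B i" using bd i by fastforce+
  assume S: "Suc i < K"
  from bd i have "C i \<le> upper K A B i" by blast
  with S show "C i < A (Suc i)" by (simp add: upper_def)
  from bd S have "lower A B (Suc i) \<le> C (Suc i)" by blast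
  then show "B i < C (Suc i)" by (simp add: lower_def)
qed

lemma net_eqv: "net_eqv K lo hi [(k, U), (k, V)] [(k + 1, U'), (k, V')]"
  unfolding net_eqv_def
proof
  show "net_le K lo hi [(k, U), (k, V)] [(k + 1, U'), (k, V')]"
  proof (rule net_leI)
    fix A B w assume b: "\<And>i. i < K \<Longrightarrow> lo \<le> A i \<and> B i \<le> hi" and "reach K [(k, U), (k, V)] A B w"
    then obtain C where C: "nstep K k A C" "nstep K k C B" and w: "w = nweight K U A C + nweight K V C B"
      by auto
    note ts = two_steps[OF C disjI1[OF refl] refl]
    have "\<exists>c'. lower A B i \<le> c' \<and> c' \<le> upper K A B i \<and> (lower A B i \<le> k \<longrightarrow> c' = lower A B i) \<and>
       g (C i) \<le> g' c' + mu (lower A B i - 1) + mu (upper K A B i)" if "i < K" for i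
    proof -
      have "upper K A B i \<le> B i" by (simp add: upper_def)
      with b[OF that] have "upper K A B i \<le> hi" by simp
      from forward[OF ts(1,2)[OF that] this ts(3,4)[OF that]] show ?thesis .
    qed
    then obtain C' where C': "\<And>i. i < K \<Longrightarrow> lower A B i \<le> C' i \<and> C' i \<le> upper K A B i \<and>
       (lower A B i \<le> k \<longrightarrow> C' i = lower A B i) \<and>
       g (C i) \<le> g' (C' i) + mu (lower A B i - 1) + mu (upper K A B i)" by metis
    have ib: "\<forall>i<K. lower A B i \<le> C' i \<and> C' i \<le> upper K A B i" using C' by blast
    note step = in_bounds_step[OF ib]
    have s1: "nstep K (k + 1) A C'"
      unfolding nstep_def
    proof (intro conjI allI impI)
      fix i assume i: "i < K"
      show "if A i < k + 1 then C' i = A i else A i \<le> C' i"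
        using step(1)[OF i] C'[OF i] ts(6)[OF i] by auto
    qed (use step(3) in simp)
    have s2: "nstep K k C' B"
      unfolding nstep_def
    proof (intro conjI allI impI)
      fix i assume i: "i < K"
      show "if C' i < k then B i = C' i else C' i \<le> B i"
      proof (cases "C' i < k")
        case True
        then have "A i < k" using step(1)[OF i] by simp
        then have "C i = A i" using C(1) i unfolding nstep_def by (auto split: if_splits)
        moreover from this have "B i = C i"
          using \<open>A i < k\<close> C(2) i unfolding nstep_def by (auto split: if_splits)
        ultimately show ?thesis using step(1,2)[OF i] True by simp
      qed (use step(2)[OF i] in simp)
    qed (use step(4) in simp)
    have AB: "A i \<le> B i" if "i < K" for i using step(1,2)[OF that] by simp
    have "0 \<le> (\<Sum>i<K. g' (C' i) + mu (lower A B i - 1) + mu (upper K A B i) - g (C i))"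
      using C' by (intro sum_nonneg) auto
    then have "w \<le> nweight K U' A C' + nweight K V' C' B"
      using weights[of K B A C' C, OF conjunct2[OF b] AB] w by simp
    moreover have "reach K [(k + 1, U'), (k, V')] A B (nweight K U' A C' + nweight K V' C' B)"
      by (rule reach_twoI[OF s1 s2])
    ultimately show "\<exists>w'\<ge>w. reach K [(k + 1, U'), (k, V')] A B w'" by blast
  qed
  show "net_le K lo hi [(k + 1, U'), (k, V')] [(k, U), (k, V)]"
  proof (rule net_leI)
    fix A B w assume b: "\<And>i. i < K \<Longrightarrow> lo \<le> A i \<and> B i \<le> hi" and "reach K [(k + 1, U'), (k, V')] A B w"
    then obtain C where C: "nstep K (k + 1) A C" "nstep K k C B"
      and w: "w = nweight K U' A C + nweight K V' C B"
      by auto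
    note ts = two_steps[OF C disjI2[OF refl] refl]
    have "\<exists>c'. lower A B i \<le> c' \<and> c' \<le> upper K A B i \<and>
       g' (C i) + mu (lower A B i - 1) + mu (upper K A B i) \<le> g c'" if "i < K" for i
    proof -
      have "upper K A B i \<le> B i" by (simp add: upper_def)
      with b[OF that] have hi: "upper K A B i \<le> hi" by simp
      \<comment> \<open>Threshold \<open>k + 1\<close> also pins a start at \<open>k\<close> itself,
        which supplies the hypothesis \<open>c = p\<close> of \<open>backward\<close>.\<close>
      have "A i < k + 1 \<Longrightarrow> C i = A i" using C(1) that unfolding nstep_def by presburger
      then have "lower A B i \<le> k \<longrightarrow> C i = lower A B i"
        using ts(5)[OF that] ts(6)[OF that] by (metis zless_add1_eq le_less)
      from backward[OF ts(1,2)[OF that] hi ts(3)[OF that] this ts(4)[OF that]] show ?thesis .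
    qed
    then obtain C' where C': "\<And>i. i < K \<Longrightarrow> lower A B i \<le> C' i \<and> C' i \<le> upper K A B i \<and>
       g' (C i) + mu (lower A B i - 1) + mu (upper K A B i) \<le> g (C' i)" by metis
    have ib: "\<forall>i<K. lower A B i \<le> C' i \<and> C' i \<le> upper K A B i" using C' by blast
    note step = in_bounds_step[OF ib]
    have AB: "B i = A i" if "A i < k" "i < K" for i
    proof -
      have "A i < k + 1" using that by simp
      then have "C i = A i" using C(1) that(2) unfolding nstep_def by presburger
      then show ?thesis using C(2) that unfolding nstep_def by metis
    qed
    have s1: "nstep K k A C'"
      unfolding nstep_def
    proof (intro conjI allI impI)
      fix i assume i: "i < K"
      show "if A i < k then C' i = A i else A i \<le> C' i"
        using step(1,2)[OF i] AB[OF _ i] by auto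
    qed (use step(3) in simp)
    have s2: "nstep K k C' B"
      unfolding nstep_def
    proof (intro conjI allI impI)
      fix i assume i: "i < K"
      show "if C' i < k then B i = C' i else C' i \<le> B i"
        using step(1,2)[OF i] AB[OF _ i] by auto
    qed (use step(4) in simp)
    have AB': "A i \<le> B i" if "i < K" for i using step(1,2)[OF that] by simp
    have "(\<Sum>i<K. g' (C i) + mu (lower A B i - 1) + mu (upper K A B i) - g (C' i)) \<le> 0"
      using C' by (intro sum_nonpos) auto
    then have "w \<le> nweight K U A C' + nweight K V C' B"
      using weights[of K B A C C', OF conjunct2[OF b] AB'] w by simp
    moreover have "reach K [(k, U), (k, V)] A B (nweight K U A C' + nweight K V C' B)"
      by (rule reach_twoI[OF s1 s2])
    ultimately show "\<exists>w'\<ge>w. reach K [(k, U), (k, V)] A B w'" by blast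
  qed
qed

end

subsection \<open>Normal forms and Greene's theorem\<close>

text \<open>The weight inserted into part \<open>l\<close> at box \<open>(i, j)\<close>: the label
  itself for \<open>l = 1\<close>, and otherwise what insertion bumps out of part
  \<open>l - 1\<close>.\<close>

definition ins_weight :: "(int \<Rightarrow> int \<Rightarrow> real) \<Rightarrow> (int \<Rightarrow> int \<Rightarrow> int \<Rightarrow> real) \<Rightarrow> int \<Rightarrow> int \<Rightarrow> int \<Rightarrow> real" where
  "ins_weight x L l i j = (if l = 1 then x i j
     else min (L (l - 1) (i - 1) j) (L (l - 1) i (j - 1)) - L (l - 1) (i - 1) (j - 1))"

text \<open>\<open>L l i j\<close> is the \<open>l\<close>-th part of the shape attached to the rectangle \<open>[1, i] \<times> [1, j]\<close>;
  the recursion is the local rule of the piecewise-linear RSK correspondence.\<close>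

definition ins_array ::
    "int \<Rightarrow> int \<Rightarrow> (int \<Rightarrow> int \<Rightarrow> real) \<Rightarrow> (int \<Rightarrow> int \<Rightarrow> int \<Rightarrow> real) \<Rightarrow> bool" where
  "ins_array r s x L \<longleftrightarrow> (\<forall>l i j. 1 \<le> l \<and> l \<le> i \<and> l \<le> j \<and> i \<le> r \<and> j \<le> s \<longrightarrow>
     L l i j = ins_weight x L l i j +
       (if i = l \<and> j = l then 0 else if i = l then L l i (j - 1)
        else if j = l then L l (i - 1) j else max (L l (i - 1) j) (L l i (j - 1))))"

lemma ins_array_rec:
  assumes "ins_array r s x L" "1 \<le> l" "l \<le> i" "l \<le> j" "i \<le> r" "j \<le> s"
  shows "L l i j = ins_weight x L l i j +
       (if i = l \<and> j = l then 0 else if i = l then L l i (j - 1)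
        else if j = l then L l (i - 1) j else max (L l (i - 1) j) (L l i (j - 1)))"
  by (rule assms(1)[unfolded ins_array_def, rule_format]) (use assms in simp)

text \<open>The local rule is symmetric in \<open>i\<close> and \<open>j\<close>. This is why rows
  and columns of \<open>x\<close> are governed by the same shapes.\<close>

lemma ins_array_transpose:
  assumes "ins_array r s x L"
  shows "ins_array s r (\<lambda>i j. x j i) (\<lambda>l i j. L l j i)"
  unfolding ins_array_def
proof (intro allI impI)
  fix l i j assume *: "1 \<le> l \<and> l \<le> i \<and> l \<le> j \<and> i \<le> s \<and> j \<le> r"
  have "ins_weight (\<lambda>i j. x j i) (\<lambda>l i j. L l j i) l i j = ins_weight x L l j i"
    by (simp add: ins_weight_def min.commute)
  moreover have "L l j i = ins_weight x L l j i +
       (if j = l \<and> i = l then 0 else if j = l then L l j (i - 1)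
        else if i = l then L l (j - 1) i else max (L l (j - 1) i) (L l j (i - 1)))"
    by (rule ins_array_rec[OF assms]) (use * in simp_all)
  ultimately show "L l j i = ins_weight (\<lambda>i j. x j i) (\<lambda>l i j. L l j i) l i j +
       (if i = l \<and> j = l then 0 else if i = l then L l (j - 1) i
        else if j = l then L l j (i - 1) else max (L l j (i - 1)) (L l (j - 1) i))"
    by (cases "i = l"; cases "j = l"; simp add: max.commute)
qed

definition psum :: "int \<Rightarrow> (int \<Rightarrow> real) \<Rightarrow> int \<Rightarrow> real" where
  "psum a f c = (\<Sum>j\<in>{a..c}. f j)"

lemma psum_low: "c < a \<Longrightarrow> psum a f c = 0"
  by (simp add: psum_def)

lemma psum_step: "a \<le> c \<Longrightarrow> psum a f c = psum a f (c - 1) + f c"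
proof -
  assume "a \<le> c"
  then have "{a..c} = insert c {a..c - 1}" by auto
  then show ?thesis by (simp add: psum_def)
qed

abbreviation cut :: "int \<Rightarrow> (int \<Rightarrow> real) \<Rightarrow> int \<Rightarrow> real" where
  "cut a f \<equiv> \<lambda>c. if c < a then 0 else f c"

text \<open>\<open>L l i\<close> has a meaning only from column \<open>l\<close> on;
  \<open>cut\<close> supplies the zeros that \<open>exchange\<close> expects to the left of the
  threshold.\<close>

abbreviation level :: "(int \<Rightarrow> int \<Rightarrow> int \<Rightarrow> real) \<Rightarrow> int \<Rightarrow> int \<Rightarrow> int \<times> (int \<Rightarrow> real)" where
  "level L i l \<equiv> (l, cut l (L l i))"

text \<open>The form in which the exchange is applied: the second level enters as a row of weights
  \<open>v\<close>, and the first one leaves as a row of bumped weights \<open>w\<close>.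
  Conservation of the total is an induction on the column based on
  \<open>max a b + min a b = a + b\<close>.\<close>

lemma exchange_by_weights:
  fixes v w :: "int \<Rightarrow> real"
  assumes "\<And>c. c < k \<Longrightarrow> U c = 0 \<and> V' c = 0"
    and "k \<le> hi \<Longrightarrow> V' k = v k + U k"
    and "\<And>c. k < c \<Longrightarrow> c \<le> hi \<Longrightarrow> V' c = v c + max (V' (c - 1)) (U c)"
    and "\<And>c. k < c \<Longrightarrow> c \<le> hi \<Longrightarrow> w c = min (V' (c - 1)) (U c) - U (c - 1)"
  shows "exchange k hi U (psum k v) (psum (k + 1) w) V'"
proof
  fix c
  show "c < k \<Longrightarrow> U c = 0 \<and> psum k v c = 0 \<and> psum (k + 1) w c = 0 \<and> V' c = 0"
    using assms(1) by (simp add: psum_low)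
  show "k < c \<Longrightarrow> c \<le> hi \<Longrightarrow> V' c = psum k v c - psum k v (c - 1) + max (V' (c - 1)) (U c)"
    using assms(3)[of c] psum_step[of k c v] by simp
  show "k \<le> hi \<Longrightarrow> V' k = U k + psum k v k"
    using assms(2) psum_step[of k k v] psum_low[of "k - 1" k v] by simp
  assume "k \<le> c"
  then show "c \<le> hi \<Longrightarrow> psum (k + 1) w c + V' c = U c + psum k v c"
  proof (induction c rule: int_ge_induct)
    case base
    then show ?case using assms(2) psum_step[of k k v] psum_low[of "k - 1" k v] psum_low[of k "k + 1" w] by simp
  next
    case (step c)
    then have IH: "psum (k + 1) w c + V' c = U c + psum k v c" by simp
    have "V' (c + 1) = v (c + 1) + max (V' c) (U (c + 1))" "w (c + 1) = min (V' c) (U (c + 1)) - U c"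
      using assms(3,4)[of "c + 1"] step by simp_all
    moreover have "max (V' c) (U (c + 1)) + min (V' c) (U (c + 1)) = V' c + U (c + 1)" by simp
    moreover have "psum (k + 1) w (c + 1) = psum (k + 1) w c + w (c + 1)" "psum k v (c + 1) = psum k v c + v (c + 1)"
      using psum_step[of "k + 1" "c + 1" w] psum_step[of k "c + 1" v] step by simp_all
    ultimately show ?case using IH by linarith
  qed
qed

lemma ins_array_exchange:
  assumes "ins_array r s x L" "1 \<le> l" "l \<le> i" "i < r"
  shows "exchange l s (cut l (L l i)) (psum l (ins_weight x L l (i + 1)))
     (psum (l + 1) (ins_weight x L (l + 1) (i + 1))) (cut l (L l (i + 1)))"
proof (rule exchange_by_weights)
  have rule: "L l (i + 1) j = ins_weight x L l (i + 1) j +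
       (if j = l then L l i j else max (L l i j) (L l (i + 1) (j - 1)))" if "l \<le> j" "j \<le> s" for j
    using ins_array_rec[OF assms(1), of l "i + 1" j] assms that by (simp split: if_splits)
  show "l \<le> s \<Longrightarrow> cut l (L l (i + 1)) l = ins_weight x L l (i + 1) l + cut l (L l i) l"
    using rule[of l] by simp
  fix c
  show "c < l \<Longrightarrow> cut l (L l i) c = 0 \<and> cut l (L l (i + 1)) c = 0" by simp
  show "l < c \<Longrightarrow> c \<le> s \<Longrightarrow> cut l (L l (i + 1)) c =
      ins_weight x L l (i + 1) c + max (cut l (L l (i + 1)) (c - 1)) (cut l (L l i) c)"
    using rule[of c] by (simp add: max.commute)
  show "l < c \<Longrightarrow> c \<le> s \<Longrightarrow> ins_weight x L (l + 1) (i + 1) c =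
      min (cut l (L l (i + 1)) (c - 1)) (cut l (L l i) c) - cut l (L l i) (c - 1)"
    using assms(2) by (simp add: ins_weight_def min.commute)
qed

lemma net_eqv_pair_map:
  assumes "net_eqv K lo hi [a, b] [c, d]"
  shows "net_eqv K lo hi (n1 @ a # b # n2) (n1 @ c # d # n2)"
proof -
  have "net_eqv K lo hi (n1 @ [a, b] @ n2) (n1 @ [c, d] @ n2)"
    by (intro net_eqv_append net_eqv_refl assms)
  then show ?thesis by simp
qed

text \<open>Row insertion. The levels are listed with level 1 last, so the new row meets level 1
  first; the row that has passed level \<open>l\<close> carries the weights
  \<open>ins_weight x L (l + 1) (i + 1)\<close>.\<close>

lemma net_eqv_insert:
  assumes "ins_array r s x L" "0 \<le> i" "i < r"
  shows "net_eqv K lo s (map (level L i) (rev [1..i]) @ [(1, psum 1 (x (i + 1)))])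
     (map (level L (i + 1)) (rev [1..i + 1]))"
proof -
  \<comment> \<open>Invariant: levels from \<open>l\<close> on still belong to \<open>i\<close>,
    those below \<open>l\<close> already belong to \<open>i + 1\<close>, and the travelling row
    stands between them.\<close>
  have main: "net_eqv K lo s (map (level L i) (rev [1..i]) @ [(1, psum 1 (x (i + 1)))])
     (map (level L i) (rev [l..i]) @ (l, psum l (ins_weight x L l (i + 1))) # map (level L (i + 1)) (rev [1..l - 1]))"
    if "1 \<le> l" "l \<le> i + 1" for l
    using that
  proof (induction l rule: int_ge_induct)
    case base
    have "ins_weight x L 1 (i + 1) = x (i + 1)" by (simp add: ins_weight_def fun_eq_iff)
    then show ?case by (simp add: net_eqv_refl)
  next
    case (step l)
    interpret exchange l s "cut l (L l i)" "psum l (ins_weight x L l (i + 1))"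
      "psum (l + 1) (ins_weight x L (l + 1) (i + 1))" "cut l (L l (i + 1))"
      by (rule ins_array_exchange[OF assms(1)]) (use step assms in auto)
    have "[l..i] = l # [l + 1..i]" "[1..l] = [1..l - 1] @ [l]"
      using step by (simp add: upto_rec1, simp add: upto_rec2)
    then have e: "map (level L i) (rev [l..i]) @ (l, psum l (ins_weight x L l (i + 1))) # map (level L (i + 1)) (rev [1..l - 1])
      = map (level L i) (rev [l + 1..i]) @ level L i l # (l, psum l (ins_weight x L l (i + 1))) # map (level L (i + 1)) (rev [1..l - 1])"
      and e': "map (level L (i + 1)) (rev [1..l]) = level L (i + 1) l # map (level L (i + 1)) (rev [1..l - 1])"
      by simp_all
    have "net_eqv K lo s (map (level L i) (rev [1..i]) @ [(1, psum 1 (x (i + 1)))])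
     (map (level L i) (rev [l..i]) @ (l, psum l (ins_weight x L l (i + 1))) # map (level L (i + 1)) (rev [1..l - 1]))"
      using step by simp
    also have "net_eqv K lo s \<dots> (map (level L i) (rev [l + 1..i]) @
        (l + 1, psum (l + 1) (ins_weight x L (l + 1) (i + 1))) # level L (i + 1) l # map (level L (i + 1)) (rev [1..l - 1]))"
      unfolding e by (rule net_eqv_pair_map[OF net_eqv])
    finally show ?case by (simp add: e')
  qed
  \<comment> \<open>For part \<open>i + 1\<close> of row \<open>i + 1\<close> the local rule has no
    upper neighbour, so the travelling row has already become the missing level.\<close>
  have last: "psum (i + 1) (ins_weight x L (i + 1) (i + 1)) c = L (i + 1) (i + 1) c" if "i + 1 \<le> c" "c \<le> s" for c
    using that
  proof (induction c rule: int_ge_induct)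
    case base
    have "L (i + 1) (i + 1) (i + 1) = ins_weight x L (i + 1) (i + 1) (i + 1)"
      using ins_array_rec[OF assms(1), of "i + 1" "i + 1" "i + 1"] assms base by simp
    then show ?case using psum_step[of "i + 1" "i + 1"] psum_low[of i "i + 1"] by simp
  next
    case (step c)
    then have "L (i + 1) (i + 1) (c + 1) = ins_weight x L (i + 1) (i + 1) (c + 1) + L (i + 1) (i + 1) c"
      using ins_array_rec[OF assms(1), of "i + 1" "i + 1" "c + 1"] assms by simp
    then show ?case using step psum_step[of "i + 1" "c + 1"] by simp
  qed
  have "net_eqv K lo s [(i + 1, psum (i + 1) (ins_weight x L (i + 1) (i + 1)))] [level L (i + 1) (i + 1)]"
  proof (rule net_eqv_single)
    fix c assume "c \<le> s"
    then have "psum (i + 1) (ins_weight x L (i + 1) (i + 1)) c' = cut (i + 1) (L (i + 1) (i + 1)) c'" if "c' \<le> c" for c'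
      using last that by (simp add: psum_low)
    then show "psum (i + 1) (ins_weight x L (i + 1) (i + 1)) c - psum (i + 1) (ins_weight x L (i + 1) (i + 1)) (c - 1)
       = cut (i + 1) (L (i + 1) (i + 1)) c - cut (i + 1) (L (i + 1) (i + 1)) (c - 1)"
      by simp
  qed simp
  then have "net_eqv K lo s
      ([(i + 1, psum (i + 1) (ins_weight x L (i + 1) (i + 1)))] @ map (level L (i + 1)) (rev [1..i]))
      ([level L (i + 1) (i + 1)] @ map (level L (i + 1)) (rev [1..i]))"
    by (rule net_eqv_append[OF _ net_eqv_refl])
  moreover have "[1..i + 1] = [1..i] @ [i + 1]" using assms(2) by (simp add: upto_rec2)
  ultimately show ?thesis
    using main[of "i + 1"] assms(2) by (simp, blast intro: net_eqv_trans)
qed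

definition rows :: "(int \<Rightarrow> int \<Rightarrow> real) \<Rightarrow> int \<Rightarrow> net" where
  "rows x r = map (\<lambda>i. (1, psum 1 (x i))) [1..r]"

theorem net_eqv_normal_form:
  assumes "ins_array r s x L" "0 \<le> i" "i \<le> r"
  shows "net_eqv K lo s (rows x i) (map (level L i) (rev [1..i]))"
  using assms(2,3)
proof (induction i rule: int_ge_induct)
  case base
  then show ?case by (simp add: rows_def net_eqv_refl)
next
  case (step i)
  then have "[1..i + 1] = [1..i] @ [i + 1]" by (simp add: upto_rec2)
  then have "rows x (i + 1) = rows x i @ [(1, psum 1 (x (i + 1)))]" by (simp add: rows_def)
  moreover have "net_eqv K lo s (rows x i @ [(1, psum 1 (x (i + 1)))])
     (map (level L i) (rev [1..i]) @ [(1, psum 1 (x (i + 1)))])"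
    using step by (intro net_eqv_append net_eqv_refl) simp
  ultimately show ?case
    using net_eqv_insert[OF assms(1), of i K lo] step by (simp, blast intro: net_eqv_trans)
qed

text \<open>Greene's theorem: between consecutive positions at both ends, the normal form admits only
  one system.\<close>

lemma normal_form_suffix:
  fixes L :: "int \<Rightarrow> int \<Rightarrow> int \<Rightarrow> real"
  assumes "l \<le> K" "int K \<le> s" "\<And>i. i < l \<Longrightarrow> C i = int i + 1"
    and B: "\<And>i. i < K \<Longrightarrow> B i = s - int K + int i + 1"
  shows "reach K (map (level L r) (rev [1..int l])) C B w \<longleftrightarrow>
     (if l = 0 then C = B else \<forall>i. l \<le> i \<and> i < K \<longrightarrow> C i = B i) \<and> w = (\<Sum>l'\<in>{1..int l}. L l' r s)"
  using assms(1,3)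
proof (induction l arbitrary: C w)
  case 0
  then show ?case by simp
next
  case (Suc l)
  let ?U = "cut (1 + int l) (L (1 + int l) r)"
  have u: "[1..int (Suc l)] = [1..int l] @ [1 + int l]" by (simp add: upto_rec2)
  have sum: "(\<Sum>l'\<in>{1..int (Suc l)}. L l' r s) = L (1 + int l) r s + (\<Sum>l'\<in>{1..int l}. L l' r s)"
  proof -
    have "{1..int (Suc l)} = insert (1 + int l) {1..int l}" by auto
    then show ?thesis by simp
  qed
  have weight: "nweight K ?U C D = L (1 + int l) r s"
    if "\<And>i. i < l \<Longrightarrow> D i = int i + 1" "\<And>i. l \<le> i \<Longrightarrow> i < K \<Longrightarrow> D i = B i"
      "\<And>i. Suc l \<le> i \<Longrightarrow> i < K \<Longrightarrow> C i = B i" for D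
  proof -
    \<comment> \<open>The weight telescopes: beyond index \<open>l\<close> one has
      \<open>C i - 1 = B (i - 1)\<close>, and up to \<open>l\<close> the level vanishes because the
      columns are left of its threshold.\<close>
    define h where "h n = (if n \<le> l then 0 else ?U (B (n - 1)))" for n
    have "?U (D i) = h (Suc i)" if "i < K" for i
      using that \<open>\<And>i. i < l \<Longrightarrow> D i = int i + 1\<close>[of i] \<open>\<And>i. l \<le> i \<Longrightarrow> i < K \<Longrightarrow> D i = B i\<close>[of i]
      by (cases "i < l") (simp_all add: h_def)
    moreover have "?U (C i - 1) = h i" if "i < K" for i
    proof (cases "i < Suc l")
      case True
      then show ?thesis using Suc.prems(2)[of i] by (simp add: h_def)
    next
      case False
      then have "C i - 1 = B (i - 1)"
        using that \<open>\<And>i. Suc l \<le> i \<Longrightarrow> i < K \<Longrightarrow> C i = B i\<close>[of i] B[of i] B[of "i - 1"] by (simp add: of_nat_diff)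
      then show ?thesis using False by (simp add: h_def)
    qed
    ultimately have "nweight K ?U C D = (\<Sum>i<K. h (Suc i) - h i)"
      unfolding nweight_def by (intro sum.cong) simp_all
    also have "\<dots> = h K - h 0" by (rule sum_lessThan_telescope)
    also have "\<dots> = ?U s" using Suc.prems(1) B[of "K - 1"] by (simp add: h_def of_nat_diff)
    also have "\<dots> = L (1 + int l) r s" using Suc.prems(1) assms(2) by simp
    finally show ?thesis .
  qed
  have low: "D i = int i + 1" if "nstep K (1 + int l) C D" "i < l" for D i
  proof -
    have "C i < 1 + int l" "i < K" using Suc.prems that by simp_all
    with that(1) have "D i = C i" unfolding nstep_def by presburger
    then show ?thesis using Suc.prems(2)[of i] that(2) by simp
  qed
  have IH: "reach K (map (level L r) (rev [1..int l])) D B w \<longleftrightarrow>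
     (if l = 0 then D = B else \<forall>i. l \<le> i \<and> i < K \<longrightarrow> D i = B i) \<and> w = (\<Sum>l'\<in>{1..int l}. L l' r s)"
    if "nstep K (1 + int l) C D" for D w
    by (rule Suc.IH) (use Suc.prems(1) low[OF that] in simp_all)
  have net: "reach K (map (level L r) (rev [1..int (Suc l)])) C B w \<longleftrightarrow>
     (\<exists>D w'. nstep K (1 + int l) C D \<and> reach K (map (level L r) (rev [1..int l])) D B w' \<and> w = nweight K ?U C D + w')"
    by (simp only: u rev_append list.map rev.simps append_Nil append_Cons map_append reach.simps)
  show ?case
  proof
    assume "reach K (map (level L r) (rev [1..int (Suc l)])) C B w"
    then obtain D w' where D: "nstep K (1 + int l) C D"
      and r: "reach K (map (level L r) (rev [1..int l])) D B w'" and w: "w = nweight K ?U C D + w'"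
      unfolding net by blast
    from r have r': "(if l = 0 then D = B else \<forall>i. l \<le> i \<and> i < K \<longrightarrow> D i = B i)"
      and w': "w' = (\<Sum>l'\<in>{1..int l}. L l' r s)"
      unfolding IH[OF D] by simp_all
    have DB: "D i = B i" if "l \<le> i" "i < K" for i using r' that by (auto split: if_splits)
    have CB: "C i = B i" if i: "Suc l \<le> i" "i < K" for i
    proof -
      \<comment> \<open>The preceding position already ends at \<open>B j = B i - 1\<close>, which
        forces \<open>C i\<close> to be at least \<open>B i\<close>.\<close>
      obtain j where j: "i = Suc j" using i(1) Suc_le_D by blast
      then have "D j < C i" using D i unfolding nstep_def by simp
      moreover have "C i \<le> D i" by (rule nstep_mono[OF D i(2)])
      ultimately show ?thesis using DB[of j] DB[of i] i j B[of i] B[of j] by simp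
    qed
    have "nweight K ?U C D = L (1 + int l) r s"
      by (rule weight[OF low[OF D] DB CB])
    then show "(if Suc l = 0 then C = B else \<forall>i. Suc l \<le> i \<and> i < K \<longrightarrow> C i = B i) \<and>
        w = (\<Sum>l'\<in>{1..int (Suc l)}. L l' r s)"
      unfolding sum w w' using CB by simp
  next
    assume a: "(if Suc l = 0 then C = B else \<forall>i. Suc l \<le> i \<and> i < K \<longrightarrow> C i = B i) \<and>
        w = (\<Sum>l'\<in>{1..int (Suc l)}. L l' r s)"
    then have CB: "C i = B i" if "Suc l \<le> i" "i < K" for i using that by simp
    \<comment> \<open>Only position \<open>l\<close> can move at this level. It runs straight to its
      end; the later positions are already there.\<close>
    define D where "D i = (if i < l then C i else B i)" for i
    have D: "nstep K (1 + int l) C D"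
      unfolding nstep_def
    proof (intro conjI allI impI)
      fix i assume i: "i < K"
      consider "i < l" | "i = l" | "Suc l \<le> i" by linarith
      then show "if C i < 1 + int l then D i = C i else C i \<le> D i"
      proof cases
        case 1 then show ?thesis using Suc.prems(2)[of i] by (simp add: D_def)
      next
        case 2 then show ?thesis using Suc.prems(2)[of i] B[OF i] assms(2) by (simp add: D_def)
      next
        case 3 then show ?thesis using CB[of i] i B[OF i] assms(2) by (simp add: D_def)
      qed
    next
      fix i assume i: "Suc i < K"
      show "D i < C (Suc i)"
      proof (cases "i < l")
        case True then show ?thesis using Suc.prems(2)[of i] Suc.prems(2)[of "Suc i"] by (simp add: D_def)
      next
        case False then show ?thesis using CB[of "Suc i"] i B[of i] B[of "Suc i"] by (simp add: D_def)
      qed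
    qed
    have "reach K (map (level L r) (rev [1..int l])) D B (\<Sum>l'\<in>{1..int l}. L l' r s)"
      unfolding IH[OF D] by (auto simp: D_def)
    moreover have "nweight K ?U C D = L (1 + int l) r s"
      by (rule weight) (use low[OF D] CB in \<open>simp_all add: D_def\<close>)
    with a have "w = nweight K ?U C D + (\<Sum>l'\<in>{1..int l}. L l' r s)"
      unfolding sum by simp
    ultimately show "reach K (map (level L r) (rev [1..int (Suc l)])) C B w"
      unfolding net using D by blast
  qed
qed

text \<open>Levels beyond \<open>K\<close> have thresholds above every starting position and are
  idle, so \<open>normal_form_suffix\<close> for the lowest \<open>K\<close> levels decides the
  weight.\<close>

theorem normal_form_reach:
  fixes L :: "int \<Rightarrow> int \<Rightarrow> int \<Rightarrow> real"
  assumes "K \<le> l" "1 \<le> l" "int K \<le> s" "\<And>i. i < K \<Longrightarrow> C i = int i + 1"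
    and B: "\<And>i. i < K \<Longrightarrow> B i = s - int K + int i + 1"
  shows "reach K (map (level L r) (rev [1..int l])) C B w \<longleftrightarrow> w = (\<Sum>l'\<in>{1..int K}. L l' r s)"
proof -
  \<comment> \<open>The induction starts at \<open>max K 1\<close>: for \<open>K = 0\<close> an
    empty net would force \<open>C\<close> and \<open>B\<close> to be equal as functions.\<close>
  have "max K 1 \<le> l" using assms by simp
  then show ?thesis
    using assms(4)
  proof (induction l arbitrary: C w rule: dec_induct)
    case base
    show ?case
    proof (cases "K = 0")
      case True
      have "reach 0 [level L r 1] C B w \<longleftrightarrow> w = 0"
        by (simp add: nstep_def nweight_def)
      with True show ?thesis by simp
    next
      case False
      then show ?thesis using normal_form_suffix[of K K s C B L r w] assms base by simp
    qed
  next
    case (step l)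
    let ?U = "cut (1 + int l) (L (1 + int l) r)"
    have u: "[1..int (Suc l)] = [1..int l] @ [1 + int l]" by (simp add: upto_rec2)
    have net: "reach K (map (level L r) (rev [1..int (Suc l)])) C B w \<longleftrightarrow>
       (\<exists>D w'. nstep K (1 + int l) C D \<and> reach K (map (level L r) (rev [1..int l])) D B w' \<and> w = nweight K ?U C D + w')"
      by (simp only: u rev_append list.map rev.simps append_Nil append_Cons map_append reach.simps)
    have D: "D i = int i + 1" if "nstep K (1 + int l) C D" "i < K" for D i
    proof -
      have "C i < 1 + int l" using that step by simp
      with that have "D i = C i" unfolding nstep_def by presburger
      then show ?thesis using step.prems that(2) by simp
    qed
    have idle: "nweight K ?U C D = 0" if "\<And>i. i < K \<Longrightarrow> D i = int i + 1" for D
      unfolding nweight_def using that step by (intro sum.neutral) simp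
    have C: "nstep K (1 + int l) C C"
      unfolding nstep_def
    proof (intro conjI allI impI)
      show "if C i < 1 + int l then C i = C i else C i \<le> C i" for i by simp
      show "C i < C (Suc i)" if "Suc i < K" for i
        using step.prems[of i] step.prems[of "Suc i"] that by simp
    qed
    show ?case unfolding net
    proof
      assume "\<exists>D w'. nstep K (1 + int l) C D \<and> reach K (map (level L r) (rev [1..int l])) D B w' \<and> w = nweight K ?U C D + w'"
      then obtain D' w' where D': "nstep K (1 + int l) C D'" "reach K (map (level L r) (rev [1..int l])) D' B w'"
        "w = nweight K ?U C D' + w'" by blast
      with idle[OF D[OF D'(1)]] step.IH[OF D[OF D'(1)]] show "w = (\<Sum>l'\<in>{1..int K}. L l' r s)" by simp
    next
      assume "w = (\<Sum>l'\<in>{1..int K}. L l' r s)"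
      then show "\<exists>D w'. nstep K (1 + int l) C D \<and> reach K (map (level L r) (rev [1..int l])) D B w' \<and> w = nweight K ?U C D + w'"
        using C idle[OF step.prems] step.IH[OF step.prems] by (intro exI[of _ C] exI[of _ w]) simp
    qed
  qed
qed

section \<open>Greatest weights between fixed ends\<close>

definition greatest_reach :: "nat \<Rightarrow> net \<Rightarrow> (nat \<Rightarrow> int) \<Rightarrow> (nat \<Rightarrow> int) \<Rightarrow> real \<Rightarrow> bool" where
  "greatest_reach K n A B W \<longleftrightarrow> reach K n A B W \<and> (\<forall>w. reach K n A B w \<longrightarrow> w \<le> W)"

lemma greatest_reach_eqv:
  "net_eqv K lo hi n n' \<Longrightarrow> (\<And>i. i < K \<Longrightarrow> lo \<le> A i \<and> B i \<le> hi) \<Longrightarrow>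
     greatest_reach K n A B W \<longleftrightarrow> greatest_reach K n' A B W"
  unfolding greatest_reach_def by (rule net_eqv_best)

lemma greatest_reach_unique: "greatest_reach K n A B W \<Longrightarrow> greatest_reach K n A B W' \<Longrightarrow> W = W'"
  unfolding greatest_reach_def by (meson order.antisym)

text \<open>In normal form these ends admit a single weight, which is thus the greatest one;
  equivalence transports it back to the rows of \<open>x\<close>.\<close>

theorem greene:
  assumes "ins_array r s x L" "1 \<le> r" "int K \<le> r" "int K \<le> s"
  shows "greatest_reach K (rows x r) (\<lambda>i. 1 + int i) (\<lambda>i. s - int K + 1 + int i) (\<Sum>l\<in>{1..int K}. L l r s)"
proof -
  have "net_eqv K 1 s (rows x r) (map (level L r) (rev [1..r]))"
    by (rule net_eqv_normal_form[OF assms(1)]) (use assms in simp_all)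
  moreover have "reach K (map (level L r) (rev [1..r])) (\<lambda>i. 1 + int i) (\<lambda>i. s - int K + 1 + int i) w \<longleftrightarrow>
      w = (\<Sum>l'\<in>{1..int K}. L l' r s)" for w
    using normal_form_reach[of K "nat r" s "\<lambda>i. 1 + int i" "\<lambda>i. s - int K + 1 + int i" L r w] assms by simp
  then have "greatest_reach K (map (level L r) (rev [1..r])) (\<lambda>i. 1 + int i) (\<lambda>i. s - int K + 1 + int i)
      (\<Sum>l\<in>{1..int K}. L l r s)"
    unfolding greatest_reach_def by simp
  ultimately show ?thesis by (subst greatest_reach_eqv) auto
qed

lemma net_eqv_cut:
  assumes "\<And>c. l \<le> c \<Longrightarrow> c \<le> hi \<Longrightarrow> f c = g c"
  shows "net_eqv K lo hi [(l, cut l f)] [(l, cut l g)]"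
proof (rule net_eqv_single)
  fix c assume "c \<le> hi"
  with assms have "cut l f c' = cut l g c'" if "c' \<le> c" for c' using that by simp
  from this[of c] this[of "c - 1"] show "cut l f c - cut l f (c - 1) = cut l g c - cut l g (c - 1)" by simp
qed simp

text \<open>The normal form of the transposed array has the levels \<open>L l i s\<close>, so the
  shapes along the last column decide the behaviour of all columns of \<open>x\<close>.\<close>

theorem net_eqv_columns:
  assumes L: "ins_array r s x L" and L': "ins_array r s x' L'" and "0 \<le> s"
    and eq: "\<And>l i. 1 \<le> l \<Longrightarrow> l \<le> s \<Longrightarrow> l \<le> i \<Longrightarrow> i \<le> r \<Longrightarrow> L l i s = L' l i s"
  shows "net_eqv K lo r (rows (\<lambda>j i. x i j) s) (rows (\<lambda>j i. x' i j) s)"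
proof -
  let ?T = "\<lambda>L :: int \<Rightarrow> int \<Rightarrow> int \<Rightarrow> real. \<lambda>l i j. L l j i"
  have "net_eqv K lo r (rows (\<lambda>j i. x i j) s) (map (level (?T L) s) (rev [1..s]))"
    by (rule net_eqv_normal_form[OF ins_array_transpose[OF L]]) (use assms in simp_all)
  also have "net_eqv K lo r \<dots> (map (level (?T L') s) (rev [1..s]))"
    by (intro net_eqv_map net_eqv_cut eq) simp_all
  also have "net_eqv K lo r \<dots> (rows (\<lambda>j i. x' i j) s)"
    by (rule net_eqv_sym, rule net_eqv_normal_form[OF ins_array_transpose[OF L']]) (use assms in simp_all)
  finally show ?thesis .
qed

section \<open>Promotion as restoration of normal form\<close>

text \<open>The promotion toggles as one system of equations. Files are treated from
  \<open>r - 1\<close> downwards, so the neighbours \<open>(i + 1, c)\<close> and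
  \<open>(i, c - 1)\<close> on the next higher file carry new values and the other two still old
  ones. Since \<open>r - s < i - c\<close> implies \<open>c < s\<close>, the neighbour
  \<open>(i, c + 1)\<close> always exists.\<close>

definition promoted ::
    "int \<Rightarrow> int \<Rightarrow> (int \<Rightarrow> int \<Rightarrow> real) \<Rightarrow> (int \<Rightarrow> int \<Rightarrow> real) \<Rightarrow> bool" where
  "promoted r s Y Y' \<longleftrightarrow> (\<forall>i c. 1 \<le> i \<and> i \<le> r \<and> 1 \<le> c \<and> r - s < i - c \<longrightarrow>
     Y' i c = (if i < r then min (Y' (i + 1) c) (Y i (c + 1)) else Y i (c + 1)) +
       (if i = 1 \<and> c = 1 then 0 else if i = 1 then Y' i (c - 1)
        else if c = 1 then Y (i - 1) c else max (Y' i (c - 1)) (Y (i - 1) c)) - Y i c)"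

lemma promotedD:
  assumes "promoted r s Y Y'" "1 \<le> i" "i \<le> r" "1 \<le> c" "r - s < i - c"
  shows "Y' i c = (if i < r then min (Y' (i + 1) c) (Y i (c + 1)) else Y i (c + 1)) +
       (if i = 1 \<and> c = 1 then 0 else if i = 1 then Y' i (c - 1)
        else if c = 1 then Y (i - 1) c else max (Y' i (c - 1)) (Y (i - 1) c)) - Y i c"
  by (rule assms(1)[unfolded promoted_def, rule_format]) (use assms in simp)

text \<open>Restricting the normal form to columns at least 2 turns its bottom level into one of the
  second kind; the exchange moves that restore normal form perform the promotion toggles.\<close>

lemma net_eqv_promotion:
  fixes Y Y' :: "int \<Rightarrow> int \<Rightarrow> real"
  assumes pr: "promoted r s Y Y'" and "1 \<le> r"
  shows "net_eqv K 2 s (map (\<lambda>l. (l, cut l (\<lambda>b. Y (r - l + 1) (b - l + 1)))) (rev [1..r]))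
    (map (\<lambda>l. (l + 1, cut (l + 1) (\<lambda>b. Y' (r - l + 1) (b - l)))) (rev [1..r]))"
proof -
  define P where "P l b = Y (r - l + 1) (b - l + 1)" for l b
  define Q where "Q l b = Y' (r - l + 1) (b - l)" for l b
  \<comment> \<open>\<open>w l\<close> is the row that travels just before it meets level
    \<open>l + 1\<close>. It starts as the increments of level 1. \<open>Q\<close> is indexed one
    column further right than the shapes of the promoted array.\<close>
  define w where "w l b = (if l = 1 then P 1 b else min (Q (l - 1) (b - 1)) (P l b)) - P l (b - 1)" for l b
  let ?p = "\<lambda>l. (l, cut l (P l))" and ?q = "\<lambda>l. (l + 1, cut (l + 1) (Q l))"
  \<comment> \<open>The toggle equation at \<open>i = r - l + 1\<close>, \<open>c = b - l\<close>,
    read as an insertion rule: the minimum and the old value form \<open>w l b\<close>, the maximum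
    is the running maximum of the exchange.\<close>
  have Q: "Q l b = w l b + (if b = l + 1 then (if l < r then P (l + 1) b else 0)
       else if l < r then max (Q l (b - 1)) (P (l + 1) b) else Q l (b - 1))"
    if "1 \<le> l" "l \<le> r" "l + 1 \<le> b" "b \<le> s" for l b
  proof -
    have [simp]: "b - l - 1 = b - 1 - l" "r - l - 1 = r - 1 - l" by simp_all
    have "Y' (r - l + 1) (b - l) = (if r - l + 1 < r then min (Y' (r - l + 1 + 1) (b - l)) (Y (r - l + 1) (b - l + 1)) else Y (r - l + 1) (b - l + 1)) +
       (if r - l + 1 = 1 \<and> b - l = 1 then 0 else if r - l + 1 = 1 then Y' (r - l + 1) (b - l - 1)
        else if b - l = 1 then Y (r - l + 1 - 1) (b - l) else max (Y' (r - l + 1) (b - l - 1)) (Y (r - l + 1 - 1) (b - l)))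
        - Y (r - l + 1) (b - l)"
      by (rule promotedD[OF pr]) (use that in simp_all)
    moreover have "w l b = (if r - l + 1 < r then min (Y' (r - l + 1 + 1) (b - l)) (Y (r - l + 1) (b - l + 1)) else Y (r - l + 1) (b - l + 1))
         - Y (r - l + 1) (b - l)"
      using that by (auto simp: w_def P_def Q_def algebra_simps)
    moreover have "Q l b = Y' (r - l + 1) (b - l)" "Q l (b - 1) = Y' (r - l + 1) (b - l - 1)"
      "P (l + 1) b = Y (r - l + 1 - 1) (b - l)"
      by (simp_all add: Q_def P_def algebra_simps)
    moreover have "(r - l + 1 = 1) = (\<not> l < r)" "(b - l = 1) = (b = l + 1)" using that by auto
    ultimately show ?thesis by (simp only:) (cases "b = l + 1"; cases "l < r"; simp)
  qed
  have exch: "exchange (l + 1) s (cut (l + 1) (P (l + 1))) (psum (l + 1) (w l))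
      (psum (l + 1 + 1) (w (l + 1))) (cut (l + 1) (Q l))" if "1 \<le> l" "l < r" for l
  proof (rule exchange_by_weights)
    show "l + 1 \<le> s \<Longrightarrow> cut (l + 1) (Q l) (l + 1) = w l (l + 1) + cut (l + 1) (P (l + 1)) (l + 1)"
      using Q[of l "l + 1"] that by simp
    fix c
    show "c < l + 1 \<Longrightarrow> cut (l + 1) (P (l + 1)) c = 0 \<and> cut (l + 1) (Q l) c = 0" by simp
    show "l + 1 < c \<Longrightarrow> c \<le> s \<Longrightarrow> cut (l + 1) (Q l) c =
        w l c + max (cut (l + 1) (Q l) (c - 1)) (cut (l + 1) (P (l + 1)) c)"
      using Q[of l c] that by simp
    show "l + 1 < c \<Longrightarrow> c \<le> s \<Longrightarrow> w (l + 1) c =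
        min (cut (l + 1) (Q l) (c - 1)) (cut (l + 1) (P (l + 1)) c) - cut (l + 1) (P (l + 1)) (c - 1)"
      using that by (simp add: w_def)
  qed
  have main: "net_eqv K 2 s (map ?p (rev [1..r]))
     (map ?p (rev [l + 1..r]) @ (l + 1, psum (l + 1) (w l)) # map ?q (rev [1..l - 1]))"
    if "1 \<le> l" "l \<le> r" for l
    using that
  proof (induction l rule: int_ge_induct)
    case base
    have "[1..r] = 1 # [2..r]" using \<open>1 \<le> r\<close> by (simp add: upto_rec1)
    then have e: "map ?p (rev [1..r]) = map ?p (rev [2..r]) @ [?p 1]" by simp
    have "net_eqv K 2 s [?p 1] [(2, psum 2 (w 1))]"
    proof (rule net_eqv_low)
      fix c :: int assume "2 \<le> c"
      then show "cut 1 (P 1) c - cut 1 (P 1) (c - 1) = psum 2 (w 1) c - psum 2 (w 1) (c - 1)"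
        using psum_step[of 2 c "w 1"] by (simp add: w_def)
    qed simp_all
    from net_eqv_append[OF net_eqv_refl this, of "map ?p (rev [2..r])"]
    show ?case unfolding e by simp
  next
    case (step l)
    interpret exchange "l + 1" s "cut (l + 1) (P (l + 1))" "psum (l + 1) (w l)"
      "psum (l + 1 + 1) (w (l + 1))" "cut (l + 1) (Q l)"
      by (rule exch) (use step in simp_all)
    have "[l + 1..r] = (l + 1) # [l + 1 + 1..r]" "[1..l] = [1..l - 1] @ [l]"
      using step by (simp add: upto_rec1, simp add: upto_rec2)
    then have e: "map ?p (rev [l + 1..r]) @ (l + 1, psum (l + 1) (w l)) # map ?q (rev [1..l - 1])
      = map ?p (rev [l + 1 + 1..r]) @ ?p (l + 1) # (l + 1, psum (l + 1) (w l)) # map ?q (rev [1..l - 1])"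
      and e': "map ?q (rev [1..l]) = ?q l # map ?q (rev [1..l - 1])"
      by simp_all
    have "net_eqv K 2 s (map ?p (rev [1..r])) (map ?p (rev [l + 1..r]) @ (l + 1, psum (l + 1) (w l)) # map ?q (rev [1..l - 1]))"
      using step by simp
    also have "net_eqv K 2 s \<dots> (map ?p (rev [l + 1 + 1..r]) @
        (l + 1 + 1, psum (l + 1 + 1) (w (l + 1))) # ?q l # map ?q (rev [1..l - 1]))"
      unfolding e by (rule net_eqv_pair_map[OF net_eqv])
    finally show ?case unfolding add_diff_cancel_right' e' .
  qed
  \<comment> \<open>For \<open>l = r\<close> the toggles concern row 1 of \<open>Y\<close>, which
    has no row below it; the travelling row has become the last level.\<close>
  have last: "psum (r + 1) (w r) c = Q r c" if "r + 1 \<le> c" "c \<le> s" for c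
    using that
  proof (induction c rule: int_ge_induct)
    case base
    then show ?case using Q[of r "r + 1"] \<open>1 \<le> r\<close> psum_step[of "r + 1" "r + 1"] psum_low[of r "r + 1"] by simp
  next
    case (step c)
    then show ?case using Q[of r "c + 1"] \<open>1 \<le> r\<close> psum_step[of "r + 1" "c + 1"] by simp
  qed
  have "net_eqv K 2 s [(r + 1, psum (r + 1) (w r))] [?q r]"
  proof (rule net_eqv_single)
    fix c assume "c \<le> s"
    then have "psum (r + 1) (w r) c' = cut (r + 1) (Q r) c'" if "c' \<le> c" for c'
      using last that by (simp add: psum_low)
    then show "psum (r + 1) (w r) c - psum (r + 1) (w r) (c - 1)
       = cut (r + 1) (Q r) c - cut (r + 1) (Q r) (c - 1)"
      by simp
  qed simp
  then have "net_eqv K 2 s ([(r + 1, psum (r + 1) (w r))] @ map ?q (rev [1..r - 1])) ([?q r] @ map ?q (rev [1..r - 1]))"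
    by (rule net_eqv_append[OF _ net_eqv_refl])
  moreover have "[1..r] = [1..r - 1] @ [r]" using \<open>1 \<le> r\<close> by (simp add: upto_rec2)
  then have "[?q r] @ map ?q (rev [1..r - 1]) = map ?q (rev [1..r])" by simp
  ultimately have "net_eqv K 2 s (map ?p (rev [1..r])) (map ?q (rev [1..r]))"
    using net_eqv_trans[OF main[of r]] \<open>1 \<le> r\<close> by simp
  then show ?thesis unfolding P_def Q_def .
qed

abbreviation shift_net :: "int \<Rightarrow> net \<Rightarrow> net" where
  "shift_net t \<equiv> map (\<lambda>(k, U). (k + t, \<lambda>c. U (c - t)))"

text \<open>The hypotheses place part \<open>l\<close> of the shape of the first \<open>c\<close>
  columns at box \<open>(r - l + 1, c - l + 1)\<close>, on file \<open>r - c\<close>. Promotion then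
  yields the normal form of \<open>x'\<close>, moved by one column.\<close>

theorem net_eqv_rows:
  assumes L: "ins_array r s x L" and L': "ins_array r s x' L'" and "1 \<le> r" and pr: "promoted r s Y Y'"
    and Y: "\<And>l c. 1 \<le> l \<Longrightarrow> l \<le> r \<Longrightarrow> l \<le> c \<Longrightarrow> c \<le> s \<Longrightarrow> L l r c = Y (r - l + 1) (c - l + 1)"
    and Y': "\<And>l c. 1 \<le> l \<Longrightarrow> l \<le> r \<Longrightarrow> l \<le> c \<Longrightarrow> c \<le> s \<Longrightarrow> L' l r c = Y' (r - l + 1) (c - l + 1)"
  shows "net_eqv K 2 s (rows x r) (shift_net 1 (rows x' r))"
proof -
  have "net_eqv K 2 s (rows x r) (map (level L r) (rev [1..r]))"
    by (rule net_eqv_normal_form[OF L]) (use assms in simp_all)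
  also have "net_eqv K 2 s \<dots> (map (\<lambda>l. (l, cut l (\<lambda>b. Y (r - l + 1) (b - l + 1)))) (rev [1..r]))"
    by (intro net_eqv_map net_eqv_cut Y) simp_all
  also have "net_eqv K 2 s \<dots> (map (\<lambda>l. (l + 1, cut (l + 1) (\<lambda>b. Y' (r - l + 1) (b - l)))) (rev [1..r]))"
    by (rule net_eqv_promotion[OF pr \<open>1 \<le> r\<close>])
  also have "net_eqv K 2 s \<dots> (shift_net 1 (rows x' r))"
  proof (rule net_eqv_sym)
    have "net_eqv K 1 s (rows x' r) (map (level L' r) (rev [1..r]))"
      by (rule net_eqv_normal_form[OF L']) (use assms in simp_all)
    also have "net_eqv K 1 s \<dots> (map (\<lambda>l. (l, cut l (\<lambda>b. Y' (r - l + 1) (b - l + 1)))) (rev [1..r]))"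
      by (intro net_eqv_map net_eqv_cut Y') simp_all
    \<comment> \<open>Columns \<open>1\<close> to \<open>s - 1\<close> are kept, since the
      translation by 1 has to land in \<open>2\<close> to \<open>s\<close>.\<close>
    finally have "net_eqv K 1 (s - 1) (rows x' r) (map (\<lambda>l. (l, cut l (\<lambda>b. Y' (r - l + 1) (b - l + 1)))) (rev [1..r]))"
      by (rule net_eqv_mono) simp_all
    from net_eqv_shift[OF this, of 1]
    have "net_eqv K 2 s (shift_net 1 (rows x' r))
        (shift_net 1 (map (\<lambda>l. (l, cut l (\<lambda>b. Y' (r - l + 1) (b - l + 1)))) (rev [1..r])))"
      by simp
    moreover have "(\<lambda>c. cut l (\<lambda>b. Y' (r - l + 1) (b - l + 1)) (c - 1)) = cut (l + 1) (\<lambda>b. Y' (r - l + 1) (b - l))" for l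
      by (rule ext) (simp add: algebra_simps)
    then have "shift_net 1 (map (\<lambda>l. (l, cut l (\<lambda>b. Y' (r - l + 1) (b - l + 1)))) (rev [1..r])) =
        map (\<lambda>l. (l + 1, cut (l + 1) (\<lambda>b. Y' (r - l + 1) (b - l)))) (rev [1..r])"
      unfolding map_map comp_def case_prod_conv by simp
    ultimately show "net_eqv K 2 s (shift_net 1 (rows x' r))
      (map (\<lambda>l. (l + 1, cut (l + 1) (\<lambda>b. Y' (r - l + 1) (b - l)))) (rev [1..r]))" by (simp only:)
  qed
  finally show ?thesis .
qed

subsection \<open>Max-min-plus functions and maps\<close>

text \<open>The only constant is 0 and all combinations have integer coefficients. Such functions
  are linear without constant term on each piece and are integral at integral points.\<close>

inductive_set trop :: "box set \<Rightarrow> (labeling \<Rightarrow> real) set" for V :: "box set" where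
  coord: "v \<in> V \<Longrightarrow> (\<lambda>x. x v) \<in> trop V"
| zero: "(\<lambda>x. 0) \<in> trop V"
| add: "f \<in> trop V \<Longrightarrow> g \<in> trop V \<Longrightarrow> (\<lambda>x. f x + g x) \<in> trop V"
| diff: "f \<in> trop V \<Longrightarrow> g \<in> trop V \<Longrightarrow> (\<lambda>x. f x - g x) \<in> trop V"
| max: "f \<in> trop V \<Longrightarrow> g \<in> trop V \<Longrightarrow> (\<lambda>x. max (f x) (g x)) \<in> trop V"
| min: "f \<in> trop V \<Longrightarrow> g \<in> trop V \<Longrightarrow> (\<lambda>x. min (f x) (g x)) \<in> trop V"

lemma trop_cong:
  assumes "f \<in> trop V" "\<And>v. v \<in> V \<Longrightarrow> x v = y v"
  shows "f x = f y"
  using assms by induction auto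

lemma trop_subst:
  assumes "f \<in> trop W" "\<And>w. w \<in> W \<Longrightarrow> (\<lambda>x. F x w) \<in> trop V"
  shows "(\<lambda>x. f (F x)) \<in> trop V"
  using assms(1) by induction (auto intro: trop.intros assms(2))

lemma trop_mono:
  assumes "f \<in> trop V" "V \<subseteq> W"
  shows "f \<in> trop W"
  using assms(1) by induction (use assms(2) in \<open>auto intro: trop.intros\<close>)

lemma trop_Ints:
  assumes "f \<in> trop V" "\<And>v. v \<in> V \<Longrightarrow> x v \<in> \<int>"
  shows "f x \<in> \<int>"
  using assms(1) by induction (auto intro: assms(2) simp: max_def min_def)

lemma trop_continuous:
  assumes "f \<in> trop V"
  shows "continuous_map (product_topology (\<lambda>_. euclidean) V) euclidean f"
  using assms
proof induction
  case (coord v)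
  then show ?case by (rule continuous_map_product_projection)
qed (auto intro!: continuous_map_add continuous_map_diff continuous_map_real_max continuous_map_real_min)

lemma trop_measurable:
  assumes "f \<in> trop V"
  shows "f \<in> borel_measurable (Pi\<^sub>M V (\<lambda>_. lborel))"
  using assms
proof induction
  case (coord v)
  have "(\<lambda>x. x v) \<in> measurable (Pi\<^sub>M V (\<lambda>_. lborel)) (lborel :: real measure)"
    by (rule measurable_component_singleton[OF coord])
  then show ?case by simp
qed auto

section \<open>Subdivision into polyhedra\<close>

text \<open>One subdivision serves all functions of \<open>F\<close>, because
  \<open>piecewise_linear\<close> asks for a whole matrix on each piece.\<close>

definition linear_pieces :: "box set \<Rightarrow> (labeling \<Rightarrow> real) set \<Rightarrow> labeling set set \<Rightarrow> bool" where
  "linear_pieces V F \<Q> \<longleftrightarrow> finite \<Q> \<and> (\<forall>Q\<in>\<Q>. polyhedron_in V Q) \<and> \<Union>\<Q> = labelings V \<and>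
     (\<forall>Q\<in>\<Q>. \<forall>f\<in>F. \<exists>a. \<forall>x\<in>Q. f x = (\<Sum>v\<in>V. a v * x v))"

lemma linear_piecesD:
  "linear_pieces V F \<Q> \<Longrightarrow> Q \<in> \<Q> \<Longrightarrow> f \<in> F \<Longrightarrow> \<exists>a. \<forall>x\<in>Q. f x = (\<Sum>v\<in>V. a v * x v)"
  unfolding linear_pieces_def by simp

lemma linear_pieces_subset: "linear_pieces V F \<Q> \<Longrightarrow> G \<subseteq> F \<Longrightarrow> linear_pieces V G \<Q>"
  unfolding linear_pieces_def by (simp add: subset_iff)

lemma polyhedron_in_labelings: "polyhedron_in V (labelings V)"
  unfolding polyhedron_in_def by (rule exI[of _ "{}"]) simp

lemma polyhedron_in_Int:
  assumes "polyhedron_in V Q" "polyhedron_in V Q'"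
  shows "polyhedron_in V (Q \<inter> Q')"
proof -
  obtain F F' where "finite F" "Q = {x \<in> labelings V. \<forall>(a, b)\<in>F. (\<Sum>v\<in>V. a v * x v) \<le> b}"
    "finite F'" "Q' = {x \<in> labelings V. \<forall>(a, b)\<in>F'. (\<Sum>v\<in>V. a v * x v) \<le> b}"
    using assms unfolding polyhedron_in_def by blast
  then show ?thesis unfolding polyhedron_in_def
    by (intro exI[of _ "F \<union> F'"]) auto
qed

lemma polyhedron_in_halfspace: "polyhedron_in V {x \<in> labelings V. (\<Sum>v\<in>V. a v * x v) \<le> b}"
  unfolding polyhedron_in_def by (rule exI[of _ "{(a, b)}"]) simp

lemma linear_pieces_union:
  assumes "linear_pieces V F \<Q>" "linear_pieces V G \<Q>'"
  shows "\<exists>\<Q>''. linear_pieces V (F \<union> G) \<Q>''"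
proof
  let ?P = "(\<lambda>(Q, Q'). Q \<inter> Q') ` (\<Q> \<times> \<Q>')"
  have "\<Union>?P = \<Union>\<Q> \<inter> \<Union>\<Q>'" by blast
  moreover have "\<forall>Q\<in>?P. \<forall>f\<in>F \<union> G. \<exists>a. \<forall>x\<in>Q. f x = (\<Sum>v\<in>V. a v * x v)"
  proof (intro ballI)
    fix P f assume "P \<in> ?P" "f \<in> F \<union> G"
    then obtain Q Q' where Q: "Q \<in> \<Q>" "Q' \<in> \<Q>'" "P = Q \<inter> Q'" by auto
    then have "\<exists>a. (\<forall>x\<in>Q. f x = (\<Sum>v\<in>V. a v * x v)) \<or> (\<forall>x\<in>Q'. f x = (\<Sum>v\<in>V. a v * x v))"
      using assms \<open>f \<in> F \<union> G\<close> unfolding linear_pieces_def by (metis UnE)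
    then show "\<exists>a. \<forall>x\<in>P. f x = (\<Sum>v\<in>V. a v * x v)" using Q(3) by blast
  qed
  ultimately show "linear_pieces V (F \<union> G) ?P"
    using assms unfolding linear_pieces_def by (auto intro: polyhedron_in_Int)
qed

text \<open>On a piece where \<open>f\<close> and \<open>g\<close> are both linear,
  \<open>f x \<le> g x\<close> is a half-space; cutting each piece along it makes maximum and
  minimum linear.\<close>

lemma linear_pieces_max_min:
  assumes "linear_pieces V {f, g} \<Q>"
  shows "linear_pieces V {\<lambda>x. max (f x) (g x), \<lambda>x. min (f x) (g x)}
    ((\<lambda>Q. Q \<inter> {x \<in> labelings V. f x \<le> g x}) ` \<Q> \<union> (\<lambda>Q. Q \<inter> {x \<in> labelings V. g x \<le> f x}) ` \<Q>)"
proof -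
  \<comment> \<open>Stated for fresh \<open>f\<close> and \<open>g\<close>, so that it applies to
    both sides of the cut.\<close>
  have half: "polyhedron_in V (Q \<inter> {x \<in> labelings V. f x \<le> g x})"
    if h: "Q \<in> \<Q>" "\<And>Q. Q \<in> \<Q> \<Longrightarrow> \<exists>a. \<forall>x\<in>Q. f x = (\<Sum>v\<in>V. a v * x v)"
      "\<And>Q. Q \<in> \<Q> \<Longrightarrow> \<exists>a. \<forall>x\<in>Q. g x = (\<Sum>v\<in>V. a v * x v)" for Q and f g :: "labeling \<Rightarrow> real"
  proof -
    obtain a b where ab: "\<forall>x\<in>Q. f x = (\<Sum>v\<in>V. a v * x v)" "\<forall>x\<in>Q. g x = (\<Sum>v\<in>V. b v * x v)"
      using h(2)[OF h(1)] h(3)[OF h(1)] by metis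
    have "f x \<le> g x \<longleftrightarrow> (\<Sum>v\<in>V. (a v - b v) * x v) \<le> 0" if "x \<in> Q" for x
      unfolding ab(1)[rule_format, OF that] ab(2)[rule_format, OF that]
      by (simp add: left_diff_distrib sum_subtractf)
    then have eq: "Q \<inter> {x \<in> labelings V. f x \<le> g x} = Q \<inter> {x \<in> labelings V. (\<Sum>v\<in>V. (a v - b v) * x v) \<le> 0}"
      by blast
    have "polyhedron_in V Q" using h(1) assms unfolding linear_pieces_def by simp
    then show ?thesis unfolding eq by (rule polyhedron_in_Int[OF _ polyhedron_in_halfspace])
  qed
  let ?A = "(\<lambda>Q. Q \<inter> {x \<in> labelings V. f x \<le> g x}) ` \<Q>" and ?B = "(\<lambda>Q. Q \<inter> {x \<in> labelings V. g x \<le> f x}) ` \<Q>"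
  let ?H = "{\<lambda>x. max (f x) (g x), \<lambda>x. min (f x) (g x)}"
  have lin: "\<exists>a. \<forall>x\<in>Q. f x = (\<Sum>v\<in>V. a v * x v)" "\<exists>a. \<forall>x\<in>Q. g x = (\<Sum>v\<in>V. a v * x v)" if "Q \<in> \<Q>" for Q
    using assms that unfolding linear_pieces_def by auto
  have l1: "\<exists>a. \<forall>x\<in>Q \<inter> {x \<in> labelings V. f x \<le> g x}. h x = (\<Sum>v\<in>V. a v * x v)"
    if "Q \<in> \<Q>" "h \<in> ?H" for Q h
    using lin[OF that(1)] that(2) by auto
  have l2: "\<exists>a. \<forall>x\<in>Q \<inter> {x \<in> labelings V. g x \<le> f x}. h x = (\<Sum>v\<in>V. a v * x v)"
    if "Q \<in> \<Q>" "h \<in> ?H" for Q h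
    using lin[OF that(1)] that(2) by (auto simp: max.absorb1 min.absorb2)
  show ?thesis
    unfolding linear_pieces_def
  proof (intro conjI)
    show "\<Union> (?A \<union> ?B) = labelings V"
    proof -
      have "labelings V = \<Union>\<Q>" using assms unfolding linear_pieces_def by simp
      then show ?thesis by (auto simp: linear)
    qed
    show "finite (?A \<union> ?B)"
      using assms unfolding linear_pieces_def by simp
  next
    show "\<forall>P\<in>?A \<union> ?B.
        polyhedron_in V P"
      using half[OF _ lin] half[OF _ lin(2,1)] by (auto simp only: ball_Un image_iff)
    show "\<forall>P\<in>?A \<union> ?B.
        \<forall>h\<in>?H. \<exists>a. \<forall>x\<in>P. h x = (\<Sum>v\<in>V. a v * x v)"
    proof (intro ballI)
      fix P h assume P: "P \<in> ?A \<union> ?B"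
        and h: "h \<in> ?H"
      from P consider Q where "Q \<in> \<Q>" "P = Q \<inter> {x \<in> labelings V. f x \<le> g x}"
        | Q where "Q \<in> \<Q>" "P = Q \<inter> {x \<in> labelings V. g x \<le> f x}" by blast
      then show "\<exists>a. \<forall>x\<in>P. h x = (\<Sum>v\<in>V. a v * x v)"
        by cases (simp only: l1[OF _ h], simp only: l2[OF _ h])
    qed
  qed
qed

lemma trop_linear_pieces:
  assumes "finite V" "f \<in> trop V"
  shows "\<exists>\<Q>. linear_pieces V {f} \<Q>"
  using assms(2)
proof induction
  case (coord v)
  have "\<exists>a. \<forall>x\<in>labelings V. x v = (\<Sum>u\<in>V. a u * x u)"
  proof (intro exI ballI)
    fix x :: labeling
    have "(\<Sum>u\<in>V. (if u = v then 1 else 0) * x u) = (\<Sum>u\<in>V. if u = v then x u else 0)"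
      by (intro sum.cong) auto
    then show "x v = (\<Sum>u\<in>V. (if u = v then 1 else 0) * x u)" using coord assms(1) by simp
  qed
  then show ?case
    by (intro exI[of _ "{labelings V}"]) (auto simp: linear_pieces_def polyhedron_in_labelings)
next
  case zero
  show ?case
    by (intro exI[of _ "{labelings V}"]) (auto simp: linear_pieces_def polyhedron_in_labelings intro!: exI[of _ "\<lambda>_. 0"])
next
  case (add f g)
  then obtain \<Q> where Q: "linear_pieces V {f, g} \<Q>"
    using linear_pieces_union[of V "{f}" _ "{g}"] by (auto simp: insert_commute)
  have "\<exists>c. \<forall>x\<in>Q. f x + g x = (\<Sum>v\<in>V. c v * x v)" if q: "Q \<in> \<Q>" for Q
  proof -
    obtain a b where "\<forall>x\<in>Q. f x = (\<Sum>v\<in>V. a v * x v)" "\<forall>x\<in>Q. g x = (\<Sum>v\<in>V. b v * x v)"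
      using linear_piecesD[OF Q q, of f] linear_piecesD[OF Q q, of g] by auto
    then show ?thesis by (intro exI[of _ "\<lambda>v. a v + b v"]) (simp add: distrib_right sum.distrib)
  qed
  with Q have "linear_pieces V {\<lambda>x. f x + g x} \<Q>" unfolding linear_pieces_def by simp
  then show ?case by blast
next
  case (diff f g)
  then obtain \<Q> where Q: "linear_pieces V {f, g} \<Q>"
    using linear_pieces_union[of V "{f}" _ "{g}"] by (auto simp: insert_commute)
  have "\<exists>c. \<forall>x\<in>Q. f x - g x = (\<Sum>v\<in>V. c v * x v)" if q: "Q \<in> \<Q>" for Q
  proof -
    obtain a b where "\<forall>x\<in>Q. f x = (\<Sum>v\<in>V. a v * x v)" "\<forall>x\<in>Q. g x = (\<Sum>v\<in>V. b v * x v)"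
      using linear_piecesD[OF Q q, of f] linear_piecesD[OF Q q, of g] by auto
    then show ?thesis by (intro exI[of _ "\<lambda>v. a v - b v"]) (simp add: left_diff_distrib sum_subtractf)
  qed
  with Q have "linear_pieces V {\<lambda>x. f x - g x} \<Q>" unfolding linear_pieces_def by simp
  then show ?case by blast
next
  case (max f g)
  then obtain \<Q> where "linear_pieces V {f, g} \<Q>"
    using linear_pieces_union[of V "{f}" _ "{g}"] by (auto simp: insert_commute)
  from linear_pieces_subset[OF linear_pieces_max_min[OF this]] show ?case by (rule exI) simp
next
  case (min f g)
  then obtain \<Q> where "linear_pieces V {f, g} \<Q>"
    using linear_pieces_union[of V "{f}" _ "{g}"] by (auto simp: insert_commute)
  from linear_pieces_subset[OF linear_pieces_max_min[OF this]] show ?case by (rule exI) simp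
qed

lemma trop_linear_pieces_finite:
  assumes "finite V" "finite F" "F \<subseteq> trop V"
  shows "\<exists>\<Q>. linear_pieces V F \<Q>"
  using assms(2,3)
proof (induction F)
  case empty
  show ?case
    by (intro exI[of _ "{labelings V}"]) (auto simp: linear_pieces_def polyhedron_in_labelings)
next
  case (insert f F)
  then obtain \<Q> \<Q>' where "linear_pieces V {f} \<Q>" "linear_pieces V F \<Q>'"
    using trop_linear_pieces[OF assms(1), of f] by auto
  from linear_pieces_union[OF this] show ?case by simp
qed

section \<open>Maps with max-min-plus coordinates\<close>

definition trop_map :: "box set \<Rightarrow> box set \<Rightarrow> (labeling \<Rightarrow> labeling) \<Rightarrow> bool" where
  "trop_map V W f \<longleftrightarrow> f \<in> labelings V \<rightarrow> labelings W \<and>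
     (\<forall>w\<in>W. \<exists>h\<in>trop V. \<forall>x\<in>labelings V. f x w = h x)"

lemma trop_mapI:
  assumes "\<And>x. x \<in> labelings V \<Longrightarrow> f x \<in> labelings W"
    and "\<And>w. w \<in> W \<Longrightarrow> h w \<in> trop V" "\<And>w x. w \<in> W \<Longrightarrow> x \<in> labelings V \<Longrightarrow> f x w = h w x"
  shows "trop_map V W f"
  unfolding trop_map_def
proof (intro conjI funcsetI ballI)
  show "\<exists>h\<in>trop V. \<forall>x\<in>labelings V. f x w = h x" if "w \<in> W" for w
    by (rule bexI[of _ "h w"]) (use assms(2,3) that in simp_all)
qed (rule assms(1))

lemma trop_map_in: "trop_map V W f \<Longrightarrow> x \<in> labelings V \<Longrightarrow> f x \<in> labelings W"
  unfolding trop_map_def by (blast dest: funcset_mem)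

lemma trop_map_formula:
  assumes "trop_map V W f"
  shows "\<exists>h. (\<forall>w\<in>W. h w \<in> trop V) \<and> (\<forall>w\<in>W. \<forall>x\<in>labelings V. f x w = h w x)"
proof -
  have "\<forall>w\<in>W. \<exists>h. h \<in> trop V \<and> (\<forall>x\<in>labelings V. f x w = h x)"
    using assms unfolding trop_map_def by blast
  from bchoice[OF this] show ?thesis by blast
qed

lemma trop_map_comp:
  assumes "trop_map V W f" "trop_map U V g"
  shows "trop_map U W (f \<circ> g)"
proof -
  obtain h where h: "\<And>w. w \<in> W \<Longrightarrow> h w \<in> trop V"
    "\<And>w x. w \<in> W \<Longrightarrow> x \<in> labelings V \<Longrightarrow> f x w = h w x" using trop_map_formula[OF assms(1)] by blast
  obtain k where k: "\<And>v. v \<in> V \<Longrightarrow> k v \<in> trop U"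
    "\<And>v x. v \<in> V \<Longrightarrow> x \<in> labelings U \<Longrightarrow> g x v = k v x" using trop_map_formula[OF assms(2)] by blast
  show ?thesis
  proof (rule trop_mapI[where h = "\<lambda>w x. h w (\<lambda>v. k v x)"])
    show "(f \<circ> g) x \<in> labelings W" if "x \<in> labelings U" for x
      using trop_map_in[OF assms(1) trop_map_in[OF assms(2) that]] by simp
    fix w assume w: "w \<in> W"
    show "(\<lambda>x. h w (\<lambda>v. k v x)) \<in> trop U" by (rule trop_subst[OF h(1)[OF w]]) (rule k(1))
    fix x assume x: "x \<in> labelings U"
    have "(f \<circ> g) x w = h w (g x)" using h(2)[OF w trop_map_in[OF assms(2) x]] by simp
    also have "\<dots> = h w (\<lambda>v. k v x)" by (rule trop_cong[OF h(1)[OF w]]) (rule k(2)[OF _ x])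
    finally show "(f \<circ> g) x w = h w (\<lambda>v. k v x)" .
  qed
qed

lemma trop_map_cong:
  assumes "trop_map V W f" "\<And>x. x \<in> labelings V \<Longrightarrow> f x = g x"
  shows "trop_map V W g"
proof -
  obtain h where "\<And>w. w \<in> W \<Longrightarrow> h w \<in> trop V"
    "\<And>w x. w \<in> W \<Longrightarrow> x \<in> labelings V \<Longrightarrow> f x w = h w x" using trop_map_formula[OF assms(1)] by blast
  then show ?thesis
    by (intro trop_mapI[where h = h]) (simp_all add: assms(2)[symmetric] trop_map_in[OF assms(1)])
qed

lemma trop_map_piecewise_linear:
  assumes "finite V" "finite W" "trop_map V W f"
  shows "piecewise_linear V W f"
proof -
  obtain h where h: "\<And>w. w \<in> W \<Longrightarrow> h w \<in> trop V"
    "\<And>w x. w \<in> W \<Longrightarrow> x \<in> labelings V \<Longrightarrow> f x w = h w x" using trop_map_formula[OF assms(3)] by blast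
  have "h ` W \<subseteq> trop V" using h(1) by blast
  then obtain \<Q> where Q: "linear_pieces V (h ` W) \<Q>"
    using trop_linear_pieces_finite[OF assms(1) finite_imageI[OF assms(2)]] by blast
  have "\<exists>A. \<forall>x\<in>Q. \<forall>w\<in>W. f x w = (\<Sum>v\<in>V. A w v * x v)" if q: "Q \<in> \<Q>" for Q
  proof -
    have "\<forall>w\<in>W. \<exists>a. \<forall>x\<in>Q. h w x = (\<Sum>v\<in>V. a v * x v)"
      using linear_piecesD[OF Q q] by simp
    from bchoice[OF this] obtain A where A: "\<forall>w\<in>W. \<forall>x\<in>Q. h w x = (\<Sum>v\<in>V. A w v * x v)" ..
    have "x \<in> labelings V" if "x \<in> Q" for x
      using Q q that unfolding linear_pieces_def by blast
    with A h(2) show ?thesis by (intro exI[of _ A] ballI) simp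
  qed
  moreover have "f \<in> labelings V \<rightarrow> labelings W" using trop_map_in[OF assms(3)] by (rule funcsetI)
  ultimately show ?thesis
    using Q unfolding piecewise_linear_def linear_pieces_def by (intro conjI exI[of _ \<Q>]) simp_all
qed

lemma trop_map_continuous:
  assumes "trop_map V W f"
  shows "continuous_labeling_map V W f"
  unfolding continuous_labeling_map_def continuous_map_componentwise
proof (intro conjI ballI)
  show "f ` topspace (product_topology (\<lambda>_. euclidean) V) \<subseteq> extensional W"
  proof (rule image_subsetI)
    fix x :: labeling assume "x \<in> topspace (product_topology (\<lambda>_. euclidean) V)"
    then have "f x \<in> labelings W" using trop_map_in[OF assms] by simp
    then show "f x \<in> extensional W" by (simp add: PiE_def)
  qed
  obtain h where h: "\<And>w. w \<in> W \<Longrightarrow> h w \<in> trop V"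
    "\<And>w x. w \<in> W \<Longrightarrow> x \<in> labelings V \<Longrightarrow> f x w = h w x" using trop_map_formula[OF assms] by blast
  fix w assume "w \<in> W"
  then show "continuous_map (product_topology (\<lambda>_. euclidean) V) euclidean (\<lambda>x. f x w)"
    by (intro continuous_map_eq[OF trop_continuous[OF h(1)]]) (simp_all add: h(2))
qed

lemma trop_map_Ints:
  assumes "trop_map V W f" "x \<in> int_labelings V"
  shows "f x \<in> int_labelings W"
proof -
  have x: "x \<in> labelings V" "\<And>v. v \<in> V \<Longrightarrow> x v \<in> \<int>"
    using assms(2) unfolding int_labelings_def by (auto simp: PiE_def)
  obtain h where h: "\<And>w. w \<in> W \<Longrightarrow> h w \<in> trop V"
    "\<And>w x. w \<in> W \<Longrightarrow> x \<in> labelings V \<Longrightarrow> f x w = h w x" using trop_map_formula[OF assms(1)] by blast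
  have "f x w \<in> \<int>" if "w \<in> W" for w
    using trop_Ints[OF h(1)[OF that], of x] x h(2)[OF that] by simp
  then show ?thesis using trop_map_in[OF assms(1) x(1)] unfolding int_labelings_def by (simp add: PiE_iff)
qed

abbreviation volume :: "box set \<Rightarrow> labeling measure" where
  "volume V \<equiv> Pi\<^sub>M V (\<lambda>_. lborel)"

lemma space_labelings: "space (volume V) = labelings V"
  by (simp add: space_PiM)

lemma trop_map_measurable:
  assumes "trop_map V W f"
  shows "f \<in> measurable (volume V) (volume W)"
proof (rule measurable_PiM_single')
  fix w assume "w \<in> W"
  then obtain h where h: "h \<in> trop V" "\<And>x. x \<in> labelings V \<Longrightarrow> f x w = h x"
    using trop_map_formula[OF assms] by blast
  have "(\<lambda>x. f x w) \<in> borel_measurable (volume V)"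
    by (subst measurable_cong[of _ _ h]) (simp_all add: space_labelings h trop_measurable)
  then show "(\<lambda>x. f x w) \<in> measurable (volume V) lborel" by simp
next
  show "(\<lambda>x w. f x w) \<in> space (volume V) \<rightarrow> (\<Pi>\<^sub>E i\<in>W. space lborel)"
    using trop_map_in[OF assms] by (auto simp: space_labelings)
qed

section \<open>Invertible maps that preserve volume\<close>

definition trop_iso ::
    "box set \<Rightarrow> box set \<Rightarrow> (labeling \<Rightarrow> labeling) \<Rightarrow> (labeling \<Rightarrow> labeling) \<Rightarrow> bool" where
  "trop_iso V W f g \<longleftrightarrow> trop_map V W f \<and> trop_map W V g \<and>
     (\<forall>x\<in>labelings V. g (f x) = x) \<and> (\<forall>y\<in>labelings W. f (g y) = y) \<and>
     distr (volume V) (volume W) f = volume W"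

lemma trop_isoD:
  assumes "trop_iso V W f g"
  shows "trop_map V W f" "trop_map W V g" "\<And>x. x \<in> labelings V \<Longrightarrow> g (f x) = x"
    "\<And>y. y \<in> labelings W \<Longrightarrow> f (g y) = y"
    "\<And>x. x \<in> labelings V \<Longrightarrow> f x \<in> labelings W" "\<And>y. y \<in> labelings W \<Longrightarrow> g y \<in> labelings V"
  using assms unfolding trop_iso_def by (simp_all add: trop_map_in[of V W f] trop_map_in[of W V g])

text \<open>Pushing the measure forward along \<open>f\<close> and then along \<open>g\<close> is
  pushing it along the identity, so the inverse preserves the measure too.\<close>

lemma trop_iso_sym:
  assumes "trop_iso V W f g"
  shows "trop_iso W V g f"
proof -
  note f = trop_map_measurable[OF trop_isoD(1)[OF assms]] and g = trop_map_measurable[OF trop_isoD(2)[OF assms]]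
  have "distr (volume W) (volume V) g
      = distr (distr (volume V) (volume W) f) (volume V) g"
    using assms unfolding trop_iso_def by simp
  also have "\<dots> = distr (volume V) (volume V) (g \<circ> f)"
    by (rule distr_distr[OF g f])
  also have "\<dots> = distr (volume V) (volume V) (\<lambda>x. x)"
    by (rule distr_cong) (use assms in \<open>auto simp: space_labelings trop_iso_def\<close>)
  finally have "distr (volume W) (volume V) g = volume V"
    by (simp add: distr_id)
  with assms show ?thesis unfolding trop_iso_def by blast
qed

lemma trop_iso_comp:
  assumes "trop_iso V W f g" "trop_iso U V f' g'"
  shows "trop_iso U W (f \<circ> f') (g' \<circ> g)"
proof -
  note m = trop_map_measurable[OF trop_isoD(1)[OF assms(1)]] trop_map_measurable[OF trop_isoD(1)[OF assms(2)]]
  have "distr (volume U) (volume W) (f \<circ> f')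
      = distr (distr (volume U) (volume V) f') (volume W) f"
    by (rule distr_distr[symmetric, OF m])
  then have "distr (volume U) (volume W) (f \<circ> f') = volume W"
    using assms unfolding trop_iso_def by simp
  then show ?thesis
    using trop_isoD[OF assms(1)] trop_isoD[OF assms(2)] unfolding trop_iso_def
    by (simp add: trop_map_comp)
qed

lemma trop_iso_cong:
  assumes "trop_iso V W f g" "\<And>x. x \<in> labelings V \<Longrightarrow> f x = f' x" "\<And>y. y \<in> labelings W \<Longrightarrow> g y = g' y"
  shows "trop_iso V W f' g'"
proof -
  have "distr (volume V) (volume W) f'
      = distr (volume V) (volume W) f"
    by (rule distr_cong) (simp_all add: space_labelings assms(2))
  then show ?thesis
    using assms trop_isoD(3-6)[OF assms(1)] trop_map_cong[OF trop_isoD(1)[OF assms(1)], of f']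
      trop_map_cong[OF trop_isoD(2)[OF assms(1)], of g'] unfolding trop_iso_def by simp
qed

lemma trop_iso_id: "trop_iso V V id id"
proof -
  have "trop_map V V id" by (rule trop_mapI[where h = "\<lambda>v x. x v"]) (simp_all add: trop.coord)
  moreover have "distr (volume V) (volume V) id = volume V"
    unfolding id_def by (rule distr_id)
  ultimately show ?thesis unfolding trop_iso_def by simp
qed

lemma trop_iso_inverse_on:
  assumes "trop_iso V V f g"
  shows "trop_iso V V (inverse_on V f) f"
proof (rule trop_iso_cong[OF trop_iso_sym[OF assms]])
  fix y assume y: "y \<in> labelings V"
  have "inj_on f (labelings V)" by (rule inj_on_inverseI) (rule trop_isoD(3)[OF assms])
  with trop_isoD[OF assms] y show "g y = inverse_on V f y"
    unfolding inverse_on_def by (metis inv_into_f_f)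
qed simp

text \<open>An image under \<open>f\<close> is a preimage under \<open>g\<close>; measurability and
  measure are then those of a pushforward along \<open>g\<close>.\<close>

lemma trop_iso_volume_preserving:
  assumes "trop_iso V W f g"
  shows "volume_preserving V W f"
  unfolding volume_preserving_def
proof
  fix A assume A: "A \<in> sets (volume V)"
  note g = trop_map_measurable[OF trop_isoD(2)[OF assms]]
  have "A \<subseteq> labelings V" using sets.sets_into_space[OF A] by (simp add: space_labelings)
  then have img: "f ` A = g -` A \<inter> space (volume W)"
    unfolding space_labelings
  proof (intro equalityI subsetI)
    fix y assume "y \<in> f ` A"
    then obtain x where "x \<in> A" "y = f x" by blast
    then show "y \<in> g -` A \<inter> labelings W"
      using \<open>A \<subseteq> labelings V\<close> trop_isoD(3,5)[OF assms, of x] by (simp add: subsetD)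
  next
    fix y assume "y \<in> g -` A \<inter> labelings W"
    then show "y \<in> f ` A" using trop_isoD(4)[OF assms, of y] by (intro image_eqI[of _ _ "g y"]) simp_all
  qed
  have "emeasure (volume W) (f ` A) = emeasure (distr (volume W) (volume V) g) A"
    unfolding img by (rule emeasure_distr[OF g A, symmetric])
  also have "\<dots> = emeasure (volume V) A"
    using trop_iso_sym[OF assms] unfolding trop_iso_def by simp
  finally show "f ` A \<in> sets (volume W) \<and>
      emeasure (volume W) (f ` A) = emeasure (volume V) A"
    using measurable_sets[OF g A] img by simp
qed

lemma trop_iso_compose_list:
  assumes "list_all2 (trop_iso V V) fs gs"
  shows "trop_iso V V (compose_list fs) (compose_list (rev gs))"
  using assms
proof (induction rule: list_all2_induct)
  case Nil
  have "compose_list [] = id" by (simp add: compose_list_def)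
  then show ?case unfolding rev.simps by (simp only: trop_iso_id)
next
  case (Cons f fs g gs)
  have snoc: "compose_list (hs @ [h]) = compose_list hs \<circ> h" for hs h
    by (induction hs) (simp_all add: compose_list_def comp_assoc)
  have "trop_iso V V (f \<circ> compose_list fs) (compose_list (rev gs) \<circ> g)"
    by (rule trop_iso_comp) (use Cons in auto)
  moreover have "compose_list (f # fs) = f \<circ> compose_list fs" by (simp add: compose_list_def)
  ultimately show ?case by (simp only: rev.simps snoc)
qed

interpretation lborel_product: product_sigma_finite "\<lambda>_ :: box. lborel :: real measure"
  by unfold_locales

lemma nn_integral_lborel_affine:
  fixes f :: "real \<Rightarrow> ennreal"
  assumes "f \<in> borel_measurable borel" "\<bar>\<sigma>\<bar> = 1"
  shows "(\<integral>\<^sup>+ t. f (c + \<sigma> * t) \<partial>lborel) = (\<integral>\<^sup>+ t. f t \<partial>lborel)"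
  using nn_integral_real_affine[OF assms(1), of \<sigma> c] assms(2) by auto

text \<open>A shear in the coordinate \<open>p\<close>, possibly with a reflection. Since
  \<open>h\<close> does not see this coordinate, integrating over it first reduces the claim to
  invariance of Lebesgue measure on the line. Toggles are the case \<open>\<sigma> = - 1\<close>,
  the steps of the transfer map the case \<open>\<sigma> = 1\<close>.\<close>

lemma trop_iso_update:
  assumes V: "finite V" "p \<in> V" and h: "h \<in> trop V" "\<And>x t. h (x(p := t)) = h x"
    and \<sigma>: "\<sigma> = 1 \<or> \<sigma> = - 1"
  shows "trop_iso V V (\<lambda>x. x(p := h x + \<sigma> * x p)) (\<lambda>x. x(p := \<sigma> * (x p - h x)))"
proof -
  let ?f = "\<lambda>x. x(p := h x + \<sigma> * x p)" and ?g = "\<lambda>x. x(p := \<sigma> * (x p - h x))"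
  have upd: "x(p := a) \<in> labelings V" if "x \<in> labelings V" for x a
    using that V(2) by (auto simp: PiE_iff extensional_def)
  have neg: "(\<lambda>x. - k x) \<in> trop V" if "k \<in> trop V" for k
    using trop.diff[OF trop.zero that] by simp
  have "trop_map V V ?f"
  proof (rule trop_mapI[where h = "\<lambda>v x. if v = p then h x + \<sigma> * x p else x v"])
    fix v assume "v \<in> V"
    have "(\<lambda>x. \<sigma> * x p) \<in> trop V" using \<sigma> trop.coord[OF V(2)] neg[OF trop.coord[OF V(2)]] by auto
    then show "(\<lambda>x. if v = p then h x + \<sigma> * x p else x v) \<in> trop V"
      using trop.add[OF h(1)] trop.coord[OF \<open>v \<in> V\<close>] by (cases "v = p") simp_all
  qed (use upd in simp_all)
  moreover have "trop_map V V ?g"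
  proof (rule trop_mapI[where h = "\<lambda>v x. if v = p then \<sigma> * (x p - h x) else x v"])
    fix v assume "v \<in> V"
    have d: "(\<lambda>x. x p - h x) \<in> trop V" by (rule trop.diff[OF trop.coord[OF V(2)] h(1)])
    have "(\<lambda>x. \<sigma> * (x p - h x)) \<in> trop V" using \<sigma> d neg[OF d] by auto
    then show "(\<lambda>x. if v = p then \<sigma> * (x p - h x) else x v) \<in> trop V"
      using trop.coord[OF \<open>v \<in> V\<close>] by (cases "v = p") simp_all
  qed (use upd in simp_all)
  moreover have "?g (?f x) = x" "?f (?g x) = x" for x
    using \<sigma> by (auto simp: h(2))
  moreover have "distr (volume V) (volume V) ?f = volume V"
  proof (rule measure_eqI)
    fix A assume "A \<in> sets (distr (volume V) (volume V) ?f)"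
    then have A: "A \<in> sets (volume V)" by simp
    note f = trop_map_measurable[OF \<open>trop_map V V ?f\<close>]
    define W where "W = V - {p}"
    have W: "V = insert p W" "finite W" "p \<notin> W" using V by (auto simp: W_def)
    have mA: "(\<lambda>x. indicator A x :: ennreal) \<in> borel_measurable (volume V)" using A by simp
    have mfA: "(\<lambda>x. indicator A (?f x) :: ennreal) \<in> borel_measurable (volume V)"
      using measurable_compose[OF f mA] by simp
    have "emeasure (distr (volume V) (volume V) ?f) A
        = (\<integral>\<^sup>+ x. indicator A x \<partial>distr (volume V) (volume V) ?f)"
      using A by simp
    also have "\<dots> = (\<integral>\<^sup>+ x. indicator A (?f x) \<partial>volume V)"
      by (rule nn_integral_distr[OF f]) (use A in simp)
    also have "\<dots> = (\<integral>\<^sup>+ y. (\<integral>\<^sup>+ t. indicator A (?f (y(p := t))) \<partial>lborel) \<partial>volume W)"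
      using lborel_product.product_nn_integral_insert[OF W(2,3), of "\<lambda>x. indicator A (?f x)"] mfA W(1) by simp
    also have "\<dots> = (\<integral>\<^sup>+ y. (\<integral>\<^sup>+ t. indicator A (y(p := t)) \<partial>lborel) \<partial>volume W)"
    proof (rule nn_integral_cong)
      fix y assume y: "y \<in> space (volume W)"
      have "(\<lambda>t. y(p := t)) \<in> measurable lborel (volume V)"
        unfolding W(1) by (rule measurable_component_update[OF y W(3)])
      then have "(\<lambda>t. indicator A (y(p := t)) :: ennreal) \<in> borel_measurable borel"
        using measurable_compose[OF _ mA] by simp
      from nn_integral_lborel_affine[OF this, of \<sigma> "h y"] \<sigma>
      show "(\<integral>\<^sup>+ t. indicator A (?f (y(p := t))) \<partial>lborel) = (\<integral>\<^sup>+ t. indicator A (y(p := t)) \<partial>lborel)"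
        by (auto simp: h(2))
    qed
    also have "\<dots> = (\<integral>\<^sup>+ x. indicator A x \<partial>volume V)"
      using lborel_product.product_nn_integral_insert[OF W(2,3), of "indicator A"] mA W(1) by simp
    finally show "emeasure (distr (volume V) (volume V) ?f) A
        = emeasure (volume V) A" using A by simp
  qed simp
  ultimately show ?thesis unfolding trop_iso_def by simp
qed

text \<open>Fubini for the splitting of \<open>V\<close> into \<open>P\<close> and its complement:
  the lifted map acts on the inner integral only.\<close>

lemma trop_iso_lift:
  assumes V: "finite V" "P \<subseteq> V" and f: "trop_iso P P f g"
  defines "F \<equiv> \<lambda>f x. \<lambda>v\<in>V. if v \<in> P then f (restrict x P) v else x v"
  shows "trop_iso V V (F f) (F g)"
proof -
  have res: "restrict x P \<in> labelings P" for x :: labeling by simp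
  have FV: "F f x \<in> labelings V" for f x by (simp add: F_def)
  have map: "trop_map V V (F k)" if k: "trop_map P P k" for k
  proof -
    obtain h where h: "\<forall>w\<in>P. h w \<in> trop P" "\<forall>w\<in>P. \<forall>x\<in>labelings P. k x w = h w x"
      using trop_map_formula[OF k] by blast
    show ?thesis
    proof (rule trop_mapI[where h = "\<lambda>v x. if v \<in> P then h v x else x v"])
      show "F k x v = (if v \<in> P then h v x else x v)" if "v \<in> V" for v x
      proof (cases "v \<in> P")
        case True
        have "F k x v = h v (restrict x P)" using h(2) res True that by (simp add: F_def)
        also have "\<dots> = h v x" by (rule trop_cong[OF h(1)[rule_format, OF True]]) simp
        finally show ?thesis using True by simp
      qed (use that in \<open>simp add: F_def\<close>)
      show "(\<lambda>x. if v \<in> P then h v x else x v) \<in> trop V" if "v \<in> V" for v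
        using that h(1) trop_mono[OF _ V(2)] by (cases "v \<in> P") (simp_all add: trop.coord)
    qed (rule FV)
  qed
  have inv: "F l (F k x) = x" if "x \<in> labelings V" and kl: "\<And>y. y \<in> labelings P \<Longrightarrow> l (k y) = y"
      "\<And>y. y \<in> labelings P \<Longrightarrow> k y \<in> labelings P" for k l x
  proof
    fix v
    have "restrict (F k x) P = k (restrict x P)"
    proof
      fix u
      have "k (restrict x P) \<in> labelings P" by (rule kl(2)[OF res])
      from PiE_arb[OF this, of u] show "restrict (F k x) P u = k (restrict x P) u"
        using subsetD[OF V(2), of u] by (cases "u \<in> P") (simp_all add: F_def)
    qed
    then have "F l (F k x) v = (if v \<in> V then x v else undefined)"
      using kl(1)[OF res] by (auto simp: F_def)
    also have "\<dots> = x v" using PiE_arb[OF that(1), of v] by simp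
    finally show "F l (F k x) v = x v" .
  qed
  note mf = trop_isoD(1)[OF f] and mg = trop_isoD(2)[OF f]
  have distr: "distr (volume V) (volume V) (F f) = volume V"
  proof (rule measure_eqI)
    fix A assume "A \<in> sets (distr (volume V) (volume V) (F f))"
    then have A: "A \<in> sets (volume V)" by simp
    note Ff = trop_map_measurable[OF map[OF mf]]
    define W where "W = V - P"
    have W: "V = W \<union> P" "finite W" "W \<inter> P = {}" "finite P"
      using V by (auto simp: W_def intro: finite_subset)
    have mA: "(\<lambda>x. indicator A x :: ennreal) \<in> borel_measurable (volume V)" using A by simp
    have mFA: "(\<lambda>x. indicator A (F f x) :: ennreal) \<in> borel_measurable (volume V)"
      using measurable_compose[OF Ff mA] by simp
    have "emeasure (distr (volume V) (volume V) (F f)) A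
        = (\<integral>\<^sup>+ x. indicator A x \<partial>distr (volume V) (volume V) (F f))"
      using A by simp
    also have "\<dots> = (\<integral>\<^sup>+ x. indicator A (F f x) \<partial>volume V)"
      by (rule nn_integral_distr[OF Ff]) (use A in simp)
    also have "\<dots> = (\<integral>\<^sup>+ y. (\<integral>\<^sup>+ z. indicator A (F f (merge W P (y, z))) \<partial>volume P) \<partial>volume W)"
      using lborel_product.product_nn_integral_fold[OF W(3,2,4), of "\<lambda>x. indicator A (F f x)"] mFA W(1) by simp
    also have "\<dots> = (\<integral>\<^sup>+ y. (\<integral>\<^sup>+ z. indicator A (merge W P (y, z)) \<partial>volume P) \<partial>volume W)"
    proof (rule nn_integral_cong)
      fix y assume y: "y \<in> space (volume W)"
      have "(\<lambda>z. (y, z)) \<in> measurable (volume P) (volume W \<Otimes>\<^sub>M volume P)"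
        using y by (rule measurable_Pair1')
      from measurable_compose[OF this measurable_merge]
      have m: "(\<lambda>z. merge W P (y, z)) \<in> measurable (volume P) (volume V)"
        using W(1) by simp
      have eq: "F f (merge W P (y, z)) = merge W P (y, f z)" if z: "z \<in> labelings P" for z
      proof
        fix v
        have "restrict (merge W P (y, z)) P = z"
          using W(3) PiE_arb[OF z] by (intro ext) (auto simp: merge_def)
        then show "F f (merge W P (y, z)) v = merge W P (y, f z) v"
          using W by (auto simp: F_def merge_def)
      qed
      have "(\<integral>\<^sup>+ z. indicator A (F f (merge W P (y, z))) \<partial>volume P)
          = (\<integral>\<^sup>+ z. indicator A (merge W P (y, f z)) \<partial>volume P)"
        by (rule nn_integral_cong) (simp add: space_labelings eq)
      also have "\<dots> = (\<integral>\<^sup>+ z. indicator A (merge W P (y, z)) \<partial>distr (volume P) (volume P) f)"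
        by (rule nn_integral_distr[symmetric, OF trop_map_measurable[OF mf]])
          (use measurable_compose[OF m mA] in simp)
      also have "\<dots> = (\<integral>\<^sup>+ z. indicator A (merge W P (y, z)) \<partial>volume P)"
        using f unfolding trop_iso_def by simp
      finally show "(\<integral>\<^sup>+ z. indicator A (F f (merge W P (y, z))) \<partial>volume P)
          = (\<integral>\<^sup>+ z. indicator A (merge W P (y, z)) \<partial>volume P)" .
    qed
    also have "\<dots> = (\<integral>\<^sup>+ x. indicator A x \<partial>volume V)"
      using lborel_product.product_nn_integral_fold[OF W(3,2,4), of "indicator A"] mA W(1) by simp
    finally show "emeasure (distr (volume V) (volume V) (F f)) A
        = emeasure (volume V) A" using A by simp
  qed simp
  show ?thesis
    unfolding trop_iso_def
  proof (intro conjI ballI)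
    show "F g (F f x) = x" if "x \<in> labelings V" for x
      by (rule inv[OF that]) (simp_all add: trop_isoD[OF f])
    show "F f (F g y) = y" if "y \<in> labelings V" for y
      by (rule inv[OF that]) (simp_all add: trop_isoD[OF f])
  qed (rule map[OF mf] map[OF mg] distr)+
qed

text \<open>Renaming coordinates takes product sets to product sets with the same factors, and these
  determine the product measure.\<close>

lemma trop_iso_relabel:
  assumes "finite V" "finite W" and \<sigma>: "bij_betw \<sigma> W V"
  shows "trop_iso V W (\<lambda>x. \<lambda>w\<in>W. x (\<sigma> w)) (\<lambda>y. \<lambda>v\<in>V. y (inv_into W \<sigma> v))"
proof -
  have s: "\<sigma> w \<in> V" "inv_into W \<sigma> (\<sigma> w) = w" if "w \<in> W" for w
    using \<sigma> that by (auto simp: bij_betw_def)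
  have i: "inv_into W \<sigma> v \<in> W" "\<sigma> (inv_into W \<sigma> v) = v" if "v \<in> V" for v
    using \<sigma> that by (auto simp: bij_betw_def inv_into_into f_inv_into_f)
  have map: "trop_map V W (\<lambda>x. \<lambda>w\<in>W. x (\<tau> w))" if "\<And>w. w \<in> W \<Longrightarrow> \<tau> w \<in> V" for \<tau> V W
    by (rule trop_mapI[where h = "\<lambda>w x. x (\<tau> w)"]) (simp_all add: that trop.coord)
  note mf = trop_map_measurable[OF map[of W \<sigma> V, OF s(1)]]
  have "distr (volume V) (volume W) (\<lambda>x. \<lambda>w\<in>W. x (\<sigma> w)) = volume W"
  proof (rule lborel_product.PiM_eqI)
    fix A :: "box \<Rightarrow> real set" assume A: "\<And>w. w \<in> W \<Longrightarrow> A w \<in> sets lborel"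
    then have PA: "Pi\<^sub>E W A \<in> sets (volume W)" using assms(2) by (intro sets_PiM_I_finite) auto
    have "(\<lambda>x. \<lambda>w\<in>W. x (\<sigma> w)) -` Pi\<^sub>E W A \<inter> space (volume V) = Pi\<^sub>E V (\<lambda>v. A (inv_into W \<sigma> v))"
    proof (intro equalityI subsetI)
      fix x assume x: "x \<in> (\<lambda>x. \<lambda>w\<in>W. x (\<sigma> w)) -` Pi\<^sub>E W A \<inter> space (volume V)"
      then have r: "(\<lambda>w\<in>W. x (\<sigma> w)) \<in> Pi\<^sub>E W A" and xV: "x \<in> labelings V" by (simp_all add: space_labelings)
      have "x v \<in> A (inv_into W \<sigma> v)" if "v \<in> V" for v
        using PiE_mem[OF r i(1)[OF that]] i[OF that] by simp
      then show "x \<in> Pi\<^sub>E V (\<lambda>v. A (inv_into W \<sigma> v))" using xV by (simp add: PiE_iff)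
    next
      fix x assume x: "x \<in> Pi\<^sub>E V (\<lambda>v. A (inv_into W \<sigma> v))"
      have "x (\<sigma> w) \<in> A w" if "w \<in> W" for w
        using PiE_mem[OF x s(1)[OF that]] s(2)[OF that] by simp
      moreover have "x \<in> labelings V" using x by (simp add: PiE_iff)
      ultimately show "x \<in> (\<lambda>x. \<lambda>w\<in>W. x (\<sigma> w)) -` Pi\<^sub>E W A \<inter> space (volume V)"
        by (simp add: space_labelings PiE_iff)
    qed
    then have "emeasure (distr (volume V) (volume W) (\<lambda>x. \<lambda>w\<in>W. x (\<sigma> w))) (Pi\<^sub>E W A)
        = emeasure (volume V) (Pi\<^sub>E V (\<lambda>v. A (inv_into W \<sigma> v)))"
      using emeasure_distr[OF mf PA] by simp
    also have "\<dots> = (\<Prod>v\<in>V. emeasure lborel (A (inv_into W \<sigma> v)))"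
      using A i(1) by (intro lborel_product.emeasure_PiM assms(1)) auto
    also have "\<dots> = (\<Prod>w\<in>W. emeasure lborel (A w))"
      by (subst prod.reindex_bij_betw[OF \<sigma>, symmetric]) (simp add: s(2))
    finally show "emeasure (distr (volume V) (volume W) (\<lambda>x. \<lambda>w\<in>W. x (\<sigma> w))) (Pi\<^sub>E W A)
        = (\<Prod>w\<in>W. emeasure lborel (A w))" .
  qed (use assms(2) in simp_all)
  moreover have "(\<lambda>v\<in>V. (\<lambda>w\<in>W. x (\<sigma> w)) (inv_into W \<sigma> v)) = x" if "x \<in> labelings V" for x :: labeling
    by (rule ext) (use i PiE_arb[OF that] in simp)
  moreover have "(\<lambda>w\<in>W. (\<lambda>v\<in>V. y (inv_into W \<sigma> v)) (\<sigma> w)) = y" if "y \<in> labelings W" for y :: labeling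
    by (rule ext) (use s PiE_arb[OF that] in simp)
  ultimately show ?thesis
    unfolding trop_iso_def using map[of W \<sigma> V] map[of V "inv_into W \<sigma>" W] s(1) i(1) by simp
qed

subsection \<open>Toggles, RSK and promotion on a rectangle\<close>

declare split_paired_All [simp del] split_paired_Ex [simp del]

lemma max_below_cong:
  assumes "\<And>q. covers P q p \<Longrightarrow> x q = y q"
  shows "max_below P x p = max_below P y p"
proof -
  have "x ` {q. covers P q p} = y ` {q. covers P q p}" by (rule image_cong) (simp_all add: assms)
  then show ?thesis by (simp only: max_below_def Let_def)
qed

lemma min_above_cong:
  assumes "\<And>q. covers P p q \<Longrightarrow> x q = y q"
  shows "min_above P x p = min_above P y p"
proof -
  have "x ` {q. covers P p q} = y ` {q. covers P p q}" by (rule image_cong) (simp_all add: assms)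
  then show ?thesis by (simp only: min_above_def Let_def)
qed

lemma finite_covers: "finite P \<Longrightarrow> finite {q. covers P q p}" "finite P \<Longrightarrow> finite {q. covers P p q}"
  by (rule finite_subset[of _ P], auto simp: covers_def)+

lemma coversD: "covers P p q \<Longrightarrow> p \<in> P \<and> q \<in> P \<and> p < q"
  by (simp add: covers_def)

lemma le_max_below: "finite P \<Longrightarrow> covers P q p \<Longrightarrow> x q \<le> max_below P x p"
  unfolding max_below_def Let_def using finite_covers(1)[of P p] by auto

lemma max_below_cases:
  assumes "finite P"
  shows "max_below P x p = 0 \<and> (\<forall>q. \<not> covers P q p) \<or> (\<exists>q. covers P q p \<and> max_below P x p = x q)"
proof (cases "{q. covers P q p} = {}")
  case False
  then have "Max (x ` {q. covers P q p}) \<in> x ` {q. covers P q p}"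
    using finite_covers(1)[OF assms] by (intro Max_in) simp_all
  then have "max_below P x p \<in> x ` {q. covers P q p}" using False by (simp only: max_below_def Let_def if_False)
  then show ?thesis by blast
qed (simp add: max_below_def)

lemma min_above_le: "finite P \<Longrightarrow> covers P p q \<Longrightarrow> min_above P x p \<le> x q"
  unfolding min_above_def Let_def using finite_covers(2)[of P p] by auto

lemma min_above_attained:
  assumes "finite P" "covers P p q"
  shows "\<exists>q'. covers P p q' \<and> min_above P x p = x q'"
proof -
  have ne: "{q. covers P p q} \<noteq> {}" using assms(2) by blast
  then have "Min (x ` {q. covers P p q}) \<in> x ` {q. covers P p q}"
    using finite_covers(2)[OF assms(1)] by (intro Min_in) simp_all
  then have "min_above P x p \<in> x ` {q. covers P p q}" using ne by (simp only: min_above_def Let_def if_False)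
  then show ?thesis by blast
qed

section \<open>The cone of nonnegative order-preserving labelings\<close>

definition order_cone :: "box set \<Rightarrow> labeling \<Rightarrow> bool" where
  "order_cone P x \<longleftrightarrow> (\<forall>p q. covers P p q \<longrightarrow> x p \<le> x q) \<and> (\<forall>p\<in>P. 0 \<le> x p)"

lemma max_below_nonneg: "finite P \<Longrightarrow> order_cone P x \<Longrightarrow> 0 \<le> max_below P x p"
  using max_below_cases[of P x p] unfolding order_cone_def by (metis coversD order.refl)

lemma max_below_le: "finite P \<Longrightarrow> order_cone P x \<Longrightarrow> p \<in> P \<Longrightarrow> max_below P x p \<le> x p"
  using max_below_cases[of P x p] unfolding order_cone_def by metis

lemma le_min_above: "finite P \<Longrightarrow> order_cone P x \<Longrightarrow> covers P p q \<Longrightarrow> x p \<le> min_above P x p"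
  using min_above_attained[of P p q x] unfolding order_cone_def by metis

text \<open>The toggle reflects \<open>x p\<close> within the interval from \<open>max_below\<close>
  to \<open>min_above\<close>. The element \<open>r\<close> above \<open>p\<close> makes the upper
  end a genuine label instead of the default 1.\<close>

lemma order_cone_toggle:
  assumes "finite P" "covers P p r" and x: "order_cone P x"
  shows "order_cone P (toggle P p x)"
proof -
  let ?v = "min_above P x p + max_below P x p - x p"
  have p: "p \<in> P" using coversD[OF assms(2)] by simp
  have v: "max_below P x p \<le> ?v" "?v \<le> min_above P x p"
    using le_min_above[OF assms(1) x assms(2)] max_below_le[OF assms(1) x p] by simp_all
  have "toggle P p x q \<le> toggle P p x q'" if c: "covers P q q'" for q q'
  proof -
    have "q \<noteq> q'" using coversD[OF c] by auto
    then consider "q = p" "q' \<noteq> p" | "q' = p" "q \<noteq> p" | "q \<noteq> p" "q' \<noteq> p" by blast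
    then show ?thesis
    proof cases
      case 1
      then show ?thesis using v(2) min_above_le[OF assms(1), of p q' x] c by (simp add: toggle_def)
    next
      case 2
      then show ?thesis using v(1) le_max_below[OF assms(1), of q p x] c by (simp add: toggle_def)
    next
      case 3
      then show ?thesis using x c by (simp add: toggle_def order_cone_def)
    qed
  qed
  moreover have "0 \<le> toggle P p x q" if "q \<in> P" for q
    using max_below_nonneg[OF assms(1) x, of p] v(1) x that by (simp add: toggle_def order_cone_def)
  ultimately show ?thesis unfolding order_cone_def by blast
qed

text \<open>Nonnegative differences give monotonicity along covers. A minimal element with negative
  label cannot exist: the maximum below it would be 0, or a negative label further down.\<close>

lemma order_cone_iff_transfer:
  assumes P: "finite P"
  shows "order_cone P y \<longleftrightarrow> (\<forall>p\<in>P. 0 \<le> transfer P y p)"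
proof
  show "order_cone P y \<Longrightarrow> \<forall>p\<in>P. 0 \<le> transfer P y p"
    using max_below_le[OF P] by (simp add: transfer_def)
next
  assume "\<forall>p\<in>P. 0 \<le> transfer P y p"
  then have le: "max_below P y p \<le> y p" if "p \<in> P" for p using that by (simp add: transfer_def)
  have mono: "y q \<le> y p" if "covers P q p" for p q
    using le_max_below[OF P that, of y] le[of p] coversD[OF that] by simp
  have "\<not> y p < 0" if "p \<in> P" for p
  proof
    assume "y p < 0"
    then have "finite {p \<in> P. y p < 0}" "{p \<in> P. y p < 0} \<noteq> {}" using that P by auto
    from finite_has_minimal[OF this] obtain m where m: "m \<in> P" "y m < 0"
      and min: "\<And>q. q \<in> P \<Longrightarrow> y q < 0 \<Longrightarrow> q \<le> m \<Longrightarrow> m = q" by auto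
    from max_below_cases[OF P, of y m] show False
    proof
      assume "max_below P y m = 0 \<and> (\<forall>q. \<not> covers P q m)"
      with le[OF m(1)] m(2) show False by simp
    next
      assume "\<exists>q. covers P q m \<and> max_below P y m = y q"
      then obtain q where q: "covers P q m" "max_below P y m = y q" by blast
      then have "y q < 0" "q \<in> P" "q \<le> m" "q \<noteq> m" using le[OF m(1)] m(2) coversD[OF q(1)] by auto
      with min[of q] show False by simp
    qed
  qed
  with mono show "order_cone P y" unfolding order_cone_def by force
qed

section \<open>Linear extensions and compositions of toggles\<close>

lemma linear_extension_exists:
  assumes "finite I"
  shows "\<exists>L. linear_extension I L"
  using assms
proof (induction "card I" arbitrary: I)
  case 0
  then have "I = {}" by simp
  then show ?case by (simp add: linear_extension_def bij_betw_def)
next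
  case (Suc n)
  then have "I \<noteq> {}" by auto
  from finite_has_maximal[OF Suc.prems this] obtain m where m: "m \<in> I" "\<And>q. q \<in> I \<Longrightarrow> m \<le> q \<Longrightarrow> m = q"
    by blast
  have n: "n = card (I - {m})" using Suc m(1) by simp
  then obtain L where L: "linear_extension (I - {m}) L" using Suc by auto
  have "bij_betw L (I - {m}) {1..n}" using L n by (simp add: linear_extension_def)
  then have bij: "bij_betw (L(m := Suc n)) (I - {m}) {1..n}" by (rule bij_betw_cong[THEN iffD1, rotated]) simp
  have "{1..card I} = {1..n} \<union> {Suc n}" "I = (I - {m}) \<union> {m}" using Suc.hyps(2) m(1) by auto
  then have "bij_betw (L(m := Suc n)) I {1..card I}"
    using bij_betw_combine[OF bij, of "{m}" "{Suc n}"] by simp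
  moreover have "(L(m := Suc n)) p \<le> (L(m := Suc n)) q" if pq: "p \<in> I" "q \<in> I" "p \<le> q" for p q
  proof (cases "p = m \<or> q = m")
    case True
    show ?thesis
    proof (cases "q = m")
      case True
      have "(L(m := Suc n)) p \<in> {1..card I}"
        using \<open>bij_betw (L(m := Suc n)) I {1..card I}\<close> pq(1) by (rule bij_betwE[rule_format])
      with True Suc.hyps(2) show ?thesis by simp
    next
      case False
      with True m(2)[OF pq(2)] pq(3) show ?thesis by simp
    qed
  next
    case False
    then show ?thesis using L pq by (simp add: linear_extension_def)
  qed
  ultimately show ?case unfolding linear_extension_def by blast
qed

text \<open>The list form of a linear extension. Composition along the list applies its last entry
  first, hence works from the top of the poset downwards.\<close>

definition topological_list :: "box list \<Rightarrow> bool" where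
  "topological_list ps \<longleftrightarrow> distinct ps \<and> sorted_wrt (\<lambda>p q. \<not> q < p) ps"

lemma linear_extension_list:
  assumes "finite I" "linear_extension I L"
  defines "ps \<equiv> map (inv_into I L) [1..<Suc (card I)]"
  shows "set ps = I" "topological_list ps"
proof -
  have bij: "bij_betw L I {1..card I}" and mono: "\<And>p q. p \<in> I \<Longrightarrow> q \<in> I \<Longrightarrow> p \<le> q \<Longrightarrow> L p \<le> L q"
    using assms(2) by (auto simp: linear_extension_def)
  have img: "{1..<Suc (card I)} = L ` I" using bij by (auto simp: bij_betw_def)
  have inj: "inj_on (inv_into I L) {1..<Suc (card I)}"
    unfolding img by (rule inj_on_inv_into) simp
  show "set ps = I"
  proof -
    have "set ps = inv_into I L ` (L ` I)" by (simp only: ps_def set_map set_upt img)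
    also have "\<dots> = I" by (rule inv_into_image_cancel) (use bij in \<open>simp_all add: bij_betw_def\<close>)
    finally show ?thesis .
  qed
  have "distinct ps" unfolding ps_def distinct_map set_upt using inj distinct_upt by blast
  moreover have "sorted_wrt (\<lambda>p q. \<not> q < p) ps"
    unfolding ps_def sorted_wrt_map
  proof (rule sorted_wrt_mono_rel[OF _ sorted_wrt_upt])
    fix k l assume kl: "k \<in> set [1..<Suc (card I)]" "l \<in> set [1..<Suc (card I)]" "k < l"
    then have k: "k \<in> L ` I" "l \<in> L ` I" using img by (auto simp flip: img)
    show "\<not> inv_into I L l < inv_into I L k"
    proof
      assume "inv_into I L l < inv_into I L k"
      then have "L (inv_into I L l) \<le> L (inv_into I L k)"
        using k by (intro mono inv_into_into) simp_all
      with k kl(3) show False by (simp add: f_inv_into_f)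
    qed
  qed
  ultimately show "topological_list ps" unfolding topological_list_def by simp
qed

lemma rho_list:
  assumes "finite I"
  obtains ps where "set ps = I" "topological_list ps" "rho P I = compose_list (map (toggle P) ps)"
proof
  let ?L = "SOME L. linear_extension I L"
  have L: "linear_extension I ?L" by (rule someI_ex[OF linear_extension_exists[OF assms]])
  show "set (map (inv_into I ?L) [1..<Suc (card I)]) = I"
    "topological_list (map (inv_into I ?L) [1..<Suc (card I)])"
    by (rule linear_extension_list[OF assms L])+
  show "rho P I = compose_list (map (toggle P) (map (inv_into I ?L) [1..<Suc (card I)]))"
    unfolding rho_def Let_def map_map comp_def ..
qed

lemma compose_list_Cons: "compose_list (f # fs) x = f (compose_list fs x)"
  by (simp add: compose_list_def)

lemma compose_list_Nil: "compose_list [] x = x"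
  by (simp add: compose_list_def)

text \<open>When \<open>p\<close> is toggled, the listed elements above it already have their new
  labels and those below it still have the old ones. The resulting equations depend only on the set
  of the list, so they describe \<open>rho\<close> whatever linear extension was chosen.\<close>

lemma compose_toggles:
  assumes "topological_list ps"
  shows "(\<forall>p\<in>set ps. compose_list (map (toggle P) ps) x p =
        min_above P (compose_list (map (toggle P) ps) x) p + max_below P x p - x p) \<and>
     (\<forall>p. p \<notin> set ps \<longrightarrow> compose_list (map (toggle P) ps) x p = x p)"
  using assms
proof (induction ps)
  case Nil
  then show ?case by (simp add: compose_list_Nil)
next
  case (Cons p ps)
  let ?y = "compose_list (map (toggle P) ps) x"
  have top: "topological_list ps" "p \<notin> set ps" "\<And>q. q \<in> set ps \<Longrightarrow> \<not> q < p"
    using Cons.prems by (auto simp: topological_list_def)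
  note IH = Cons.IH[OF top(1)]
  have z: "compose_list (map (toggle P) (p # ps)) x = ?y(p := min_above P ?y p + max_below P ?y p - ?y p)"
    by (simp only: list.map compose_list_Cons toggle_def)
  have ab: "min_above P (?y(p := a)) q = min_above P ?y q" if "q = p \<or> q \<in> set ps" for q a
    by (rule min_above_cong) (use that top(3) coversD in fastforce)
  have be: "max_below P ?y p = max_below P x p"
  proof (rule max_below_cong)
    fix q assume "covers P q p"
    then have "q \<notin> set ps" using top(3) coversD by blast
    then show "?y q = x q" using IH by simp
  qed
  have yp: "?y p = x p" using IH top(2) by blast
  have "(?y(p := a)) q = min_above P (?y(p := a)) q + max_below P x q - x q"
    if "q \<in> set (p # ps)" "a = min_above P ?y p + max_below P ?y p - ?y p" for q a
  proof (cases "q = p")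
    case True
    then show ?thesis using that(2) ab[of p] be yp by simp
  next
    case False
    then have q: "q \<in> set ps" using that(1) by simp
    have "?y q = min_above P ?y q + max_below P x q - x q" using IH q by blast
    then show ?thesis using ab[of q a] q False by simp
  qed
  moreover have "(?y(p := a)) q = x q" if "q \<notin> set (p # ps)" for q a
    using IH that by simp
  ultimately show ?case unfolding z by blast
qed

lemma rho_spec:
  assumes "finite I"
  shows "p \<in> I \<Longrightarrow> rho P I x p = min_above P (rho P I x) p + max_below P x p - x p"
    and "p \<notin> I \<Longrightarrow> rho P I x p = x p"
proof -
  obtain ps where "set ps = I" "topological_list ps" "rho P I = compose_list (map (toggle P) ps)"
    by (rule rho_list[OF assms, of P])
  with compose_toggles[of ps P x] show "p \<in> I \<Longrightarrow> rho P I x p = min_above P (rho P I x) p + max_below P x p - x p"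
    "p \<notin> I \<Longrightarrow> rho P I x p = x p" by metis+
qed

text \<open>Working downwards, each maximum is taken over original labels. The transfer map thus
  factors into shears of single coordinates.\<close>

lemma compose_transfers:
  fixes P :: "box set"
  assumes "topological_list ps"
  defines "t \<equiv> \<lambda>p x. x(p := x p - max_below P x p)"
  shows "(\<forall>p\<in>set ps. compose_list (map t ps) x p = x p - max_below P x p) \<and>
     (\<forall>p. p \<notin> set ps \<longrightarrow> compose_list (map t ps) x p = x p)"
  using assms(1)
proof (induction ps)
  case Nil
  then show ?case by (simp add: compose_list_Nil)
next
  case (Cons p ps)
  let ?y = "compose_list (map t ps) x"
  have top: "topological_list ps" "p \<notin> set ps" "\<And>q. q \<in> set ps \<Longrightarrow> \<not> q < p"
    using Cons.prems by (auto simp: topological_list_def)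
  note IH = Cons.IH[OF top(1)]
  have z: "compose_list (map t (p # ps)) x = ?y(p := ?y p - max_below P ?y p)"
    by (simp only: list.map compose_list_Cons t_def)
  have be: "max_below P ?y p = max_below P x p"
  proof (rule max_below_cong)
    fix q assume "covers P q p"
    then have "q \<notin> set ps" using top(3) coversD by blast
    then show "?y q = x q" using IH by simp
  qed
  have yp: "?y p = x p" using IH top(2) by blast
  show ?case unfolding z be yp using IH by simp
qed

text \<open>An equivalence for the cone, so that the property passes to inverses; \<open>RSK\<close>
  is built from inverses.\<close>

definition cone_iso :: "box set \<Rightarrow> (labeling \<Rightarrow> labeling) \<Rightarrow> bool" where
  "cone_iso P f \<longleftrightarrow> (\<exists>g. trop_iso P P f g) \<and> (\<forall>x\<in>labelings P. order_cone P (f x) \<longleftrightarrow> order_cone P x)"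

lemma cone_iso_in: "cone_iso P f \<Longrightarrow> x \<in> labelings P \<Longrightarrow> f x \<in> labelings P"
  unfolding cone_iso_def using trop_isoD(5) by metis

lemma cone_iso_id: "cone_iso P id"
  unfolding cone_iso_def using trop_iso_id by auto

lemma cone_iso_comp: "cone_iso P f \<Longrightarrow> cone_iso P g \<Longrightarrow> cone_iso P (f \<circ> g)"
  unfolding cone_iso_def using trop_iso_comp trop_isoD(5) by (metis comp_apply)

lemma cone_iso_compose_list: "(\<And>f. f \<in> set fs \<Longrightarrow> cone_iso P f) \<Longrightarrow> cone_iso P (compose_list fs)"
proof (induction fs)
  case Nil
  have "compose_list [] = id" by (simp add: compose_list_def)
  then show ?case by (simp only: cone_iso_id)
next
  case (Cons f fs)
  have e: "compose_list (f # fs) = f \<circ> compose_list fs" by (simp add: compose_list_def)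
  show ?case unfolding e by (rule cone_iso_comp[OF Cons.prems Cons.IH[OF Cons.prems]]) simp_all
qed

lemma inverse_on_right:
  assumes "trop_iso P P f g" "y \<in> labelings P"
  shows "f (inverse_on P f y) = y"
  using trop_isoD(3)[OF trop_iso_inverse_on[OF assms(1)] assms(2)] .

lemma cone_iso_inverse_on:
  assumes "cone_iso P f"
  shows "cone_iso P (inverse_on P f)"
proof -
  obtain g where g: "trop_iso P P f g" using assms unfolding cone_iso_def by blast
  have "order_cone P (inverse_on P f y) \<longleftrightarrow> order_cone P y" if "y \<in> labelings P" for y
    using assms inverse_on_right[OF g that] trop_isoD(5)[OF trop_iso_inverse_on[OF g] that]
    unfolding cone_iso_def by metis
  then show ?thesis unfolding cone_iso_def using trop_iso_inverse_on[OF g] by blast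
qed

section \<open>The rectangle as a poset\<close>

locale grid_size =
  fixes r s :: int
  assumes r: "1 \<le> r" and s: "1 \<le> s"
begin

abbreviation "G \<equiv> grid r s"

lemma covers_grid:
  "covers G p q \<longleftrightarrow> p \<in> G \<and> q \<in> G \<and> (q = (fst p + 1, snd p) \<or> q = (fst p, snd p + 1))"
proof -
  obtain i j k l where pq: "p = (i, j)" "q = (k, l)" by (metis surj_pair)
  show ?thesis
  proof
    assume c: "covers G p q"
    then have "p \<in> G" "q \<in> G" "p < q" and no: "\<And>z. z \<in> G \<Longrightarrow> p < z \<Longrightarrow> z < q \<Longrightarrow> False"
      unfolding covers_def by blast+
    from \<open>p < q\<close> have "i \<le> k" "j \<le> l" "\<not> (k \<le> i \<and> l \<le> j)"
      unfolding pq less_prod_def less_eq_prod_def by simp_all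
    show "p \<in> G \<and> q \<in> G \<and> (q = (fst p + 1, snd p) \<or> q = (fst p, snd p + 1))"
    proof (rule ccontr)
      assume n: "\<not> ?thesis"
      show False
      proof (cases "i < k")
        case True
        show False
          by (rule no[of "(i + 1, j)"])
            (use True n \<open>p \<in> G\<close> \<open>q \<in> G\<close> \<open>j \<le> l\<close> in \<open>auto simp: pq less_prod_def less_eq_prod_def\<close>)
      next
        case False
        show False
          by (rule no[of "(i, j + 1)"])
            (use False n \<open>p \<in> G\<close> \<open>q \<in> G\<close> \<open>j \<le> l\<close> \<open>i \<le> k\<close> \<open>\<not> (k \<le> i \<and> l \<le> j)\<close> in \<open>auto simp: pq less_prod_def less_eq_prod_def\<close>)
      qed
    qed
  next
    assume "p \<in> G \<and> q \<in> G \<and> (q = (fst p + 1, snd p) \<or> q = (fst p, snd p + 1))"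
    then have pG: "p \<in> G" "q \<in> G" and q: "(k = i + 1 \<and> l = j) \<or> (k = i \<and> l = j + 1)"
      by (simp_all add: pq)
    from q have "p < q" unfolding pq less_prod_def less_eq_prod_def by auto
    moreover have "\<not> (p < z \<and> z < q)" for z
    proof -
      obtain m n where z: "z = (m, n)" by (cases z)
      from q show ?thesis unfolding pq z less_prod_def less_eq_prod_def by auto
    qed
    ultimately show "covers G p q" using pG unfolding covers_def by blast
  qed
qed

definition below :: "labeling \<Rightarrow> int \<Rightarrow> int \<Rightarrow> real" where
  "below x i j = (if i = 1 \<and> j = 1 then 0 else if i = 1 then x (i, j - 1) else if j = 1 then x (i - 1, j)
     else max (x (i - 1, j)) (x (i, j - 1)))"

lemma max_below_grid: "(i, j) \<in> G \<Longrightarrow> max_below G x (i, j) = below x i j"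
proof -
  assume ij: "(i, j) \<in> G"
  then have "{q. covers G q (i, j)} = (if i = 1 then {} else {(i - 1, j)}) \<union> (if j = 1 then {} else {(i, j - 1)})"
    by (auto simp: covers_grid)
  then have "max_below G x (i, j) = (let A = (if i = 1 then {} else {(i - 1, j)}) \<union> (if j = 1 then {} else {(i, j - 1)})
      in if A = {} then 0 else Max (x ` A))"
    unfolding max_below_def by (simp only:)
  then show ?thesis by (auto simp: below_def Let_def max.commute)
qed

lemma min_above_grid:
  "(i, j) \<in> G \<Longrightarrow> (i, j) \<noteq> (r, s) \<Longrightarrow> min_above G x (i, j) =
     (if i = r then x (i, j + 1) else if j = s then x (i + 1, j) else min (x (i + 1, j)) (x (i, j + 1)))"
proof -
  assume ij: "(i, j) \<in> G" "(i, j) \<noteq> (r, s)"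
  then have "{q. covers G (i, j) q} = (if i = r then {} else {(i + 1, j)}) \<union> (if j = s then {} else {(i, j + 1)})"
    by (auto simp: covers_grid)
  then have "min_above G x (i, j) = (let A = (if i = r then {} else {(i + 1, j)}) \<union> (if j = s then {} else {(i, j + 1)})
      in if A = {} then 1 else Min (x ` A))"
    unfolding min_above_def by (simp only:)
  then show ?thesis using ij by (auto simp: Let_def min.commute)
qed

lemma trop_max_below: "p \<in> G \<Longrightarrow> (\<lambda>x. max_below G x p) \<in> trop G"
proof -
  assume p: "p \<in> G"
  obtain i j where ij: "p = (i, j)" by (cases p)
  have "(\<lambda>x. below x i j) \<in> trop G"
    using p unfolding below_def ij
    by (cases "i = 1"; cases "j = 1") (auto intro!: trop.intros)
  then show ?thesis using p unfolding ij by (simp add: max_below_grid)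
qed

lemma trop_min_above: "p \<in> G \<Longrightarrow> p \<noteq> (r, s) \<Longrightarrow> (\<lambda>x. min_above G x p) \<in> trop G"
proof -
  assume p: "p \<in> G" "p \<noteq> (r, s)"
  obtain i j where ij: "p = (i, j)" by (cases p)
  have "(\<lambda>x. if i = r then x (i, j + 1) else if j = s then x (i + 1, j) else min (x (i + 1, j)) (x (i, j + 1))) \<in> trop G"
    using p unfolding ij
    by (cases "i = r"; cases "j = s") (auto intro!: trop.intros)
  then show ?thesis using p unfolding ij by (simp add: min_above_grid)
qed

lemma not_covers_self: "\<not> covers G p p"
  by (simp add: covers_def)

lemma max_below_upd: "max_below G (x(p := t)) p = max_below G x p"
  by (rule max_below_cong) (use not_covers_self in auto)

lemma min_above_upd: "min_above G (x(p := t)) p = min_above G x p"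
  by (rule min_above_cong) (use not_covers_self in auto)

lemma trop_iso_toggle:
  assumes "p \<in> G" "p \<noteq> (r, s)"
  shows "trop_iso G G (toggle G p) (toggle G p)"
proof -
  let ?h = "\<lambda>x. min_above G x p + max_below G x p"
  have "trop_iso G G (\<lambda>x. x(p := ?h x + - 1 * x p)) (\<lambda>x. x(p := - 1 * (x p - ?h x)))"
    by (rule trop_iso_update)
      (use assms in \<open>auto simp: max_below_upd min_above_upd intro: trop.add trop_max_below trop_min_above\<close>)
  moreover have "(\<lambda>x. x(p := ?h x + - 1 * x p)) = toggle G p" "(\<lambda>x. x(p := - 1 * (x p - ?h x))) = toggle G p"
    by (simp_all add: toggle_def fun_eq_iff)
  ultimately show ?thesis by simp
qed

lemma cone_iso_toggle:
  assumes "p \<in> G" "p \<noteq> (r, s)"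
  shows "cone_iso G (toggle G p)"
proof -
  note iso = trop_iso_toggle[OF assms]
  obtain i j where ij: "p = (i, j)" by (cases p)
  have "covers G p (if i = r then (i, j + 1) else (i + 1, j))"
    using assms by (auto simp: covers_grid ij)
  from order_cone_toggle[OF _ this]
  have "order_cone G x \<Longrightarrow> order_cone G (toggle G p x)" for x by simp
  then show ?thesis unfolding cone_iso_def using iso trop_isoD(3)[OF iso] by metis
qed

lemma cone_iso_rho:
  assumes "I \<subseteq> G" "(r, s) \<notin> I"
  shows "cone_iso G (rho G I)"
proof -
  have "finite I" using assms(1) by (rule finite_subset) simp
  then obtain ps where ps: "set ps = I" "rho G I = compose_list (map (toggle G) ps)"
    by (rule rho_list)
  show ?thesis unfolding ps(2)
    by (rule cone_iso_compose_list) (use assms ps(1) cone_iso_toggle in auto)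
qed

lemma trop_iso_transfer: "\<exists>g. trop_iso G G (transfer G) g"
proof -
  obtain L where L: "linear_extension G L" using linear_extension_exists[of G] by auto
  define ps where "ps = map (inv_into G L) [1..<Suc (card G)]"
  have ps: "set ps = G" "topological_list ps"
    unfolding ps_def by (rule linear_extension_list[OF _ L], simp)+
  define t where "t p x = x(p := x p - max_below G x p)" for p and x :: labeling
  define u where "u p x = x(p := 1 * (x p - (0 - max_below G x p)))" for p and x :: labeling
  have "trop_iso G G (t p) (u p)" if "p \<in> G" for p
  proof -
    have "trop_iso G G (\<lambda>x. x(p := (0 - max_below G x p) + 1 * x p)) (\<lambda>x. x(p := 1 * (x p - (0 - max_below G x p))))"
      by (rule trop_iso_update[OF _ that trop.diff[OF trop.zero trop_max_below[OF that]]])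
        (simp_all add: max_below_upd)
    moreover have "(\<lambda>x. x(p := (0 - max_below G x p) + 1 * x p)) = t p"
      by (simp add: t_def fun_eq_iff)
    ultimately show ?thesis by (simp add: u_def[abs_def])
  qed
  then have "list_all2 (trop_iso G G) (map t ps) (map u ps)"
    unfolding list_all2_conv_all_nth by (metis length_map nth_map nth_mem ps(1))
  from trop_iso_compose_list[OF this]
  have "trop_iso G G (compose_list (map t ps)) (compose_list (rev (map u ps)))" .
  moreover have "compose_list (map t ps) x = transfer G x" if "x \<in> labelings G" for x
  proof
    fix p
    show "compose_list (map t ps) x p = transfer G x p"
    proof (cases "p \<in> G")
      case True
      then have "compose_list (map t ps) x p = x p - max_below G x p"
        using compose_transfers[OF ps(2), of G x] ps(1) unfolding t_def[abs_def] by blast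
      with True show ?thesis by (simp only: transfer_def restrict_apply if_True)
    next
      case False
      then have "compose_list (map t ps) x p = x p"
        using compose_transfers[OF ps(2), of G x] ps(1) unfolding t_def[abs_def] by blast
      with False PiE_arb[OF that False] show ?thesis by (simp only: transfer_def restrict_apply if_False)
    qed
  qed
  ultimately show ?thesis using trop_iso_cong by blast
qed

lemma inverse_transfer:
  assumes "x \<in> labelings G"
  shows "inverse_on G (transfer G) x \<in> labelings G" "transfer G (inverse_on G (transfer G) x) = x"
    "order_cone G (inverse_on G (transfer G) x) \<longleftrightarrow> (\<forall>p\<in>G. 0 \<le> x p)"
proof -
  obtain g where g: "trop_iso G G (transfer G) g" using trop_iso_transfer by blast
  show "inverse_on G (transfer G) x \<in> labelings G" by (rule trop_isoD(5)[OF trop_iso_inverse_on[OF g] assms])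
  show e: "transfer G (inverse_on G (transfer G) x) = x" by (rule inverse_on_right[OF g assms])
  show "order_cone G (inverse_on G (transfer G) x) \<longleftrightarrow> (\<forall>p\<in>G. 0 \<le> x p)"
    by (subst order_cone_iff_transfer) (simp_all add: e)
qed

abbreviation "inner_rho k \<equiv> rho G (grid (r - k) (s - k))"

lemma cone_iso_inner_rho: "1 \<le> k \<Longrightarrow> cone_iso G (inner_rho k)"
  by (rule cone_iso_rho) auto

section \<open>RSK in stages\<close>

text \<open>The intermediate results of \<open>RSK\<close>. Stage 0 consists of the last-passage
  values, the first parts of all shapes; each further stage replaces the labels on a smaller
  rectangle by the next parts.\<close>

fun stage :: "labeling \<Rightarrow> nat \<Rightarrow> labeling" where
  "stage x 0 = inverse_on G (transfer G) x"
| "stage x (Suc k) = inverse_on G (inner_rho (1 + int k)) (stage x k)"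

lemma stage_in: "x \<in> labelings G \<Longrightarrow> stage x k \<in> labelings G"
proof (induction k)
  case (Suc k)
  then show ?case using cone_iso_in[OF cone_iso_inverse_on[OF cone_iso_inner_rho[of "1 + int k"]]] by simp
qed (simp add: inverse_transfer)

lemma stage_Suc:
  assumes "x \<in> labelings G"
  shows "inner_rho (1 + int k) (stage x (Suc k)) = stage x k"
proof -
  obtain g where "trop_iso G G (inner_rho (1 + int k)) g"
    using cone_iso_inner_rho[of "1 + int k"] unfolding cone_iso_def by auto
  from inverse_on_right[OF this stage_in[OF assms]] show ?thesis by simp
qed

lemma stage_cone: "x \<in> labelings G \<Longrightarrow> order_cone G (stage x k) \<longleftrightarrow> (\<forall>p\<in>G. 0 \<le> x p)"
proof (induction k)
  case (Suc k)
  have "cone_iso G (inverse_on G (inner_rho (1 + int k)))"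
    by (rule cone_iso_inverse_on[OF cone_iso_inner_rho]) simp
  then show ?case using Suc stage_in[of x k] unfolding cone_iso_def by simp
qed (simp add: inverse_transfer)

lemma compose_inverse_rho:
  "compose_list (map (\<lambda>k. inverse_on G (inner_rho k)) (rev [1..int n])) (stage x 0) = stage x n"
proof (induction n)
  case (Suc n)
  have "[1..int (Suc n)] = [1..int n] @ [1 + int n]" by (simp add: upto_rec2)
  then have "compose_list (map (\<lambda>k. inverse_on G (inner_rho k)) (rev [1..int (Suc n)])) (stage x 0)
      = inverse_on G (inner_rho (1 + int n)) (compose_list (map (\<lambda>k. inverse_on G (inner_rho k)) (rev [1..int n])) (stage x 0))"
    by (simp only: rev_append rev.simps append_Nil append_Cons list.map compose_list_Cons)
  then show ?case unfolding Suc by simp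
qed (simp add: compose_list_Nil)

lemma RSK_stage: "RSK r s x = stage x (nat (min r s - 1))"
proof -
  have "int (nat (min r s - 1)) = min r s - 1" using r s by simp
  then show ?thesis
    using compose_inverse_rho[of "nat (min r s - 1)" x] unfolding RSK_def by (simp del: map_map rev_map)
qed

lemma cone_iso_rest: "cone_iso G (compose_list (map (\<lambda>k. inverse_on G (inner_rho k)) (rev [1..min r s - 1])))"
  by (rule cone_iso_compose_list) (auto intro!: cone_iso_inverse_on cone_iso_inner_rho)

lemma trop_iso_RSK: "\<exists>g. trop_iso G G (RSK r s) g"
proof -
  obtain g where g: "trop_iso G G (transfer G) g" using trop_iso_transfer by blast
  obtain g' where "trop_iso G G (compose_list (map (\<lambda>k. inverse_on G (inner_rho k)) (rev [1..min r s - 1]))) g'"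
    using cone_iso_rest unfolding cone_iso_def by blast
  from trop_iso_comp[OF this trop_iso_inverse_on[OF g]] show ?thesis unfolding RSK_def by blast
qed

lemma RSK_cone: "x \<in> labelings G \<Longrightarrow> order_cone G (RSK r s x) \<longleftrightarrow> (\<forall>p\<in>G. 0 \<le> x p)"
  unfolding RSK_stage by (rule stage_cone)

text \<open>Box \<open>(i, j)\<close> lies in \<open>grid (r - k) (s - k)\<close> only for
  \<open>k \<le> min (r - i) (s - j)\<close>; later stages leave its label alone.\<close>

lemma stage_stable:
  assumes x: "x \<in> labelings G" and "min (r - i) (s - j) \<le> int k"
  shows "stage x k (i, j) = stage x (nat (min (r - i) (s - j))) (i, j)"
  using assms(2)
proof (induction k)
  case (Suc k)
  show ?case
  proof (cases "min (r - i) (s - j) \<le> int k")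
    case True
    then have "(i, j) \<notin> grid (r - (1 + int k)) (s - (1 + int k))" by auto
    from rho_spec(2)[OF _ this, of G "stage x (Suc k)"]
    have "stage x (Suc k) (i, j) = stage x k (i, j)" unfolding stage_Suc[OF x] by simp
    with Suc.IH[OF True] show ?thesis by simp
  next
    case False
    with Suc.prems have "min (r - i) (s - j) = int (Suc k)" by simp
    then have "nat (min (r - i) (s - j)) = Suc k" by (simp only: nat_int)
    then show ?thesis by (simp only:)
  qed
qed simp

text \<open>Part \<open>l\<close> of the shape of \<open>[1, i] \<times> [1, j]\<close> is stored
  \<open>l - 1\<close> steps down the file of \<open>(i, j)\<close>.\<close>

definition shapes :: "labeling \<Rightarrow> int \<Rightarrow> int \<Rightarrow> int \<Rightarrow> real" where
  "shapes x l i j = stage x (nat (l - 1)) (i - l + 1, j - l + 1)"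

text \<open>The equation of \<open>rho\<close> for the passage from \<open>stage x (Suc k)\<close>
  back to \<open>stage x k\<close> is the local rule for \<open>l = k + 2\<close>: the minimum and
  the subtracted label are read in \<open>stage x k\<close>, which stores part \<open>l - 1\<close>,
  the maximum in \<open>stage x (Suc k)\<close>, which stores part \<open>l\<close>.\<close>

lemma ins_array_shapes:
  assumes x: "x \<in> labelings G"
  shows "ins_array r s (\<lambda>i j. x (i, j)) (shapes x)"
  unfolding ins_array_def
proof (intro allI impI)
  fix l i j assume *: "1 \<le> l \<and> l \<le> i \<and> l \<le> j \<and> i \<le> r \<and> j \<le> s"
  have low: "below (stage x (nat (l - 1))) (i - l + 1) (j - l + 1) =
     (if i = l \<and> j = l then 0 else if i = l then shapes x l i (j - 1)
      else if j = l then shapes x l (i - 1) j else max (shapes x l (i - 1) j) (shapes x l i (j - 1)))"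
    by (simp add: below_def shapes_def algebra_simps)
  show "shapes x l i j = ins_weight (\<lambda>i j. x (i, j)) (shapes x) l i j +
     (if i = l \<and> j = l then 0 else if i = l then shapes x l i (j - 1)
      else if j = l then shapes x l (i - 1) j else max (shapes x l (i - 1) j) (shapes x l i (j - 1)))"
  proof (cases "l = 1")
    case True
    have ij: "(i, j) \<in> G" using * by simp
    have "transfer G (stage x 0) (i, j) = x (i, j)" using inverse_transfer[OF x] by simp
    then have "stage x 0 (i, j) = x (i, j) + below (stage x 0) i j"
      using max_below_grid[OF ij] ij by (simp add: transfer_def)
    then show ?thesis unfolding low[symmetric] using True by (simp add: shapes_def ins_weight_def)
  next
    case False
    define k where "k = nat (l - 2)"
    have k: "l = int k + 2" using False * by (simp add: k_def)
    let ?i = "i - l + 1" and ?j = "j - l + 1"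
    have p: "(?i, ?j) \<in> grid (r - (1 + int k)) (s - (1 + int k))" "(?i, ?j) \<in> G" "(?i, ?j) \<noteq> (r, s)" "?i \<noteq> r" "?j \<noteq> s"
      using * k by auto
    have n: "nat (l - 1) = Suc k" "nat (l - 1 - 1) = k" using k by simp_all
    have "stage x k (?i, ?j) = min_above G (stage x k) (?i, ?j) + max_below G (stage x (Suc k)) (?i, ?j) - stage x (Suc k) (?i, ?j)"
      using rho_spec(1)[OF _ p(1), of G "stage x (Suc k)"] unfolding stage_Suc[OF x] by simp
    moreover have "min_above G (stage x k) (?i, ?j) = min (stage x k (?i + 1, ?j)) (stage x k (?i, ?j + 1))"
      using min_above_grid[OF p(2,3)] p(4,5) by simp
    moreover have "ins_weight (\<lambda>i j. x (i, j)) (shapes x) l i j =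
        min (stage x k (?i + 1, ?j)) (stage x k (?i, ?j + 1)) - stage x k (?i, ?j)"
      using False by (simp add: ins_weight_def shapes_def k_def algebra_simps min.commute)
    ultimately show ?thesis
      unfolding low[symmetric] using max_below_grid[OF p(2), of "stage x (Suc k)"] by (simp add: shapes_def n(1))
  qed
qed

text \<open>For \<open>i = r\<close> or \<open>j = s\<close> the storage box is exactly
  \<open>l - 1\<close> steps from the upper border, so stage \<open>l - 1\<close> is the last one
  that changes it.\<close>

lemma shapes_RSK:
  assumes "x \<in> labelings G" "1 \<le> l" "l \<le> i" "l \<le> j" "i \<le> r" "j \<le> s" "i = r \<or> j = s"
  shows "shapes x l i j = RSK r s x (i - l + 1, j - l + 1)"
proof -
  have m: "min (r - (i - l + 1)) (s - (j - l + 1)) = l - 1" using assms by auto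
  have "RSK r s x (i - l + 1, j - l + 1) = stage x (nat (l - 1)) (i - l + 1, j - l + 1)"
    unfolding RSK_stage m[symmetric] by (rule stage_stable[OF assms(1)]) (use assms m in auto)
  then show ?thesis by (simp add: shapes_def)
qed

section \<open>Promotion file by file\<close>

lemma cone_iso_promotion: "cone_iso G (promotion r s)"
  unfolding promotion_def
  by (rule cone_iso_compose_list) (auto intro!: cone_iso_rho simp: grid_file_def)

definition promote_from :: "int \<Rightarrow> labeling \<Rightarrow> labeling" where
  "promote_from k = compose_list (map (\<lambda>k. rho G (grid_file r s k)) [k..r - 1])"

lemma promotion_eq: "promotion r s = promote_from (r - s + 1)"
  by (simp only: promotion_def promote_from_def)

text \<open>No cover relation joins two boxes of the same file. Toggling file \<open>k\<close>
  therefore reads only file \<open>k + 1\<close>, which is final, and file \<open>k - 1\<close>,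
  which is untouched.\<close>

lemma promotion_from:
  assumes "r - s < k"
  shows "(\<forall>i c. (i, c) \<in> G \<and> i - c < k \<longrightarrow> promote_from k y (i, c) = y (i, c)) \<and>
    (\<forall>i c. (i, c) \<in> G \<and> k \<le> i - c \<longrightarrow> promote_from k y (i, c) =
      (if i < r then min (promote_from k y (i + 1, c)) (y (i, c + 1)) else y (i, c + 1)) +
       (if i = 1 \<and> c = 1 then 0 else if i = 1 then promote_from k y (i, c - 1)
        else if c = 1 then y (i - 1, c) else max (promote_from k y (i, c - 1)) (y (i - 1, c)))
       - y (i, c))"
  using assms
proof (induction "nat (r - k)" arbitrary: k)
  case 0
  then show ?case by (simp add: promote_from_def compose_list_Nil)
next
  case (Suc n)
  let ?Z = "\<lambda>k. promote_from k y"
  have k: "k \<le> r - 1" using Suc.hyps(2) by linarith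
  have "n = nat (r - (k + 1))" "r - s < k + 1" using Suc by simp_all
  note IH = Suc.hyps(1)[OF this]
  have Z: "?Z k = rho G (grid_file r s k) (?Z (k + 1))"
    using k by (simp add: promote_from_def upto_rec1 compose_list_Cons)
  have fin: "finite (grid_file r s k)" by (rule finite_subset[of _ G]) (auto simp: grid_file_def)
  have out: "?Z k (i, c) = ?Z (k + 1) (i, c)" if "i - c \<noteq> k" for i c
    unfolding Z by (rule rho_spec(2)[OF fin]) (use that in \<open>simp add: grid_file_def\<close>)
  have IH1: "?Z (k + 1) (i, c) = y (i, c)" if "(i, c) \<in> G" "i - c \<le> k" for i c
    using IH that by simp
  show ?case
  proof (intro conjI allI impI)
    fix i c assume ic: "(i, c) \<in> G \<and> i - c < k"
    then show "?Z k (i, c) = y (i, c)" using out[of i c] IH1[of i c] by simp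
  next
    fix i c assume ic: "(i, c) \<in> G \<and> k \<le> i - c"
    let ?F = "\<lambda>Z. (if i < r then min (Z (i + 1, c)) (y (i, c + 1)) else y (i, c + 1)) +
       (if i = 1 \<and> c = 1 then 0 else if i = 1 then Z (i, c - 1)
        else if c = 1 then y (i - 1, c) else max (Z (i, c - 1)) (y (i - 1, c))) - y (i, c) :: real"
    show "?Z k (i, c) = ?F (?Z k)"
    proof (cases "i - c = k")
      case False
      then have IH': "?Z (k + 1) (i, c) = ?F (?Z (k + 1))"
        by (intro conjunct2[OF IH, rule_format]) (use ic in simp)
      have "?Z k (i, c) = ?Z (k + 1) (i, c)" "?Z k (i + 1, c) = ?Z (k + 1) (i + 1, c)"
        "?Z k (i, c - 1) = ?Z (k + 1) (i, c - 1)"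
        using False ic by (auto intro!: out)
      then show ?thesis by (simp only:) (rule IH')
    next
      case True
      \<comment> \<open>A file index above \<open>r - s\<close> forces \<open>c < s\<close>: the box
        is not the top one, and \<open>(i, c + 1)\<close> is one of its upper covers.\<close>
      have G: "(i, c) \<in> G" "(i, c) \<noteq> (r, s)" "c \<noteq> s" "c < s" using ic True Suc.prems by auto
      have "(i, c) \<in> grid_file r s k" using True ic by (simp add: grid_file_def)
      from rho_spec(1)[OF fin this, of G "?Z (k + 1)"]
      have "?Z k (i, c) = min_above G (?Z k) (i, c) + below (?Z (k + 1)) i c - ?Z (k + 1) (i, c)"
        unfolding Z max_below_grid[OF G(1)] .
      moreover have "min_above G (?Z k) (i, c) = (if i < r then min (?Z k (i + 1, c)) (y (i, c + 1)) else y (i, c + 1))"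
        unfolding min_above_grid[OF G(1,2)] using out[of i "c + 1"] IH1[of i "c + 1"] True G by auto
      moreover have "below (?Z (k + 1)) i c = (if i = 1 \<and> c = 1 then 0 else if i = 1 then ?Z k (i, c - 1)
        else if c = 1 then y (i - 1, c) else max (?Z k (i, c - 1)) (y (i - 1, c)))"
        unfolding below_def using out[of i "c - 1"] IH1[of "i - 1" c] True G by (auto simp: max.commute)
      moreover have "?Z (k + 1) (i, c) = y (i, c)" using IH1 G True by simp
      ultimately show ?thesis by simp
    qed
  qed
qed

lemma promoted_promotion: "promoted r s (\<lambda>i j. y (i, j)) (\<lambda>i j. promotion r s y (i, j))"
  unfolding promoted_def
proof (intro allI impI)
  fix i c assume *: "1 \<le> i \<and> i \<le> r \<and> 1 \<le> c \<and> r - s < i - c"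
  then have ic: "(i, c) \<in> G \<and> r - s + 1 \<le> i - c" by auto
  have "r - s < r - s + 1" by simp
  from conjunct2[OF promotion_from[OF this, of y], rule_format, OF ic, folded promotion_eq]
  show "promotion r s y (i, c) = (if i < r then min (promotion r s y (i + 1, c)) (y (i, c + 1)) else y (i, c + 1)) +
       (if i = 1 \<and> c = 1 then 0 else if i = 1 then promotion r s y (i, c - 1)
        else if c = 1 then y (i - 1, c) else max (promotion r s y (i, c - 1)) (y (i - 1, c))) - y (i, c)" .
qed

lemma promotion_fixes: "(i, j) \<in> G \<Longrightarrow> i - j \<le> r - s \<Longrightarrow> promotion r s y (i, j) = y (i, j)"
  unfolding promotion_eq using conjunct1[OF promotion_from[of "r - s + 1" y]] by simp

lemma trop_iso_Omega: "\<exists>g. trop_iso G G (Omega_grid r s) g"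
proof -
  obtain g where g: "trop_iso G G (RSK r s) g" using trop_iso_RSK by blast
  obtain h where h: "trop_iso G G (promotion r s) h" using cone_iso_promotion unfolding cone_iso_def by blast
  from trop_iso_comp[OF trop_iso_comp[OF trop_iso_inverse_on[OF g] h] g]
  show ?thesis unfolding Omega_grid_def by blast
qed

lemma RSK_in: "x \<in> labelings G \<Longrightarrow> RSK r s x \<in> labelings G"
  unfolding RSK_stage by (rule stage_in)

lemma Omega_in: "x \<in> labelings G \<Longrightarrow> Omega_grid r s x \<in> labelings G"
  using trop_iso_Omega by (elim exE) (rule trop_isoD(5))

lemma RSK_Omega:
  assumes "x \<in> labelings G"
  shows "RSK r s (Omega_grid r s x) = promotion r s (RSK r s x)"
proof -
  obtain g where g: "trop_iso G G (RSK r s) g" using trop_iso_RSK by blast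
  have "promotion r s (RSK r s x) \<in> labelings G"
    by (rule cone_iso_in[OF cone_iso_promotion RSK_in[OF assms]])
  from inverse_on_right[OF g this] show ?thesis by (simp add: Omega_grid_def)
qed

text \<open>\<open>RSK\<close> matches nonnegative labelings with the order cone, and promotion
  preserves the cone in both directions.\<close>

lemma Omega_nonneg:
  assumes "x \<in> labelings G"
  shows "(\<forall>p\<in>G. 0 \<le> Omega_grid r s x p) \<longleftrightarrow> (\<forall>p\<in>G. 0 \<le> x p)"
proof -
  have "order_cone G (promotion r s (RSK r s x)) \<longleftrightarrow> order_cone G (RSK r s x)"
    by (rule conjunct2[OF cone_iso_promotion[unfolded cone_iso_def], rule_format, OF RSK_in[OF assms]])
  then show ?thesis
    using RSK_cone[OF assms] RSK_cone[OF Omega_in[OF assms]] unfolding RSK_Omega[OF assms] by (simp only:)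
qed

theorem Omega_columns:
  assumes x: "x \<in> labelings G"
  shows "net_eqv K lo r (rows (\<lambda>j i. x (i, j)) s) (rows (\<lambda>j i. Omega_grid r s x (i, j)) s)"
proof (rule net_eqv_columns[OF ins_array_shapes[OF x] ins_array_shapes[OF Omega_in[OF x]]])
  fix l i assume "1 \<le> l" "l \<le> s" "l \<le> i" "i \<le> r"
  then show "shapes x l i s = shapes (Omega_grid r s x) l i s"
    using promotion_fixes[of "i - l + 1" "s - l + 1" "RSK r s x"]
    by (simp add: shapes_RSK x Omega_in RSK_Omega)
qed (use s in simp)

theorem Omega_rows:
  assumes x: "x \<in> labelings G"
  shows "net_eqv K 2 s (rows (\<lambda>i j. x (i, j)) r) (shift_net 1 (rows (\<lambda>i j. Omega_grid r s x (i, j)) r))"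
  by (rule net_eqv_rows[OF ins_array_shapes[OF x] ins_array_shapes[OF Omega_in[OF x]] r promoted_promotion[of "RSK r s x"]])
    (simp_all add: shapes_RSK x Omega_in RSK_Omega)

end

subsection \<open>Path systems as reachable weights\<close>

text \<open>The vertex set of a lattice path that enters row \<open>i\<close> in column
  \<open>E (i - 1)\<close> and leaves it in column \<open>E i\<close>.\<close>

abbreviation staircase :: "int \<Rightarrow> int \<Rightarrow> (int \<Rightarrow> int) \<Rightarrow> box set" where
  "staircase a b E \<equiv> Sigma {a..b} (\<lambda>i. {E (i - 1)..E i})"

lemma lattice_path_staircase:
  assumes "lattice_path (a, c) (b, d) w"
  shows "\<exists>E. a \<le> b \<and> E (a - 1) = c \<and> E b = d \<and> (\<forall>i\<in>{a..b}. E (i - 1) \<le> E i) \<and> set w = staircase a b E"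
  using assms
proof (induction w arbitrary: a c)
  case Nil
  then show ?case by (simp add: lattice_path_def)
next
  case (Cons p w)
  then have p: "p = (a, c)" by (simp add: lattice_path_def)
  show ?case
  proof (cases w)
    case Nil
    then have "b = a" "d = c" using Cons.prems p by (simp_all add: lattice_path_def)
    then show ?thesis using Nil p by (intro exI[of _ "\<lambda>_. c"]) auto
  next
    case (Cons p' w')
    obtain a' c' where p': "p' = (a', c')" by (cases p')
    have step: "(a', c') = (a + 1, c) \<or> (a', c') = (a, c + 1)"
      and path: "lattice_path (a', c') (b, d) w"
      using Cons.prems unfolding lattice_path_def local.Cons p p' by (simp_all add: local.Cons)
    from Cons.IH[OF path] obtain E where E: "a' \<le> b" "E (a' - 1) = c'" "E b = d"
      "\<forall>i\<in>{a'..b}. E (i - 1) \<le> E i" "set w = staircase a' b E" by blast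
    \<comment> \<open>After a down step this adds the entry column of the new first row; after a
      right step it moves the entry column of the first row from \<open>c + 1\<close> back to
      \<open>c\<close>.\<close>
    let ?E = "E(a - 1 := c)"
    have "a \<le> b" using step E(1) by auto
    moreover have "?E b = d" using E(3) \<open>a \<le> b\<close> by simp
    moreover have "\<forall>i\<in>{a..b}. ?E (i - 1) \<le> ?E i"
    proof
      fix i assume i: "i \<in> {a..b}"
      show "?E (i - 1) \<le> ?E i"
        using step i E(2) E(4) by (cases "i = a") force+
    qed
    moreover have "set (p # w) = staircase a b ?E"
      using step
    proof
      assume s: "(a', c') = (a + 1, c)"
      have "staircase a b ?E = {(a, c)} \<union> staircase (a + 1) b E"
      proof (rule set_eqI)
        fix q :: box
        obtain i j where q: "q = (i, j)" by (cases q)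
        have "E a = c" "(i - 1 = a - 1) = (i = a)" using s E(2) by auto
        then show "q \<in> staircase a b ?E \<longleftrightarrow> q \<in> {(a, c)} \<union> staircase (a + 1) b E"
          using \<open>a \<le> b\<close> unfolding q by (cases "i = a") auto
      qed
      then show ?thesis using E(5) s p by simp
    next
      assume s: "(a', c') = (a, c + 1)"
      have "E a \<ge> c + 1" using E(1,2,4) s by force
      have "staircase a b ?E = {(a, c)} \<union> staircase a b E"
      proof (rule set_eqI)
        fix q :: box
        obtain i j where q: "q = (i, j)" by (cases q)
        have "E (a - 1) = c + 1" "(i - 1 = a - 1) = (i = a)" using s E(2) by auto
        then show "q \<in> staircase a b ?E \<longleftrightarrow> q \<in> {(a, c)} \<union> staircase a b E"
          using \<open>a \<le> b\<close> \<open>E a \<ge> c + 1\<close> unfolding q by (cases "i = a") auto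
      qed
      then show ?thesis using E(5) s p by simp
    qed
    ultimately show ?thesis by (intro exI[of _ ?E]) simp
  qed
qed

abbreviation path_step :: "box \<Rightarrow> box \<Rightarrow> bool" where
  "path_step \<equiv> \<lambda>(i, j) (i', j'). (i', j') = (i + 1, j) \<or> (i', j') = (i, j + 1)"

lemma row_path: "c \<le> d \<Longrightarrow> lattice_path (a, c) (a, d) (map (Pair a) [c..d])"
proof (induction d rule: int_ge_induct)
  case base
  then show ?case by (simp add: lattice_path_def)
next
  case (step d)
  have u: "[c..d + 1] = [c..d] @ [d + 1]" using step by (simp add: upto_rec2)
  show ?case using step unfolding u
    by (simp add: lattice_path_def successively_append_iff hd_append)
qed

lemma staircase_lattice_path:
  assumes "a \<le> b" "\<forall>i\<in>{a..b}. E (i - 1) \<le> E i"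
  shows "\<exists>w. lattice_path (a, E (a - 1)) (b, E b) w \<and> set w = staircase a b E"
  using assms
proof (induction b rule: int_ge_induct)
  case base
  then show ?case
    by (intro exI[of _ "map (Pair a) [E (a - 1)..E a]"]) (auto intro!: row_path)
next
  case (step b)
  then obtain w where w: "lattice_path (a, E (a - 1)) (b, E b) w" "set w = staircase a b E" by auto
  let ?v = "map (Pair (b + 1)) [E b..E (b + 1)]"
  have v: "lattice_path (b + 1, E b) (b + 1, E (b + 1)) ?v"
    by (rule row_path) (use step in force)
  have "lattice_path (a, E (a - 1)) (b + 1, E (b + 1)) (w @ ?v)"
    using w(1) v unfolding lattice_path_def by (auto simp: successively_append_iff)
  moreover have "{a..b + 1} = insert (b + 1) {a..b}" using step by auto
  then have "set (w @ ?v) = staircase a (b + 1) E" using w(2) by auto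
  ultimately show ?case by blast
qed

lemma reach_upto:
  assumes "u1 - 1 \<le> u2"
  shows "reach K (map (\<lambda>i. (b, U i)) [u1..u2]) A B W \<longleftrightarrow>
    (\<exists>C. C (u1 - 1) = A \<and> C u2 = B \<and> (\<forall>i\<in>{u1..u2}. nstep K b (C (i - 1)) (C i)) \<and>
       W = (\<Sum>i\<in>{u1..u2}. nweight K (U i) (C (i - 1)) (C i)))"
  using assms
proof (induction u2 arbitrary: B W rule: int_ge_induct)
  case base
  show ?case by (auto intro: exI[of _ "\<lambda>_. A"])
next
  case (step u2)
  have u: "[u1..u2 + 1] = [u1..u2] @ [u2 + 1]" using step by (simp add: upto_rec2)
  have ins: "{u1..u2 + 1} = insert (u2 + 1) {u1..u2}" using step by auto
  show ?case (is "?L \<longleftrightarrow> ?R")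
  proof
    assume ?L
    then obtain D w1 w2 where D: "reach K (map (\<lambda>i. (b, U i)) [u1..u2]) A D w1"
      "reach K [(b, U (u2 + 1))] D B w2" "W = w1 + w2"
      unfolding u map_append reach_append by auto
    from D(1) obtain C where C: "C (u1 - 1) = A" "C u2 = D" "\<forall>i\<in>{u1..u2}. nstep K b (C (i - 1)) (C i)"
      "w1 = (\<Sum>i\<in>{u1..u2}. nweight K (U i) (C (i - 1)) (C i))" unfolding step.IH by blast
    let ?C = "C(u2 + 1 := B)"
    have "(\<Sum>i\<in>{u1..u2}. nweight K (U i) (?C (i - 1)) (?C i)) = w1"
      unfolding C(4) by (intro sum.cong) auto
    then have "W = (\<Sum>i\<in>{u1..u2 + 1}. nweight K (U i) (?C (i - 1)) (?C i))"
      using D(2,3) C(2) unfolding ins reach_singleton by simp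
    moreover have "\<forall>i\<in>{u1..u2 + 1}. nstep K b (?C (i - 1)) (?C i)"
      using C(2,3) D(2) unfolding ins reach_singleton by simp
    ultimately show ?R using C(1) step by (intro exI[of _ ?C]) simp
  next
    assume ?R
    then obtain C where C: "C (u1 - 1) = A" "C (u2 + 1) = B" "\<forall>i\<in>{u1..u2 + 1}. nstep K b (C (i - 1)) (C i)"
      "W = (\<Sum>i\<in>{u1..u2 + 1}. nweight K (U i) (C (i - 1)) (C i))" by blast
    have "reach K (map (\<lambda>i. (b, U i)) [u1..u2]) A (C u2) (\<Sum>i\<in>{u1..u2}. nweight K (U i) (C (i - 1)) (C i))"
      unfolding step.IH using C by (intro exI[of _ C]) simp
    moreover have "reach K [(b, U (u2 + 1))] (C u2) B (nweight K (U (u2 + 1)) (C u2) B)"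
      unfolding reach_singleton using C(2,3) unfolding ins by simp
    moreover have "W = (\<Sum>i\<in>{u1..u2}. nweight K (U i) (C (i - 1)) (C i)) + nweight K (U (u2 + 1)) (C u2) B"
      using C(2,4) unfolding ins by simp
    ultimately show ?L unfolding u map_append reach_append list.map by blast
  qed
qed

text \<open>\<open>b\<close> is both the threshold and the base of the partial sums. It is placed to
  the left of all positions considered, so that nothing is frozen.\<close>

definition strip :: "(box \<Rightarrow> real) \<Rightarrow> int \<Rightarrow> int \<Rightarrow> int \<Rightarrow> net" where
  "strip x b u1 u2 = map (\<lambda>i. (b, psum b (\<lambda>j. x (i, j)))) [u1..u2]"

lemma psum_diff:
  assumes "b \<le> a" "a \<le> c"
  shows "psum b f c - psum b f (a - 1) = (\<Sum>j\<in>{a..c}. f j)"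
proof -
  have "{b..c} = {b..a - 1} \<union> {a..c}" using assms by auto
  then show ?thesis unfolding psum_def by (simp add: sum.union_disjoint)
qed

lemma staircase_sum:
  assumes "\<And>i. i \<in> {u1..u2} \<Longrightarrow> b \<le> E (i - 1) \<and> E (i - 1) \<le> E i"
  shows "(\<Sum>v\<in>staircase u1 u2 E. x v) =
    (\<Sum>i\<in>{u1..u2}. psum b (\<lambda>j. x (i, j)) (E i) - psum b (\<lambda>j. x (i, j)) (E (i - 1) - 1))"
proof -
  have "(\<Sum>v\<in>staircase u1 u2 E. x v) = (\<Sum>i\<in>{u1..u2}. \<Sum>j\<in>{E (i - 1)..E i}. x (i, j))"
    by (subst sum.Sigma) (auto intro!: sum.cong)
  then show ?thesis using assms by (simp add: psum_diff)
qed

lemma chain_mono: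
  assumes "\<And>i :: int. i \<in> {u1..u2} \<Longrightarrow> E (i - 1) \<le> (E i :: int)" "u1 - 1 \<le> i" "i \<le> u2"
  shows "E (u1 - 1) \<le> E i"
  using assms(2,3)
proof (induction i rule: int_ge_induct)
  case (step i)
  then show ?case using assms(1)[of "i + 1"] by simp
qed simp

text \<open>The positions after row \<open>i\<close> are the columns in which the paths leave that
  row, and disjointness of consecutive paths is the separation condition of
  \<open>nstep\<close>.\<close>

theorem path_system_reach:
  assumes "u1 \<le> u2"
  shows "(\<exists>w. path_system (u1, u2, v1, v2) k w \<and> W = (\<Sum>l<k. \<Sum>v\<in>set (w l). x v)) \<longleftrightarrow>
    reach k (strip x v1 u1 u2) (\<lambda>l. v1 + int l) (\<lambda>l. v2 - int k + 1 + int l) W"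
proof
  let ?A = "\<lambda>l. v1 + int l" and ?B = "\<lambda>l. v2 - int k + 1 + int l"
  let ?p = "\<lambda>i. psum v1 (\<lambda>j. x (i, j))"
  assume "\<exists>w. path_system (u1, u2, v1, v2) k w \<and> W = (\<Sum>l<k. \<Sum>v\<in>set (w l). x v)"
  then obtain w where w: "\<And>l. l < k \<Longrightarrow> lattice_path (u1, ?A l) (u2, ?B l) (w l)"
    "\<And>l l'. l < k \<Longrightarrow> l' < k \<Longrightarrow> l \<noteq> l' \<Longrightarrow> set (w l) \<inter> set (w l') = {}"
    and W: "W = (\<Sum>l<k. \<Sum>v\<in>set (w l). x v)" unfolding path_system.simps by blast
  have "\<forall>l\<in>{..<k}. \<exists>E. E (u1 - 1) = ?A l \<and> E u2 = ?B l \<and> (\<forall>i\<in>{u1..u2}. E (i - 1) \<le> E i) \<and>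
      set (w l) = staircase u1 u2 E"
    using lattice_path_staircase[OF w(1)] by blast
  from bchoice[OF this] obtain E where E: "\<And>l. l < k \<Longrightarrow> E l (u1 - 1) = ?A l \<and> E l u2 = ?B l \<and>
      (\<forall>i\<in>{u1..u2}. E l (i - 1) \<le> E l i) \<and> set (w l) = staircase u1 u2 (E l)" by auto
  have mono: "E l (i - 1) \<le> E l i" if "l < k" "u1 \<le> i" "i \<le> u2" for l i using E that by simp
  have low: "v1 \<le> E l i" if "l < k" "u1 - 1 \<le> i" "i \<le> u2" for l i
    using chain_mono[of u1 u2 "E l" i] E that by force
  \<comment> \<open>The order at the entry of a row comes from the previous row. If path
    \<open>l\<close> got as far as the entry of path \<open>Suc l\<close>, that box would lie on
    both paths.\<close>
  have sep: "E l i < E (Suc l) (i - 1)" if "Suc l < k" "u1 \<le> i" "i \<le> u2" for l i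
    using that(2,3)
  proof (induction i rule: int_ge_induct)
    case base
    have "E l (u1 - 1) < E (Suc l) (u1 - 1)" using E that(1) by simp
    moreover have "\<not> E (Suc l) (u1 - 1) \<le> E l u1"
    proof
      assume "E (Suc l) (u1 - 1) \<le> E l u1"
      then have "(u1, E (Suc l) (u1 - 1)) \<in> set (w l) \<inter> set (w (Suc l))"
        using calculation E[of l] E[of "Suc l"] that(1) assms mono[of "Suc l" u1] by simp
      with w(2)[of l "Suc l"] that(1) show False by simp
    qed
    ultimately show ?case by simp
  next
    case (step i)
    then have "E l i < E (Suc l) i" using mono[of "Suc l" i] that(1) by simp
    moreover have "\<not> E (Suc l) i \<le> E l (i + 1)"
    proof
      assume "E (Suc l) i \<le> E l (i + 1)"
      then have "(i + 1, E (Suc l) i) \<in> set (w l) \<inter> set (w (Suc l))"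
        using calculation E[of l] E[of "Suc l"] that(1) step mono[of "Suc l" "i + 1"] by simp
      with w(2)[of l "Suc l"] that(1) show False by simp
    qed
    ultimately show ?case by simp
  qed
  \<comment> \<open>From index \<open>k\<close> on the values only have to match the two end
    functions, since \<open>reach\<close> fixes its ends as whole functions.\<close>
  define C where "C i l = (if l < k then E l i else if i = u1 - 1 then ?A l else ?B l)" for i l
  show "reach k (strip x v1 u1 u2) ?A ?B W"
    unfolding strip_def
  proof (subst reach_upto, use assms in simp, intro exI[of _ C] conjI ballI)
    show "C (u1 - 1) = ?A" "C u2 = ?B" using E assms by (auto simp: C_def)
    show "nstep k v1 (C (i - 1)) (C i)" if "i \<in> {u1..u2}" for i
      unfolding nstep_def
    proof (intro conjI allI impI)
      fix l assume l: "l < k"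
      then have "v1 \<le> E l (i - 1)" "E l (i - 1) \<le> E l i" using that low[of l "i - 1"] mono[of l i] by auto
      then show "if C (i - 1) l < v1 then C i l = C (i - 1) l else C (i - 1) l \<le> C i l"
        using l by (simp add: C_def)
    next
      fix l assume "Suc l < k"
      then show "C i l < C (i - 1) (Suc l)" using sep[of l i] that by (simp add: C_def)
    qed
    have "W = (\<Sum>l<k. \<Sum>i\<in>{u1..u2}. ?p i (E l i) - ?p i (E l (i - 1) - 1))"
      unfolding W
    proof (rule sum.cong[OF refl])
      fix l assume "l \<in> {..<k}"
      then have l: "l < k" by simp
      then have "set (w l) = staircase u1 u2 (E l)" using E by blast
      then show "(\<Sum>v\<in>set (w l). x v) = (\<Sum>i\<in>{u1..u2}. ?p i (E l i) - ?p i (E l (i - 1) - 1))"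
        by (simp only:) (rule staircase_sum, use low l mono in auto)
    qed
    then show "W = (\<Sum>i\<in>{u1..u2}. nweight k (?p i) (C (i - 1)) (C i))"
      unfolding nweight_def by (subst sum.swap) (simp add: C_def)
  qed
next
  let ?A = "\<lambda>l. v1 + int l" and ?B = "\<lambda>l. v2 - int k + 1 + int l"
  let ?p = "\<lambda>i. psum v1 (\<lambda>j. x (i, j))"
  assume "reach k (strip x v1 u1 u2) ?A ?B W"
  then obtain C where C: "C (u1 - 1) = ?A" "C u2 = ?B" "\<And>i. i \<in> {u1..u2} \<Longrightarrow> nstep k v1 (C (i - 1)) (C i)"
    and W: "W = (\<Sum>i\<in>{u1..u2}. nweight k (?p i) (C (i - 1)) (C i))"
    unfolding strip_def using reach_upto[of u1 u2 k v1 "?p" ?A ?B W] assms by auto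
  have mono: "C (i - 1) l \<le> C i l" if "i \<in> {u1..u2}" "l < k" for i l
    by (rule nstep_mono[OF C(3)[OF that(1)] that(2)])
  have low: "v1 \<le> C i l" if "l < k" "u1 - 1 \<le> i" "i \<le> u2" for l i
    using chain_mono[of u1 u2 "\<lambda>i. C i l" i] mono that C(1) by force
  have sep: "C i l < C (i - 1) l'" if "i \<in> {u1..u2}" "l < l'" "l' < k" for i l l'
    using that(2,3)
  proof (induction l')
    case (Suc l')
    have "C i l' < C (i - 1) (Suc l')" using C(3)[OF that(1)] Suc.prems(2) unfolding nstep_def by simp
    moreover have "C (i - 1) l' \<le> C i l'" using mono[OF that(1)] Suc.prems(2) by simp
    ultimately show ?case using Suc by (cases "l = l'") simp_all
  qed simp
  have "\<forall>l\<in>{..<k}. \<exists>w. lattice_path (u1, ?A l) (u2, ?B l) w \<and> set w = staircase u1 u2 (\<lambda>i. C i l)"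
  proof
    fix l assume "l \<in> {..<k}"
    then show "\<exists>w. lattice_path (u1, ?A l) (u2, ?B l) w \<and> set w = staircase u1 u2 (\<lambda>i. C i l)"
      using staircase_lattice_path[of u1 u2 "\<lambda>i. C i l"] mono assms C(1,2) by simp
  qed
  from bchoice[OF this] obtain w where w: "\<And>l. l < k \<Longrightarrow> lattice_path (u1, ?A l) (u2, ?B l) (w l) \<and>
      set (w l) = staircase u1 u2 (\<lambda>i. C i l)" by auto
  have disj: "set (w l) \<inter> set (w l') = {}" if "l < l'" "l' < k" for l l'
  proof -
    have "set (w l) = staircase u1 u2 (\<lambda>i. C i l)" "set (w l') = staircase u1 u2 (\<lambda>i. C i l')"
      using w that by simp_all
    moreover have "(i, j) \<notin> staircase u1 u2 (\<lambda>i. C i l')" if "(i, j) \<in> staircase u1 u2 (\<lambda>i. C i l)" for i j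
      using sep[of i l l'] \<open>l < l'\<close> \<open>l' < k\<close> that by auto
    ultimately show ?thesis by auto
  qed
  have "path_system (u1, u2, v1, v2) k w"
    unfolding path_system.simps
  proof (intro conjI allI impI)
    show "lattice_path (u1, ?A l) (u2, ?B l) (w l)" if "l < k" for l using w that by simp
    show "set (w l) \<inter> set (w l') = {}" if "l < k" "l' < k" "l \<noteq> l'" for l l'
      using disj[of l l'] disj[of l' l] that by (cases "l < l'") auto
  qed
  moreover have "W = (\<Sum>l<k. \<Sum>v\<in>set (w l). x v)"
  proof -
    have "(\<Sum>v\<in>set (w l). x v) = (\<Sum>i\<in>{u1..u2}. ?p i (C i l) - ?p i (C (i - 1) l - 1))"
      if "l < k" for l
    proof -
      have "set (w l) = staircase u1 u2 (\<lambda>i. C i l)" using w that by blast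
      then show ?thesis by (simp only:) (rule staircase_sum, use low that mono in auto)
    qed
    then have "(\<Sum>l<k. \<Sum>v\<in>set (w l). x v) = (\<Sum>l<k. \<Sum>i\<in>{u1..u2}. ?p i (C i l) - ?p i (C (i - 1) l - 1))"
      by (intro sum.cong) auto
    then show ?thesis unfolding W nweight_def by (subst sum.swap) simp
  qed
  ultimately show "\<exists>w. path_system (u1, u2, v1, v2) k w \<and> W = (\<Sum>l<k. \<Sum>v\<in>set (w l). x v)" by blast
qed

text \<open>A sum depends only on the vertex sets of the paths, and these are subsets of a fixed
  rectangle.\<close>

lemma finite_path_sums:
  assumes "u1 \<le> u2"
  shows "finite {\<Sum>l<k. \<Sum>v\<in>set (w l). x v | w. path_system (u1, u2, v1, v2) k w}"
proof (rule finite_subset)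
  let ?F = "\<lambda>f. \<Sum>l<k. \<Sum>v\<in>f l. x v"
  show "{\<Sum>l<k. \<Sum>v\<in>set (w l). x v | w. path_system (u1, u2, v1, v2) k w}
      \<subseteq> ?F ` ({..<k} \<rightarrow>\<^sub>E Pow ({u1..u2} \<times> {v1..v2}))"
  proof clarify
    fix w assume w: "path_system (u1, u2, v1, v2) k w"
    have sub: "set (w l) \<subseteq> {u1..u2} \<times> {v1..v2}" if l: "l < k" for l
    proof -
      have "lattice_path (u1, v1 + int l) (u2, v2 - int k + 1 + int l) (w l)" using w l by simp
      from lattice_path_staircase[OF this] obtain E where E: "E (u1 - 1) = v1 + int l"
        "E u2 = v2 - int k + 1 + int l" "\<forall>i\<in>{u1..u2}. E (i - 1) \<le> E i" "set (w l) = staircase u1 u2 E"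
        by blast
      have lo: "v1 \<le> E i" if "u1 - 1 \<le> i" "i \<le> u2" for i
        using chain_mono[of u1 u2 E i] E(1,3) that by simp
      have hi: "E i \<le> v2" if "u1 \<le> i" "i \<le> u2" for i
        using chain_mono[of "i + 1" u2 E u2] E(2,3) l that by simp
      show ?thesis
      proof
        fix p assume "p \<in> set (w l)"
        then obtain i j where p: "p = (i, j)" "u1 \<le> i" "i \<le> u2" "E (i - 1) \<le> j" "j \<le> E i"
          unfolding E(4) by auto
        then show "p \<in> {u1..u2} \<times> {v1..v2}" using lo[of "i - 1"] hi[of i] by simp
      qed
    qed
    show "(\<Sum>l<k. \<Sum>v\<in>set (w l). x v) \<in> ?F ` ({..<k} \<rightarrow>\<^sub>E Pow ({u1..u2} \<times> {v1..v2}))"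
      by (rule image_eqI[of _ _ "\<lambda>l\<in>{..<k}. set (w l)"]) (use sub in auto)
  qed
qed (auto intro!: finite_imageI finite_PiE)

lemma max_path_sum_eq:
  assumes "u1 \<le> u2"
    and "greatest_reach k (strip x v1 u1 u2) (\<lambda>l. v1 + int l) (\<lambda>l. v2 - int k + 1 + int l) W"
  shows "max_path_sum (u1, u2, v1, v2) x k = W"
  unfolding max_path_sum_def
proof (rule Max_eqI[OF finite_path_sums[OF assms(1)]])
  let ?X = "{\<Sum>l<k. \<Sum>v\<in>set (w l). x v | w. path_system (u1, u2, v1, v2) k w}"
  have iff: "y \<in> ?X \<longleftrightarrow>
      reach k (strip x v1 u1 u2) (\<lambda>l. v1 + int l) (\<lambda>l. v2 - int k + 1 + int l) y" for y
    unfolding path_system_reach[OF assms(1), symmetric] by blast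
  show "W \<in> ?X"
    using assms(2) unfolding iff greatest_reach_def by simp
  show "y \<le> W" if "y \<in> ?X" for y
    using assms(2) that unfolding iff greatest_reach_def by simp
qed

section \<open>Comparing strips of a polyomino with rows of a local rectangle\<close>

lemma upto_shift: "[a + t..b + t] = map (\<lambda>i. i + t) [a..b]"
  by (rule nth_equalityI) (auto simp: nth_upto)

text \<open>Both thresholds and both bases lie at or left of \<open>lo\<close>, so only the labels
  in columns \<open>lo\<close> to \<open>hi\<close> count.\<close>

lemma strip_eqv_shift:
  assumes "b \<le> lo" "b' + t \<le> lo" "r = u2 - u1 + 1"
    and "\<And>i c. i \<in> {1..r} \<Longrightarrow> lo \<le> c \<Longrightarrow> c \<le> hi \<Longrightarrow> x (i + u1 - 1, c) = f i (c - t)"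
  shows "net_eqv K lo hi (strip x b u1 u2) (shift_net t (map (\<lambda>i. (b', psum b' (f i))) [1..r]))"
proof -
  have u: "[u1..u2] = map (\<lambda>i. i + (u1 - 1)) [1..r]" using upto_shift[of 1 "u1 - 1" r] assms(3) by simp
  have "net_eqv K lo hi [(b, psum b (\<lambda>j. x (i + (u1 - 1), j)))] [(b' + t, \<lambda>c. psum b' (f i) (c - t))]"
    if i: "i \<in> {1..r}" for i
  proof (rule net_eqv_low)
    fix c assume c: "lo \<le> c" "c \<le> hi"
    have "x (i + (u1 - 1), c) = f i (c - t)" using assms(4)[OF i c] by (simp add: algebra_simps)
    then show "psum b (\<lambda>j. x (i + (u1 - 1), j)) c - psum b (\<lambda>j. x (i + (u1 - 1), j)) (c - 1) =
        psum b' (f i) (c - t) - psum b' (f i) (c - 1 - t)"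
      using psum_step[of b c] psum_step[of b' "c - t" "f i"] c assms(1,2) by (simp add: algebra_simps)
  qed (use assms in simp_all)
  then have "net_eqv K lo hi (map (\<lambda>i. (b, psum b (\<lambda>j. x (i + (u1 - 1), j)))) [1..r])
      (map (\<lambda>i. (b' + t, \<lambda>c. psum b' (f i) (c - t))) [1..r])"
    by (intro net_eqv_map) simp
  then show ?thesis unfolding strip_def u map_map comp_def by simp
qed

lemma strip_eqv:
  assumes "b \<le> lo" "b' \<le> lo" "\<And>i c. u1 \<le> i \<Longrightarrow> i \<le> u2 \<Longrightarrow> lo \<le> c \<Longrightarrow> c \<le> hi \<Longrightarrow> x (i, c) = y (i, c)"
  shows "net_eqv K lo hi (strip x b u1 u2) (strip y b' u1 u2)"
  unfolding strip_def
proof (rule net_eqv_map, rule net_eqv_low)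
  fix i c assume "i \<in> set [u1..u2]" "lo \<le> c" "c \<le> hi"
  then show "psum b (\<lambda>j. x (i, j)) c - psum b (\<lambda>j. x (i, j)) (c - 1) = psum b' (\<lambda>j. y (i, j)) c - psum b' (\<lambda>j. y (i, j)) (c - 1)"
    using psum_step[of b c] psum_step[of b' c] assms by simp
qed (use assms in simp_all)

lemma strip_append: "u1 \<le> m + 1 \<Longrightarrow> m \<le> u2 \<Longrightarrow> strip x b u1 u2 = strip x b u1 m @ strip x b (m + 1) u2"
proof (cases "u1 \<le> m")
  case False
  assume "u1 \<le> m + 1" "m \<le> u2"
  with False have "m = u1 - 1" by simp
  then show ?thesis by (simp add: strip_def)
qed (simp add: strip_def upto_split2[of u1 m u2])

lemma shift_net_append: "shift_net t (n @ n') = shift_net t n @ shift_net t n'"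
  by simp

lemma shift_net_shift_net: "shift_net t (shift_net u n) = shift_net (u + t) n"
  by (induction n) (auto simp: algebra_simps)

lemma shift_net_strip: "shift_net t (strip y b u1 u2) = strip (\<lambda>(i, j). y (i, j - t)) (b + t) u1 u2"
proof -
  have "psum b (\<lambda>j. y (i, j)) (c - t) = psum (b + t) (\<lambda>j. y (i, j - t)) c" for i c
    unfolding psum_def by (rule sum.reindex_bij_witness[of _ "\<lambda>j. j - t" "\<lambda>j. j + t"]) auto
  then show ?thesis unfolding strip_def by simp
qed

lemma greatest_reach_shift:
  "greatest_reach K (shift_net t n) A B W \<longleftrightarrow> greatest_reach K n (\<lambda>i. A i - t) (\<lambda>i. B i - t) W"
  using reach_shift[of K t n "\<lambda>i. A i - t" "\<lambda>i. B i - t"] unfolding greatest_reach_def by simp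

abbreviation local_labeling :: "(box \<Rightarrow> real) \<Rightarrow> int \<Rightarrow> int \<Rightarrow> int \<Rightarrow> int \<Rightarrow> labeling" where
  "local_labeling x u1 v1 r s \<equiv> \<lambda>(a, b)\<in>grid r s. x (a + u1 - 1, b + v1 - 1)"

lemma strip_local:
  assumes "r = u2 - u1 + 1" "s = v2 - v1 + 1" "v1 \<le> lo" "hi \<le> v2"
  shows "net_eqv K lo hi (strip x lo u1 u2) (shift_net (v1 - 1) (rows (\<lambda>i j. local_labeling x u1 v1 r s (i, j)) r))"
  unfolding rows_def by (rule strip_eqv_shift) (use assms in simp_all)

lemma strip_local_swap:
  assumes "r = u2 - u1 + 1" "s = v2 - v1 + 1" "u1 \<le> lo" "hi \<le> u2"
  shows "net_eqv K lo hi (strip (x \<circ> prod.swap) lo v1 v2)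
     (shift_net (u1 - 1) (rows (\<lambda>j i. local_labeling x u1 v1 r s (i, j)) s))"
  unfolding rows_def by (rule strip_eqv_shift) (use assms in simp_all)

text \<open>Both weights are read off the same shape, since the local rule is symmetric.\<close>

lemma path_sums_both_ways:
  assumes "u1 \<le> u2" "v1 \<le> v2" "int k \<le> u2 - u1 + 1" "int k \<le> v2 - v1 + 1"
  shows "\<exists>W. greatest_reach k (strip x v1 u1 u2) (\<lambda>l. v1 + int l) (\<lambda>l. v2 - int k + 1 + int l) W \<and>
     greatest_reach k (strip (x \<circ> prod.swap) u1 v1 v2) (\<lambda>l. u1 + int l) (\<lambda>l. u2 - int k + 1 + int l) W"
proof -
  let ?r = "u2 - u1 + 1" and ?s = "v2 - v1 + 1"
  let ?z = "local_labeling x u1 v1 ?r ?s"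
  interpret grid_size ?r ?s by unfold_locales (use assms in simp_all)
  have "?z \<in> labelings (grid ?r ?s)" by (rule restrict_PiE_iff[THEN iffD2]) simp
  from ins_array_shapes[OF this] have L: "ins_array ?r ?s (\<lambda>i j. ?z (i, j)) (shapes ?z)" .
  let ?W = "\<Sum>l\<in>{1..int k}. shapes ?z l ?r ?s"
  have "greatest_reach k (rows (\<lambda>i j. ?z (i, j)) ?r) (\<lambda>i. 1 + int i) (\<lambda>i. ?s - int k + 1 + int i) ?W"
    by (rule greene[OF L]) (use assms in simp_all)
  moreover have "(\<lambda>i. v1 + int i - (v1 - 1)) = (\<lambda>i. 1 + int i)"
    "(\<lambda>i. v2 - int k + 1 + int i - (v1 - 1)) = (\<lambda>i. ?s - int k + 1 + int i)" by (simp_all add: fun_eq_iff)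
  ultimately have "greatest_reach k (shift_net (v1 - 1) (rows (\<lambda>i j. ?z (i, j)) ?r))
      (\<lambda>l. v1 + int l) (\<lambda>l. v2 - int k + 1 + int l) ?W"
    unfolding greatest_reach_shift by (simp only:)
  then have 1: "greatest_reach k (strip x v1 u1 u2) (\<lambda>l. v1 + int l) (\<lambda>l. v2 - int k + 1 + int l) ?W"
    using greatest_reach_eqv[OF strip_local[of ?r u2 u1 ?s v2 v1 v1 v2 k x]] by simp
  have "greatest_reach k (rows (\<lambda>j i. ?z (i, j)) ?s) (\<lambda>i. 1 + int i) (\<lambda>i. ?r - int k + 1 + int i) ?W"
    by (rule greene[OF ins_array_transpose[OF L]]) (use assms in simp_all)
  moreover have "(\<lambda>i. u1 + int i - (u1 - 1)) = (\<lambda>i. 1 + int i)"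
    "(\<lambda>i. u2 - int k + 1 + int i - (u1 - 1)) = (\<lambda>i. ?r - int k + 1 + int i)" by (simp_all add: fun_eq_iff)
  ultimately have "greatest_reach k (shift_net (u1 - 1) (rows (\<lambda>j i. ?z (i, j)) ?s))
      (\<lambda>l. u1 + int l) (\<lambda>l. u2 - int k + 1 + int l) ?W"
    unfolding greatest_reach_shift by (simp only:)
  then have "greatest_reach k (strip (x \<circ> prod.swap) u1 v1 v2) (\<lambda>l. u1 + int l) (\<lambda>l. u2 - int k + 1 + int l) ?W"
    using greatest_reach_eqv[OF strip_local_swap[of ?r u2 u1 ?s v2 v1 u1 u2 k x]] by simp
  with 1 show ?thesis by blast
qed

lemma max_path_sum_vertical:
  assumes "u1 \<le> u2" "v1 \<le> v2" "int k \<le> u2 - u1 + 1" "int k \<le> v2 - v1 + 1"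
  shows "greatest_reach k (strip x v1 u1 u2) (\<lambda>l. v1 + int l) (\<lambda>l. v2 - int k + 1 + int l)
    (max_path_sum (u1, u2, v1, v2) x k)"
  using path_sums_both_ways[OF assms, of x] max_path_sum_eq[OF assms(1)] by metis

text \<open>The same maximum, computed with paths that start in consecutive rows of the first
  column. This form is needed where only column weights are known to be preserved.\<close>

lemma max_path_sum_horizontal:
  assumes "u1 \<le> u2" "v1 \<le> v2" "int k \<le> u2 - u1 + 1" "int k \<le> v2 - v1 + 1"
  shows "greatest_reach k (strip (x \<circ> prod.swap) u1 v1 v2) (\<lambda>l. u1 + int l) (\<lambda>l. u2 - int k + 1 + int l)
    (max_path_sum (u1, u2, v1, v2) x k)"
  using path_sums_both_ways[OF assms, of x] max_path_sum_eq[OF assms(1)] by metis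

section \<open>Rectangles that cross \<open>R\<close>\<close>

locale rectangle =
  fixes i1 i2 j1 j2 :: int
  assumes i12: "i1 \<le> i2" and j12: "j1 \<le> j2"
begin

abbreviation "h \<equiv> i2 - i1 + 1"
abbreviation "w \<equiv> j2 - j1 + 1"
abbreviation "window x \<equiv> local_labeling x i1 j1 h w"

sublocale grid_size h w by unfold_locales (use i12 j12 in simp_all)

lemma window_in: "window x \<in> labelings (grid h w)"
  by (rule restrict_PiE_iff[THEN iffD2]) simp

lemma Omega_rect_eq:
  "i \<in> {i1..i2} \<Longrightarrow> j \<in> {j1..j2} \<Longrightarrow>
     Omega_rect (i1, i2, j1, j2) x (i, j) = Omega_grid h w (window x) (i - i1 + 1, j - j1 + 1)"
  by (simp add: Let_def)

text \<open>Between any two sets of positions in the rows \<open>a\<close> to \<open>b\<close>, the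
  columns \<open>j1\<close> to \<open>j2\<close> may be replaced by those of the image; the columns
  on either side are equal, and equivalences can be concatenated.\<close>

theorem wide_rectangle:
  assumes S: "i1 \<le> a" "a \<le> b" "b \<le> i2" "c \<le> j1" "j2 \<le> d" and k: "int k \<le> b - a + 1" "int k \<le> d - c + 1"
    and in_R: "\<And>i j. i \<in> {a..b} \<Longrightarrow> j \<in> {j1..j2} \<Longrightarrow> y (i, j) = Omega_rect (i1, i2, j1, j2) x (i, j)"
    and out_R: "\<And>i j. i \<in> {a..b} \<Longrightarrow> j \<in> {c..d} - {j1..j2} \<Longrightarrow> y (i, j) = x (i, j)"
  shows "max_path_sum (a, b, c, d) x k = max_path_sum (a, b, c, d) y k"
proof -
  let ?x = "x \<circ> prod.swap" and ?y = "y \<circ> prod.swap"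
  have "net_eqv k a b (strip ?x a j1 j2) (shift_net (i1 - 1) (rows (\<lambda>j i. window x (i, j)) w))"
  proof -
    have "net_eqv k a b (strip ?x a j1 j2) (shift_net (i1 - 1) (map (\<lambda>i. (1, psum 1 ((\<lambda>j i. window x (i, j)) i))) [1..w]))"
      by (rule strip_eqv_shift) (use S in simp_all)
    then show ?thesis by (simp add: rows_def)
  qed
  also have "net_eqv k a b \<dots> (shift_net (i1 - 1) (rows (\<lambda>j i. Omega_grid h w (window x) (i, j)) w))"
    by (rule net_eqv_mono[OF net_eqv_shift[OF Omega_columns[OF window_in, of k "a - i1 + 1"]]]) (use S in simp_all)
  also have "net_eqv k a b \<dots> (strip ?y a j1 j2)"
  proof (rule net_eqv_sym)
    have "net_eqv k a b (strip ?y a j1 j2) (shift_net (i1 - 1) (map (\<lambda>i. (1, psum 1 ((\<lambda>j i. Omega_grid h w (window x) (i, j)) i))) [1..w]))"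
      by (rule strip_eqv_shift) (use S in_R in \<open>simp_all del: Omega_rect.simps add: Omega_rect_eq algebra_simps\<close>)
    then show "net_eqv k a b (strip ?y a j1 j2) (shift_net (i1 - 1) (rows (\<lambda>j i. Omega_grid h w (window x) (i, j)) w))"
      by (simp add: rows_def)
  qed
  finally have mid: "net_eqv k a b (strip ?x a j1 j2) (strip ?y a j1 j2)" .
  have split: "strip z a c d = strip z a c (j1 - 1) @ strip z a j1 j2 @ strip z a (j2 + 1) d" for z
    using strip_append[of c "j1 - 1" d z a] strip_append[of j1 j2 d z a] S j12 by simp
  have "net_eqv k a b (strip ?x a c (j1 - 1)) (strip ?y a c (j1 - 1))"
    "net_eqv k a b (strip ?x a (j2 + 1) d) (strip ?y a (j2 + 1) d)"
  proof -
    have "?x (e, i) = ?y (e, i)" if "a \<le> i" "i \<le> b" "e \<in> {c..d} - {j1..j2}" for i e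
      using out_R[of i e] that by simp
    then show "net_eqv k a b (strip ?x a c (j1 - 1)) (strip ?y a c (j1 - 1))"
      "net_eqv k a b (strip ?x a (j2 + 1) d) (strip ?y a (j2 + 1) d)"
      using S j12 by (intro strip_eqv; simp)+
  qed
  then have eqv: "net_eqv k a b (strip ?x a c d) (strip ?y a c d)"
    unfolding split by (intro net_eqv_append mid)
  have g: "greatest_reach k (strip (z \<circ> prod.swap) a c d) (\<lambda>l. a + int l) (\<lambda>l. b - int k + 1 + int l)
    (max_path_sum (a, b, c, d) z k)" for z
    by (rule max_path_sum_horizontal) (use S k j12 in simp_all)
  have "greatest_reach k (strip ?y a c d) (\<lambda>l. a + int l) (\<lambda>l. b - int k + 1 + int l) (max_path_sum (a, b, c, d) x k)"
    using g[of x] greatest_reach_eqv[OF eqv] by simp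
  from greatest_reach_unique[OF this g] show ?thesis .
qed

text \<open>\<open>j1 + 1 \<le> c\<close> is the restriction to columns at least 2 of
  \<open>R\<close>, as in \<open>Omega_rows\<close>. The rows outside \<open>R\<close> are moved by
  the same one column, so the three strips fit together.\<close>

theorem tall_rectangle:
  assumes S: "a \<le> i1" "i2 \<le> b" "j1 + 1 \<le> c" "c \<le> d" "d \<le> j2" and k: "int k \<le> b - a + 1" "int k \<le> d - c + 1"
    and in_R: "\<And>i j. i \<in> {i1..i2} \<Longrightarrow> j \<in> {c - 1..d - 1} \<Longrightarrow> y (i, j) = Omega_rect (i1, i2, j1, j2) x (i, j)"
    and out_R: "\<And>i j. i \<in> {a..b} - {i1..i2} \<Longrightarrow> j \<in> {c - 1..d - 1} \<Longrightarrow> y (i, j) = x (i, j + 1)"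
  shows "max_path_sum (a, b, c, d) x k = max_path_sum (a, b, c - 1, d - 1) y k"
proof -
  let ?s = "\<lambda>u1 u2. shift_net 1 (strip y (c - 1) u1 u2)"
  have "net_eqv k c d (strip x c i1 i2) (shift_net (j1 - 1) (map (\<lambda>i. (1, psum 1 ((\<lambda>i j. window x (i, j)) i))) [1..h]))"
    by (rule strip_eqv_shift) (use S in simp_all)
  then have "net_eqv k c d (strip x c i1 i2) (shift_net (j1 - 1) (rows (\<lambda>i j. window x (i, j)) h))"
    by (simp add: rows_def)
  also have "net_eqv k c d \<dots> (shift_net (j1 - 1) (shift_net 1 (rows (\<lambda>i j. Omega_grid h w (window x) (i, j)) h)))"
    by (rule net_eqv_mono[OF net_eqv_shift[OF Omega_rows[OF window_in]]]) (use S in simp_all)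
  also have "net_eqv k c d \<dots> (?s i1 i2)"
  proof (rule net_eqv_sym)
    have "net_eqv k c d (?s i1 i2) (shift_net (1 + (j1 - 1)) (map (\<lambda>i. (1, psum 1 ((\<lambda>i j. Omega_grid h w (window x) (i, j)) i))) [1..h]))"
      unfolding shift_net_strip
      by (rule strip_eqv_shift) (use S in_R in \<open>simp_all del: Omega_rect.simps add: Omega_rect_eq\<close>)
    then show "net_eqv k c d (?s i1 i2) (shift_net (j1 - 1) (shift_net 1 (rows (\<lambda>i j. Omega_grid h w (window x) (i, j)) h)))"
      unfolding shift_net_shift_net rows_def .
  qed
  finally have mid: "net_eqv k c d (strip x c i1 i2) (?s i1 i2)" .
  have split: "strip z e a b = strip z e a (i1 - 1) @ strip z e i1 i2 @ strip z e (i2 + 1) b" for z e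
    using strip_append[of a "i1 - 1" b z e] strip_append[of i1 i2 b z e] S i12 by simp
  have "net_eqv k c d (strip x c a (i1 - 1)) (?s a (i1 - 1))"
    "net_eqv k c d (strip x c (i2 + 1) b) (?s (i2 + 1) b)"
    unfolding shift_net_strip
  proof -
    have "x (i, e) = (case (i, e) of (i, j) \<Rightarrow> y (i, j - 1))" if "i \<in> {a..b} - {i1..i2}" "c \<le> e" "e \<le> d" for i e
      using out_R[of i "e - 1"] that by simp
    then show "net_eqv k c d (strip x c a (i1 - 1)) (strip (\<lambda>(i, j). y (i, j - 1)) (c - 1 + 1) a (i1 - 1))"
      "net_eqv k c d (strip x c (i2 + 1) b) (strip (\<lambda>(i, j). y (i, j - 1)) (c - 1 + 1) (i2 + 1) b)"
      using S i12 by (intro strip_eqv; simp)+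
  qed
  then have eqv: "net_eqv k c d (strip x c a b) (?s a b)"
    unfolding split shift_net_append by (intro net_eqv_append mid)
  have "greatest_reach k (strip x c a b) (\<lambda>l. c + int l) (\<lambda>l. d - int k + 1 + int l) (max_path_sum (a, b, c, d) x k)"
    by (rule max_path_sum_vertical) (use S k i12 in simp_all)
  then have "greatest_reach k (?s a b) (\<lambda>l. c + int l) (\<lambda>l. d - int k + 1 + int l) (max_path_sum (a, b, c, d) x k)"
    using greatest_reach_eqv[OF eqv] by simp
  moreover have "(\<lambda>l. c + int l - 1) = (\<lambda>l. c - 1 + int l)"
    "(\<lambda>l. d - int k + 1 + int l - 1) = (\<lambda>l. d - 1 - int k + 1 + int l)" by (simp_all add: fun_eq_iff)
  ultimately have "greatest_reach k (strip y (c - 1) a b) (\<lambda>l. c - 1 + int l) (\<lambda>l. d - 1 - int k + 1 + int l) (max_path_sum (a, b, c, d) x k)"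
    unfolding greatest_reach_shift by (simp only:)
  moreover have "greatest_reach k (strip y (c - 1) a b) (\<lambda>l. c - 1 + int l) (\<lambda>l. d - 1 - int k + 1 + int l) (max_path_sum (a, b, c - 1, d - 1) y k)"
    by (rule max_path_sum_vertical) (use S k i12 in simp_all)
  ultimately show ?thesis by (rule greatest_reach_unique)
qed

end

subsection \<open>Cliques, shifts and the main theorem\<close>

lemma dilate_QSTAB:
  assumes "finite M"
  shows "dilate M k (QSTAB M) = {x \<in> labelings M. (\<forall>v\<in>M. 0 \<le> x v) \<and> (\<forall>C. clique M C \<longrightarrow> (\<Sum>v\<in>C. x v) \<le> real k)}"
proof (intro equalityI subsetI)
  fix x assume "x \<in> dilate M k (QSTAB M)"
  then obtain y where y: "y \<in> QSTAB M" and x: "x = (\<lambda>v\<in>M. real k * y v)" unfolding dilate_def by blast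
  have "(\<Sum>v\<in>C. x v) \<le> real k" if C: "clique M C" for C
  proof -
    have "C \<subseteq> M" using C by (simp add: clique_def)
    then have "(\<Sum>v\<in>C. x v) = (\<Sum>v\<in>C. real k * y v)" unfolding x by (intro sum.cong) auto
    also have "\<dots> = real k * (\<Sum>v\<in>C. y v)" by (simp add: sum_distrib_left)
    also have "\<dots> \<le> real k * 1" using y C unfolding QSTAB_def by (intro mult_left_mono) auto
    finally show ?thesis by simp
  qed
  moreover have "0 \<le> x v" if "v \<in> M" for v using y that unfolding QSTAB_def x by simp
  moreover have "x \<in> labelings M" unfolding x by (rule restrict_PiE_iff[THEN iffD2]) simp
  ultimately show "x \<in> {x \<in> labelings M. (\<forall>v\<in>M. 0 \<le> x v) \<and> (\<forall>C. clique M C \<longrightarrow> (\<Sum>v\<in>C. x v) \<le> real k)}"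
    by blast
next
  fix x assume "x \<in> {x \<in> labelings M. (\<forall>v\<in>M. 0 \<le> x v) \<and> (\<forall>C. clique M C \<longrightarrow> (\<Sum>v\<in>C. x v) \<le> real k)}"
  then have x: "x \<in> labelings M" "\<And>v. v \<in> M \<Longrightarrow> 0 \<le> x v" "\<And>C. clique M C \<Longrightarrow> (\<Sum>v\<in>C. x v) \<le> real k" by auto
  \<comment> \<open>For \<open>k = 0\<close> the quotient is 0, and indeed singleton cliques force
    \<open>x = 0\<close> in that case.\<close>
  define y where "y = (\<lambda>v\<in>M. x v / real k)"
  have "y \<in> labelings M" unfolding y_def by (rule restrict_PiE_iff[THEN iffD2]) simp
  moreover have "0 \<le> y v" if "v \<in> M" for v using x(2)[OF that] that by (simp add: y_def)
  moreover have "(\<Sum>v\<in>C. y v) \<le> 1" if C: "clique M C" for C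
  proof -
    have "C \<subseteq> M" using C by (simp add: clique_def)
    then have "(\<Sum>v\<in>C. y v) = (\<Sum>v\<in>C. x v / real k)" unfolding y_def by (intro sum.cong) auto
    also have "\<dots> = (\<Sum>v\<in>C. x v) / real k" by (simp add: sum_divide_distrib)
    also have "\<dots> \<le> 1" using x(3)[OF C] by (cases "k = 0") (simp_all add: divide_le_eq)
    finally show ?thesis .
  qed
  ultimately have "y \<in> QSTAB M" unfolding QSTAB_def by blast
  moreover have "x = (\<lambda>v\<in>M. real k * y v)"
  proof
    fix v
    show "x v = (\<lambda>v\<in>M. real k * y v) v"
    proof (cases "v \<in> M")
      case True
      have "x v \<le> real k" using x(3)[of "{v}"] True by (simp add: clique_def)
      with x(2)[OF True] True show ?thesis by (cases "k = 0") (simp_all add: y_def)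
    next
      case False
      with PiE_arb[OF x(1) False] show ?thesis by simp
    qed
  qed
  ultimately show "x \<in> dilate M k (QSTAB M)" unfolding dilate_def by blast
qed

lemma staircase_clique:
  assumes E: "\<And>i. i \<in> {a..b} \<Longrightarrow> E (i - 1) \<le> (E i :: int)" and M: "{a..b} \<times> {c..d} \<subseteq> M"
    and ends: "E (a - 1) = c" "E b = d"
  shows "clique M (staircase a b E)"
proof -
  have mono: "E i \<le> E i'" if "a - 1 \<le> i" "i \<le> i'" "i' \<le> b" for i i'
    using chain_mono[of "i + 1" b E i'] E that by simp
  have box: "a \<le> i \<and> i \<le> b \<and> c \<le> j \<and> j \<le> d" if "(i, j) \<in> staircase a b E" for i j
    using that mono[of "a - 1" "i - 1"] mono[of i b] ends by auto
  have adj: "adjacent M (i, j) (i', j')"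
    if p: "(i, j) \<in> staircase a b E" "(i', j') \<in> staircase a b E" "(i, j) \<noteq> (i', j')" for i j i' j'
  proof -
    have "(i, j) \<in> M" "(i', j') \<in> M" using box[OF p(1)] box[OF p(2)] M by auto
    have "(i \<le> i' \<and> j \<le> j') \<or> (i' \<le> i \<and> j' \<le> j)"
    proof (cases i i' rule: linorder_cases)
      case less
      then have "E i \<le> E (i' - 1)" using mono[of i "i' - 1"] p by simp
      with less p show ?thesis by simp
    next
      case greater
      then have "E i' \<le> E (i - 1)" using mono[of i' "i - 1"] p by simp
      with greater p show ?thesis by simp
    qed auto
    moreover have "{i..i'} \<times> {j..j'} \<subseteq> {a..b} \<times> {c..d}" "{i'..i} \<times> {j'..j} \<subseteq> {a..b} \<times> {c..d}"
      using box[OF p(1)] box[OF p(2)] by auto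
    then have "{i..i'} \<times> {j..j'} \<subseteq> M" "{i'..i} \<times> {j'..j} \<subseteq> M"
      by (simp_all only: subset_trans[OF _ M])
    ultimately show ?thesis using \<open>(i, j) \<in> M\<close> \<open>(i', j') \<in> M\<close> p(3)
      by (auto simp: adjacent_def box_le_within_def)
  qed
  have "staircase a b E \<subseteq> M"
  proof
    fix p assume p: "p \<in> staircase a b E"
    obtain i j where ij: "p = (i, j)" by (cases p)
    show "p \<in> M" using box[of i j] p M unfolding ij by auto
  qed
  moreover have "adjacent M p q" if "p \<in> staircase a b E" "q \<in> staircase a b E" "p \<noteq> q" for p q
    using adj[of "fst p" "snd p" "fst q" "snd q"] that unfolding prod.collapse by blast
  ultimately show ?thesis unfolding clique_def by blast
qed

text \<open>Boxes of a clique are comparable, so their columns grow weakly with their rows, and the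
  running maximum of the columns bounds a staircase that contains them.\<close>

lemma clique_in_staircase:
  assumes C: "clique M C" "finite C" and sub: "C \<subseteq> {a..b} \<times> {c..d}" and "a \<le> b" "c \<le> d"
  shows "\<exists>E. E (a - 1) = c \<and> E b = d \<and> (\<forall>i\<in>{a..b}. E (i - 1) \<le> E i) \<and> C \<subseteq> staircase a b E"
proof -
  define J where "J i = insert c {j. \<exists>i'\<le>i. (i', j) \<in> C}" for i
  have fin: "finite (J i)" for i
    by (rule finite_subset[of _ "insert c (snd ` C)"]) (use C(2) in \<open>force simp: J_def\<close>)+
  \<comment> \<open>The value at \<open>b\<close> is raised to \<open>d\<close> so that the path
    ends in the upper corner; inserting \<open>c\<close> into \<open>J\<close> makes it start in the
    lower one and keeps the maxima nonempty.\<close>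
  define E where "E i = (if i = b then d else Max (J i))" for i
  have le_d: "Max (J i) \<le> d" for i
    using fin[of i] sub \<open>c \<le> d\<close> by (subst Max_le_iff) (auto simp: J_def)
  have "J (a - 1) = {c}" using sub by (auto simp: J_def)
  then have Ea: "E (a - 1) = c" using \<open>a \<le> b\<close> by (simp add: E_def)
  have mono: "E (i - 1) \<le> E i" if "i \<in> {a..b}" for i
  proof -
    have "J (i - 1) \<subseteq> J i" by (auto simp: J_def) (meson order_trans zle_diff1_eq less_imp_le)
    then have "Max (J (i - 1)) \<le> Max (J i)" by (intro Max_mono fin) (simp_all add: J_def)
    then show ?thesis using that le_d by (auto simp: E_def)
  qed
  have "(i, j) \<in> staircase a b E" if p: "(i, j) \<in> C" for i j
  proof -
    have ij: "a \<le> i" "i \<le> b" "c \<le> j" "j \<le> d" using sub p by auto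
    have "j' \<le> j" if "j' \<in> J (i - 1)" for j'
    proof (cases "j' = c")
      case False
      then obtain i' where i': "i' \<le> i - 1" "(i', j') \<in> C" using \<open>j' \<in> J (i - 1)\<close> by (auto simp: J_def)
      then have "adjacent M (i', j') (i, j)" using C(1) p unfolding clique_def by auto
      with i'(1) show ?thesis by (auto simp: adjacent_def box_le_within_def)
    qed (use ij in simp)
    then have "Max (J (i - 1)) \<le> j" by (intro Max.boundedI[OF fin]) (simp_all add: J_def)
    moreover have "j \<le> Max (J i)" using p fin by (intro Max_ge) (auto simp: J_def)
    ultimately show ?thesis using ij by (auto simp: E_def)
  qed
  then have "C \<subseteq> staircase a b E" by (intro subrelI)
  then show ?thesis using Ea mono by (intro exI[of _ E]) (simp add: E_def)
qed

text \<open>A clique is a chain for the product order. The rectangle between its least and greatest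
  boxes lies in \<open>M\<close> because these two are adjacent or equal.\<close>

lemma clique_in_rectangle:
  assumes C: "clique M C" "finite C" "C \<noteq> {}"
  shows "\<exists>a b c d. a \<le> b \<and> c \<le> d \<and> {a..b} \<times> {c..d} \<subseteq> M \<and> C \<subseteq> {a..b} \<times> {c..d}"
proof -
  have cmp: "p \<le> q \<or> q \<le> p" if "p \<in> C" "q \<in> C" for p q
  proof (cases "p = q")
    case False
    then have "adjacent M p q" using C(1) that by (simp add: clique_def)
    then show ?thesis by (cases p; cases q) (auto simp: adjacent_def box_le_within_def less_eq_prod_def)
  qed simp
  obtain p where p: "p \<in> C" "\<And>q. q \<in> C \<Longrightarrow> q \<le> p \<Longrightarrow> p = q"
    using finite_has_minimal[OF C(2,3)] by blast
  obtain q where q: "q \<in> C" "\<And>r. r \<in> C \<Longrightarrow> q \<le> r \<Longrightarrow> q = r"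
    using finite_has_maximal[OF C(2,3)] by blast
  have le: "p \<le> r" "r \<le> q" if "r \<in> C" for r
    using cmp[OF p(1) that] p(2)[OF that] cmp[OF q(1) that] q(2)[OF that] by auto
  obtain a c b d where pq: "p = (a, c)" "q = (b, d)" by (metis surj_pair)
  have ab: "a \<le> b" "c \<le> d" using le[OF q(1)] by (simp_all add: pq less_eq_prod_def)
  have "{a..b} \<times> {c..d} \<subseteq> M"
  proof (cases "p = q")
    case True
    then show ?thesis using pq C(1) p(1) by (auto simp: clique_def)
  next
    case False
    then have "adjacent M p q" using C(1) p(1) q(1) by (simp add: clique_def)
    then show ?thesis using ab False by (auto simp: pq adjacent_def box_le_within_def)
  qed
  moreover have "C \<subseteq> {a..b} \<times> {c..d}" using le by (force simp: pq less_eq_prod_def)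
  ultimately show ?thesis using ab by blast
qed

text \<open>\<open>S\<close> may be any family of rectangles into whose members all rectangles of
  \<open>M\<close> can be enlarged; this avoids matching the maximal rectangles of \<open>M\<close>
  with those of \<open>N\<close>. Nonnegativity allows a clique to be enlarged to a full lattice
  path.\<close>

lemma clique_sums_by_rectangles:
  assumes M: "finite M" and x: "\<And>v. v \<in> M \<Longrightarrow> 0 \<le> x v" and K: "0 \<le> K"
    and S: "\<And>a b c d. (a, b, c, d) \<in> S \<Longrightarrow> a \<le> b \<and> c \<le> d \<and> {a..b} \<times> {c..d} \<subseteq> M"
    and ext: "\<And>a b c d. a \<le> b \<Longrightarrow> c \<le> d \<Longrightarrow> {a..b} \<times> {c..d} \<subseteq> M \<Longrightarrow>
      \<exists>a' b' c' d'. (a', b', c', d') \<in> S \<and> a' \<le> a \<and> b \<le> b' \<and> c' \<le> c \<and> d \<le> d'"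
  shows "(\<forall>C. clique M C \<longrightarrow> (\<Sum>v\<in>C. x v) \<le> K) \<longleftrightarrow>
    (\<forall>a b c d. (a, b, c, d) \<in> S \<longrightarrow> max_path_sum (a, b, c, d) x 1 \<le> K)"
proof (intro iffI allI impI)
  fix a b c d assume cl: "\<forall>C. clique M C \<longrightarrow> (\<Sum>v\<in>C. x v) \<le> K" and "(a, b, c, d) \<in> S"
  then have ab: "a \<le> b" "c \<le> d" "{a..b} \<times> {c..d} \<subseteq> M" using S by auto
  have "greatest_reach 1 (strip x c a b) (\<lambda>l. c + int l) (\<lambda>l. d - int 1 + 1 + int l) (max_path_sum (a, b, c, d) x 1)"
    by (rule max_path_sum_vertical) (use ab in simp_all)
  then have "reach 1 (strip x c a b) (\<lambda>l. c + int l) (\<lambda>l. d - int 1 + 1 + int l) (max_path_sum (a, b, c, d) x 1)"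
    unfolding greatest_reach_def by simp
  then obtain w where w: "path_system (a, b, c, d) 1 w"
    "max_path_sum (a, b, c, d) x 1 = (\<Sum>l<1. \<Sum>v\<in>set (w l). x v)"
    unfolding path_system_reach[OF ab(1), symmetric] by blast
  from w(1) have "lattice_path (a, c) (b, d) (w 0)" by simp
  from lattice_path_staircase[OF this] obtain E where E: "E (a - 1) = c" "E b = d"
    "\<forall>i\<in>{a..b}. E (i - 1) \<le> E i" "set (w 0) = staircase a b E" by blast
  have "clique M (set (w 0))"
    unfolding E(4) by (rule staircase_clique[OF _ ab(3) E(1,2)]) (use E(3) in simp)
  with cl w(2) show "max_path_sum (a, b, c, d) x 1 \<le> K" by simp
next
  fix C assume le: "\<forall>a b c d. (a, b, c, d) \<in> S \<longrightarrow> max_path_sum (a, b, c, d) x 1 \<le> K" and C: "clique M C"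
  have CM: "C \<subseteq> M" using C by (simp add: clique_def)
  then have fin: "finite C" using M by (rule finite_subset)
  show "(\<Sum>v\<in>C. x v) \<le> K"
  proof (cases "C = {}")
    case False
    from clique_in_rectangle[OF C fin False] obtain a0 b0 c0 d0 where 0: "a0 \<le> b0" "c0 \<le> d0"
      "{a0..b0} \<times> {c0..d0} \<subseteq> M" "C \<subseteq> {a0..b0} \<times> {c0..d0}" by blast
    from ext[OF 0(1-3)] obtain a b c d where S': "(a, b, c, d) \<in> S" "a \<le> a0" "b0 \<le> b" "c \<le> c0" "d0 \<le> d" by blast
    have ab: "a \<le> b" "c \<le> d" "{a..b} \<times> {c..d} \<subseteq> M" using S[OF S'(1)] by auto
    have "C \<subseteq> {a..b} \<times> {c..d}" using 0(4) S' by fastforce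
    from clique_in_staircase[OF C fin this ab(1,2)] obtain E where E: "E (a - 1) = c" "E b = d"
      "\<forall>i\<in>{a..b}. E (i - 1) \<le> E i" "C \<subseteq> staircase a b E" by blast
    from staircase_lattice_path[OF ab(1) E(3)] obtain w where w: "lattice_path (a, c) (b, d) w" "set w = staircase a b E"
      unfolding E(1,2) by blast
    have "clique M (staircase a b E)" by (rule staircase_clique[OF _ ab(3) E(1,2)]) (use E(3) in simp)
    then have "staircase a b E \<subseteq> M" by (simp add: clique_def)
    then have "(\<Sum>v\<in>C. x v) \<le> (\<Sum>v\<in>set w. x v)"
      unfolding w(2) by (intro sum_mono2 E(4)) (use x M in \<open>auto intro: finite_subset\<close>)
    also have "\<dots> \<le> max_path_sum (a, b, c, d) x 1"
      unfolding max_path_sum_def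
    proof (rule Max_ge[OF finite_path_sums[OF ab(1)]])
      show "(\<Sum>v\<in>set w. x v) \<in> {\<Sum>l<1. \<Sum>v\<in>set (w l). x v | w. path_system (a, b, c, d) 1 w}"
        using w(1) by (intro CollectI exI[of _ "\<lambda>_. w"]) simp
    qed
    also have "\<dots> \<le> K" using le S'(1) by blast
    finally show ?thesis .
  qed (use K in simp)
qed

section \<open>The geometry of a shift\<close>

locale moon_shift =
  fixes M N :: "box set" and i1 i2 j1 j2 :: int
  assumes moon_M: "moon_polyomino M" and moon_N: "moon_polyomino N"
    and maximal: "maximal_rect M (i1, i2, j1, j2)"
    and shift: "obtained_by_shift M (i1, i2, j1, j2) N"
begin

sublocale rectangle i1 i2 j1 j2
  by unfold_locales (use maximal in simp_all)

lemma finite_M: "finite M" and finite_N: "finite N"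
  using moon_M moon_N by (simp_all add: moon_polyomino_def)

lemma R_sub: "{i1..i2} \<times> {j1..j2} \<subseteq> M"
  using maximal by simp

lemma inR: "i1 \<le> i \<Longrightarrow> i \<le> i2 \<Longrightarrow> j1 \<le> j \<Longrightarrow> j \<le> j2 \<Longrightarrow> (i, j) \<in> M"
  using R_sub by auto

lemma moon_row:
  assumes "moon_polyomino P" "(i, j) \<in> P" "(i, j') \<in> P" "j \<le> e" "e \<le> j'"
  shows "(i, e) \<in> P"
proof -
  have "{j..j'} \<subseteq> up_diagonal P i"
    using assms(1-3) unfolding moon_polyomino_def convex_polyomino_def int_interval_def up_diagonal_def by blast
  then show ?thesis using assms(4,5) by (auto simp: up_diagonal_def)
qed

lemma moon_column:
  assumes "moon_polyomino P" "(i, j) \<in> P" "(i', j) \<in> P" "i \<le> e" "e \<le> i'"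
  shows "(e, j) \<in> P"
proof -
  have "{i..i'} \<subseteq> down_diagonal P j"
    using assms(1-3) unfolding moon_polyomino_def convex_polyomino_def int_interval_def down_diagonal_def by blast
  then show ?thesis using assms(4,5) by (auto simp: down_diagonal_def)
qed

lemma moon_comparable:
  assumes "moon_polyomino P" "(i, j) \<in> P" "(i', j) \<notin> P" "(i', e) \<in> P"
  shows "(i, e) \<in> P"
  using assms unfolding moon_polyomino_def intersection_free_def up_diagonal_def by blast

lemma maximal_R:
  assumes "a \<le> i1" "i2 \<le> b" "c \<le> j1" "j2 \<le> d" "{a..b} \<times> {c..d} \<subseteq> M"
  shows "a = i1 \<and> b = i2 \<and> c = j1 \<and> d = j2"
proof -
  have "boxes (i1, i2, j1, j2) \<subseteq> boxes (a, b, c, d)" using assms by auto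
  then have "boxes (a, b, c, d) = boxes (i1, i2, j1, j2)"
    using maximal assms(5) unfolding maximal_rect.simps boxes.simps by (metis boxes.simps)
  moreover have "(a, c) \<in> boxes (a, b, c, d)" "(b, d) \<in> boxes (a, b, c, d)" using assms i12 j12 by auto
  ultimately show ?thesis using assms by auto
qed

lemma row_without_left: "\<exists>i. i1 \<le> i \<and> i \<le> i2 \<and> (i, j1 - 1) \<notin> M"
proof (rule ccontr)
  assume "\<nexists>i. i1 \<le> i \<and> i \<le> i2 \<and> (i, j1 - 1) \<notin> M"
  then have "(i, j) \<in> M" if "i1 \<le> i" "i \<le> i2" "j1 - 1 \<le> j" "j \<le> j2" for i j
    using that inR[of i j] by (cases "j = j1 - 1") auto
  then have "{i1..i2} \<times> {j1 - 1..j2} \<subseteq> M" by auto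
  from maximal_R[OF _ _ _ _ this] show False by simp
qed

lemma row_without_right: "\<exists>i. i1 \<le> i \<and> i \<le> i2 \<and> (i, j2 + 1) \<notin> M"
proof (rule ccontr)
  assume "\<nexists>i. i1 \<le> i \<and> i \<le> i2 \<and> (i, j2 + 1) \<notin> M"
  then have "(i, j) \<in> M" if "i1 \<le> i" "i \<le> i2" "j1 \<le> j" "j \<le> j2 + 1" for i j
    using that inR[of i j] by (cases "j = j2 + 1") auto
  then have "{i1..i2} \<times> {j1..j2 + 1} \<subseteq> M" by auto
  from maximal_R[OF _ _ _ _ this] show False by simp
qed

text \<open>Otherwise convexity of the down-diagonals would fill all rows between row
  \<open>i\<close> and \<open>R\<close>, and \<open>R\<close> would not be maximal.\<close>

lemma outer_row_gap:
  assumes "i \<notin> {i1..i2}"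
  shows "\<exists>j. j1 \<le> j \<and> j \<le> j2 \<and> (i, j) \<notin> M"
proof (rule ccontr)
  assume "\<nexists>j. j1 \<le> j \<and> j \<le> j2 \<and> (i, j) \<notin> M"
  then have row: "(i, j) \<in> M" if "j1 \<le> j" "j \<le> j2" for j using that by blast
  have "(e, j) \<in> M" if "min i i1 \<le> e" "e \<le> max i i2" "j1 \<le> j" "j \<le> j2" for e j
  proof -
    consider "i1 \<le> e" "e \<le> i2" | "i \<le> e" "e \<le> i1" | "i2 \<le> e" "e \<le> i" using \<open>min i i1 \<le> e\<close> \<open>e \<le> max i i2\<close> by linarith
    then show ?thesis
    proof cases
      case 1 then show ?thesis using inR that by simp
    next
      case 2 then show ?thesis
        using moon_column[OF moon_M row[OF that(3,4)] inR[of i1 j]] that i12 by simp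
    next
      case 3 then show ?thesis
        using moon_column[OF moon_M inR[of i2 j] row[OF that(3,4)]] that i12 by simp
    qed
  qed
  then have "{min i i1..max i i2} \<times> {j1..j2} \<subseteq> M" by auto
  from maximal_R[OF _ _ _ _ this] assms show False by auto
qed

text \<open>By the gap and intersection-freeness, the outer row is contained in every row of
  \<open>R\<close>. A box left of \<open>j1\<close> would then put column \<open>j1 - 1\<close> into
  all rows of \<open>R\<close>, contradicting maximality; likewise on the right.\<close>

lemma outer_row_weak:
  assumes "(i, j) \<in> M" "i \<notin> {i1..i2}"
  shows "j1 \<le> j \<and> j \<le> j2"
proof -
  obtain g where g: "j1 \<le> g" "g \<le> j2" "(i, g) \<notin> M" using outer_row_gap[OF assms(2)] by blast
  have sub: "(e, j) \<in> M" if "i1 \<le> e" "e \<le> i2" for e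
    using moon_comparable[OF moon_M inR[OF that g(1,2)] g(3) assms(1)] .
  obtain l where l: "i1 \<le> l" "l \<le> i2" "(l, j1 - 1) \<notin> M" using row_without_left by blast
  obtain r where r: "i1 \<le> r" "r \<le> i2" "(r, j2 + 1) \<notin> M" using row_without_right by blast
  have "\<not> j < j1"
    using moon_row[OF moon_M sub[OF l(1,2)] inR[OF l(1,2), of j1], of "j1 - 1"] l(3) j12 by auto
  moreover have "\<not> j2 < j"
    using moon_row[OF moon_M inR[OF r(1,2), of j2] sub[OF r(1,2)], of "j2 + 1"] r(3) j12 by auto
  ultimately show ?thesis by simp
qed

lemma meeting_M: "(i, j) \<in> down_diagonals_meeting M ({i1..i2} \<times> {j1..j2}) \<longleftrightarrow> (i, j) \<in> M \<and> j1 \<le> j \<and> j \<le> j2"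
  using inR[of i1 j] i12 unfolding down_diagonals_meeting_def by auto

text \<open>Every box outside the rows of \<open>R\<close> lies on a down-diagonal meeting
  \<open>R\<close>, so the shift moves outer rows as a whole and leaves the rows of \<open>R\<close>
  in place.\<close>

lemma N_iff: "(i, j) \<in> N \<longleftrightarrow> (if i \<in> {i1..i2} then (i, j) \<in> M else (i, j + 1) \<in> M)"
proof -
  have s: "shift_box M (i1, i2, j1, j2) (a, b) = (if a \<in> {i1..i2} then (a, b) else (a, b - 1))" if "(a, b) \<in> M" for a b
    using that outer_row_weak[OF that] unfolding shift_box_def by (auto simp: meeting_M)
  have "(i, j) \<in> N \<longleftrightarrow> (\<exists>a b. (a, b) \<in> M \<and> (i, j) = shift_box M (i1, i2, j1, j2) (a, b))"
    using shift unfolding obtained_by_shift_def by auto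
  also have "\<dots> \<longleftrightarrow> (\<exists>a b. (a, b) \<in> M \<and> (i, j) = (if a \<in> {i1..i2} then (a, b) else (a, b - 1)))"
    using s by (metis (no_types, lifting))
  also have "\<dots> \<longleftrightarrow> (if i \<in> {i1..i2} then (i, j) \<in> M else (i, j + 1) \<in> M)"
  proof
    assume "\<exists>a b. (a, b) \<in> M \<and> (i, j) = (if a \<in> {i1..i2} then (a, b) else (a, b - 1))"
    then show "if i \<in> {i1..i2} then (i, j) \<in> M else (i, j + 1) \<in> M" by (auto split: if_splits)
  next
    assume *: "if i \<in> {i1..i2} then (i, j) \<in> M else (i, j + 1) \<in> M"
    show "\<exists>a b. (a, b) \<in> M \<and> (i, j) = (if a \<in> {i1..i2} then (a, b) else (a, b - 1))"
    proof (cases "i \<in> {i1..i2}")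
      case True
      with * show ?thesis by - (rule exI[of _ i], rule exI[of _ j], simp)
    next
      case False
      with * show ?thesis by - (rule exI[of _ i], rule exI[of _ "j + 1"], auto)
    qed
  qed
  finally show ?thesis .
qed

lemma N_in: "i \<in> {i1..i2} \<Longrightarrow> (i, j) \<in> N \<longleftrightarrow> (i, j) \<in> M"
  unfolding N_iff by (simp only: if_True)

lemma N_out: "i \<notin> {i1..i2} \<Longrightarrow> (i, j) \<in> N \<longleftrightarrow> (i, j + 1) \<in> M"
  unfolding N_iff by (simp only: if_False)

text \<open>If an outer row of \<open>M\<close> reached the first column of \<open>R\<close>, its shift would stick out on the left,
  against intersection-freeness of \<open>N\<close>.\<close>

lemma outer_row:
  assumes "(i, j) \<in> M" "i \<notin> {i1..i2}"
  shows "j1 + 1 \<le> j \<and> j \<le> j2"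
proof (rule ccontr)
  assume "\<not> ?thesis"
  then have j: "j = j1" using outer_row_weak[OF assms] by auto
  obtain l where l: "i1 \<le> l" "l \<le> i2" "(l, j1 - 1) \<notin> M" using row_without_left by blast
  have "(i, j1 - 1) \<in> N" "(l, j1 - 1) \<notin> N" "(l, j2) \<in> N"
    using assms j l inR[of l j2] j12 by (auto simp: N_iff)
  from moon_comparable[OF moon_N this] have "(i, j2 + 1) \<in> M" using assms(2) by (simp add: N_iff)
  from outer_row_weak[OF this assms(2)] show False by simp
qed

lemma meeting_N: "(i, j) \<in> down_diagonals_meeting N ({i1..i2} \<times> {j1..j2}) \<longleftrightarrow> (i, j) \<in> N \<and> j1 \<le> j \<and> j \<le> j2"
  using inR[of i1 j] i12 unfolding down_diagonals_meeting_def by (auto simp: N_iff)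

section \<open>The map on wide and tall rectangles\<close>

abbreviation "\<Omega> \<equiv> Omega_shift (i1, i2, j1, j2) N"

lemma Omega_in_R: "i \<in> {i1..i2} \<Longrightarrow> j \<in> {j1..j2} \<Longrightarrow> \<Omega> x (i, j) = Omega_rect (i1, i2, j1, j2) x (i, j)"
  using inR[of i j] unfolding Omega_shift_def by (simp add: N_iff del: Omega_rect.simps)

lemma Omega_wide: "i \<in> {i1..i2} \<Longrightarrow> j \<notin> {j1..j2} \<Longrightarrow> (i, j) \<in> M \<Longrightarrow> \<Omega> x (i, j) = x (i, j)"
  unfolding Omega_shift_def by (auto simp: meeting_N N_in simp del: Omega_rect.simps)

lemma Omega_outer: "i \<notin> {i1..i2} \<Longrightarrow> (i, j + 1) \<in> M \<Longrightarrow> \<Omega> x (i, j) = x (i, j + 1)"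
  using outer_row[of i "j + 1"] unfolding Omega_shift_def by (auto simp: meeting_N N_out simp del: Omega_rect.simps)

text \<open>The two ways of crossing \<open>R\<close>. Tall rectangles begin at column
  \<open>j1 + 1\<close> because outer rows of \<open>M\<close> do not reach column
  \<open>j1\<close>.\<close>

definition "wide a b c d \<longleftrightarrow> i1 \<le> a \<and> a \<le> b \<and> b \<le> i2 \<and> c \<le> j1 \<and> j2 \<le> d"
definition "tall a b c d \<longleftrightarrow> a \<le> i1 \<and> i2 \<le> b \<and> j1 + 1 \<le> c \<and> c \<le> d \<and> d \<le> j2"

lemma wide_in_N: "wide a b c d \<Longrightarrow> {a..b} \<times> {c..d} \<subseteq> N \<longleftrightarrow> {a..b} \<times> {c..d} \<subseteq> M"
  by (auto simp: wide_def N_iff subset_iff)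

lemma tall_in_N:
  assumes "tall a b c d"
  shows "{a..b} \<times> {c - 1..d - 1} \<subseteq> N \<longleftrightarrow> {a..b} \<times> {c..d} \<subseteq> M"
proof -
  have "(\<forall>j\<in>{c - 1..d - 1}. (i, j) \<in> N) \<longleftrightarrow> (\<forall>j\<in>{c..d}. (i, j) \<in> M)" for i
  proof (cases "i \<in> {i1..i2}")
    case True
    then show ?thesis using inR[of i] assms by (auto simp: N_iff tall_def)
  next
    case False
    show ?thesis
    proof
      assume *: "\<forall>j\<in>{c - 1..d - 1}. (i, j) \<in> N"
      show "\<forall>j\<in>{c..d}. (i, j) \<in> M"
      proof
        fix j assume "j \<in> {c..d}"
        then show "(i, j) \<in> M" using *[rule_format, of "j - 1"] N_out[OF False, of "j - 1"] by simp
      qed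
    next
      assume *: "\<forall>j\<in>{c..d}. (i, j) \<in> M"
      show "\<forall>j\<in>{c - 1..d - 1}. (i, j) \<in> N"
      proof
        fix j assume "j \<in> {c - 1..d - 1}"
        then show "(i, j) \<in> N" using *[rule_format, of "j + 1"] N_out[OF False, of j] by simp
      qed
    qed
  qed
  then show ?thesis by (auto simp: subset_iff)
qed

lemma wide_invariant:
  assumes "wide a b c d" "{a..b} \<times> {c..d} \<subseteq> M" "int k \<le> b - a + 1" "int k \<le> d - c + 1"
  shows "max_path_sum (a, b, c, d) x k = max_path_sum (a, b, c, d) (\<Omega> x) k"
proof (rule wide_rectangle)
  show "\<Omega> x (i, j) = Omega_rect (i1, i2, j1, j2) x (i, j)" if "i \<in> {a..b}" "j \<in> {j1..j2}" for i j
    using Omega_in_R[of i j] that assms(1) by (simp add: wide_def del: Omega_rect.simps)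
  show "\<Omega> x (i, j) = x (i, j)" if "i \<in> {a..b}" "j \<in> {c..d} - {j1..j2}" for i j
    by (rule Omega_wide) (use that assms(1,2) in \<open>auto simp: wide_def\<close>)
qed (use assms in \<open>simp_all add: wide_def\<close>)

lemma tall_invariant:
  assumes "tall a b c d" "{a..b} \<times> {c..d} \<subseteq> M" "int k \<le> b - a + 1" "int k \<le> d - c + 1"
  shows "max_path_sum (a, b, c, d) x k = max_path_sum (a, b, c - 1, d - 1) (\<Omega> x) k"
proof (rule tall_rectangle)
  show "\<Omega> x (i, j) = Omega_rect (i1, i2, j1, j2) x (i, j)" if "i \<in> {i1..i2}" "j \<in> {c - 1..d - 1}" for i j
    using Omega_in_R[of i j] that assms(1) by (simp add: tall_def del: Omega_rect.simps)
  show "\<Omega> x (i, j) = x (i, j + 1)" if "i \<in> {a..b} - {i1..i2}" "j \<in> {c - 1..d - 1}" for i j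
    by (rule Omega_outer) (use that assms(2) in auto)
qed (use assms in \<open>simp_all add: tall_def\<close>)

text \<open>Each row meets both the given rectangle and \<open>R\<close>, and convexity of
  up-diagonals fills what lies between them. \<open>P\<close> will be \<open>M\<close> as well as
  \<open>N\<close>.\<close>

lemma extend_wide:
  assumes P: "moon_polyomino P" "{i1..i2} \<times> {j1..j2} \<subseteq> P" and S: "{a..b} \<times> {c..d} \<subseteq> P" "i1 \<le> a" "b \<le> i2" "c \<le> d"
  shows "{a..b} \<times> {min c j1..max d j2} \<subseteq> P"
proof (rule subsetI)
  fix p assume "p \<in> {a..b} \<times> {min c j1..max d j2}"
  then obtain i j where p: "p = (i, j)" and ij: "i \<in> {a..b}" "min c j1 \<le> j" "j \<le> max d j2" by auto
  have "(i, c) \<in> P" "(i, d) \<in> P" by (rule subsetD[OF S(1)], use ij(1) S(4) in simp)+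
  moreover have "(i, j1) \<in> P" "(i, j2) \<in> P" by (rule subsetD[OF P(2)], use ij(1) S(2,3) j12 in simp)+
  ultimately have "(i, min c j1) \<in> P" "(i, max d j2) \<in> P" by (simp_all add: min_def max_def)
  from moon_row[OF P(1) this ij(2,3)] show "p \<in> P" unfolding p .
qed

lemma extend_tall:
  assumes P: "moon_polyomino P" "{i1..i2} \<times> {j1..j2} \<subseteq> P" and S: "{a..b} \<times> {c..d} \<subseteq> P" "j1 \<le> c" "d \<le> j2" "a \<le> b"
  shows "{min a i1..max b i2} \<times> {c..d} \<subseteq> P"
proof (rule subsetI)
  fix p assume "p \<in> {min a i1..max b i2} \<times> {c..d}"
  then obtain i j where p: "p = (i, j)" and ij: "j \<in> {c..d}" "min a i1 \<le> i" "i \<le> max b i2" by auto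
  have "(a, j) \<in> P" "(b, j) \<in> P" by (rule subsetD[OF S(1)], use ij(1) S(4) in simp)+
  moreover have "(i1, j) \<in> P" "(i2, j) \<in> P" by (rule subsetD[OF P(2)], use ij(1) S(2,3) i12 in simp)+
  ultimately have "(min a i1, j) \<in> P" "(max b i2, j) \<in> P" by (simp_all add: min_def max_def)
  from moon_column[OF P(1) this ij(2,3)] show "p \<in> P" unfolding p .
qed

lemma extend_in_M:
  assumes S: "a \<le> b" "c \<le> d" "{a..b} \<times> {c..d} \<subseteq> M"
  shows "\<exists>a' b' c' d'. {a'..b'} \<times> {c'..d'} \<subseteq> M \<and> a' \<le> a \<and> b \<le> b' \<and> c' \<le> c \<and> d \<le> d' \<and>
    (if {a..b} \<subseteq> {i1..i2} then wide a' b' c' d' else tall a' b' c' d')"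
proof (cases "{a..b} \<subseteq> {i1..i2}")
  case True
  then have ab: "i1 \<le> a" "b \<le> i2" using S(1) by auto
  from extend_wide[OF moon_M R_sub S(3) ab S(2)] show ?thesis
    using ab S(1) True by - (rule exI[of _ a], rule exI[of _ b], rule exI[of _ "min c j1"], rule exI[of _ "max d j2"], simp add: wide_def)
next
  case False
  then have "a \<notin> {i1..i2} \<or> b \<notin> {i1..i2}" using S(1) by auto
  moreover have "(a, c) \<in> M" "(a, d) \<in> M" "(b, c) \<in> M" "(b, d) \<in> M" using S by auto
  ultimately have cd: "j1 + 1 \<le> c" "d \<le> j2" using outer_row by blast+
  from extend_tall[OF moon_M R_sub S(3) _ cd(2) S(1)] show ?thesis
    unfolding if_not_P[OF False] using cd S(2) by - (rule exI[of _ "min a i1"], rule exI[of _ "max b i2"], rule exI[of _ c], rule exI[of _ d], simp add: tall_def)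
qed

text \<open>Outer rows of \<open>N\<close> are outer rows of \<open>M\<close> moved left, so they
  occupy columns between \<open>j1\<close> and \<open>j2 - 1\<close>; moved back by one column, the
  rectangle is tall.\<close>

lemma extend_in_N:
  assumes S: "a \<le> b" "c \<le> d" "{a..b} \<times> {c..d} \<subseteq> N"
  shows "\<exists>a' b' c' d'. {a'..b'} \<times> {c'..d'} \<subseteq> N \<and> a' \<le> a \<and> b \<le> b' \<and> c' \<le> c \<and> d \<le> d' \<and>
    (wide a' b' c' d' \<or> tall a' b' (c' + 1) (d' + 1))"
proof (cases "{a..b} \<subseteq> {i1..i2}")
  case True
  then have ab: "i1 \<le> a" "b \<le> i2" using S(1) by auto
  have R: "{i1..i2} \<times> {j1..j2} \<subseteq> N" using R_sub by (auto simp: N_iff)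
  from extend_wide[OF moon_N R S(3) ab S(2)] show ?thesis
    using ab S(1) by - (rule exI[of _ a], rule exI[of _ b], rule exI[of _ "min c j1"], rule exI[of _ "max d j2"], simp add: wide_def)
next
  case False
  then obtain e where e: "e \<in> {a..b}" "e \<notin> {i1..i2}" by blast
  have R: "{i1..i2} \<times> {j1..j2} \<subseteq> N" using R_sub by (auto simp: N_iff)
  have "(e, c) \<in> N" "(e, d) \<in> N" using S e(1) by auto
  then have "(e, c + 1) \<in> M" "(e, d + 1) \<in> M" using e(2) by (simp_all add: N_iff)
  from outer_row[OF this(1) e(2)] outer_row[OF this(2) e(2)] have cd: "j1 \<le> c" "d + 1 \<le> j2" by simp_all
  from extend_tall[OF moon_N R S(3) cd(1) _ S(1)] show ?thesis
    using cd S(2) by - (rule exI[of _ "min a i1"], rule exI[of _ "max b i2"], rule exI[of _ c], rule exI[of _ d], simp add: tall_def)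
qed

text \<open>A maximal rectangle equals its own extension. The case distinction is the one made by
  \<open>corresponding_rect\<close>.\<close>

lemma maximal_rect_cases:
  assumes S: "maximal_rect M (a, b, c, d)"
  shows "if {a..b} \<subseteq> {i1..i2} then wide a b c d else tall a b c d"
proof -
  have ab: "a \<le> b" "c \<le> d" "{a..b} \<times> {c..d} \<subseteq> M" using S by auto
  from extend_in_M[OF this] obtain a' b' c' d' where T: "{a'..b'} \<times> {c'..d'} \<subseteq> M" "a' \<le> a" "b \<le> b'" "c' \<le> c" "d \<le> d'"
    "if {a..b} \<subseteq> {i1..i2} then wide a' b' c' d' else tall a' b' c' d'" by blast
  have "boxes (a, b, c, d) \<subseteq> boxes (a', b', c', d')" using T(2-5) by auto
  then have "boxes (a', b', c', d') = boxes (a, b, c, d)"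
    using S T(1) unfolding maximal_rect.simps by (metis boxes.simps)
  moreover have "(a', c') \<in> boxes (a', b', c', d')" "(b', d') \<in> boxes (a', b', c', d')" using T(2-5) ab by auto
  ultimately have e: "a' = a" "b' = b" "c' = c" "d' = d" using T(2-5) by auto
  show ?thesis using T(6) unfolding e .
qed

theorem path_stat_invariant:
  assumes "maximal_rect M S"
  shows "path_stat S x k = path_stat (corresponding_rect (i1, i2, j1, j2) S) (\<Omega> x) k"
proof -
  obtain a b c d where S: "S = (a, b, c, d)" by (metis surj_pair)
  have ab: "a \<le> b" "c \<le> d" "{a..b} \<times> {c..d} \<subseteq> M" using assms unfolding S by auto
  \<comment> \<open>Both sides cap \<open>k\<close> by the smaller side length, which is the same
    for the corresponding rectangle.\<close>
  define l where "l = min k (nat (min (b - a + 1) (d - c + 1)))"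
  have l: "int l \<le> b - a + 1" "int l \<le> d - c + 1" unfolding l_def using ab(1,2) by linarith+
  note cs = maximal_rect_cases[OF assms[unfolded S]]
  show ?thesis
  proof (cases "{a..b} \<subseteq> {i1..i2}")
    case True
    then have "max_path_sum (a, b, c, d) x l = max_path_sum (a, b, c, d) (\<Omega> x) l"
      using wide_invariant[OF _ ab(3) l] cs by simp
    with True show ?thesis unfolding S path_stat.simps corresponding_rect.simps l_def by (simp only: not_True_eq_False if_False path_stat.simps)
  next
    case False
    then have "max_path_sum (a, b, c, d) x l = max_path_sum (a, b, c - 1, d - 1) (\<Omega> x) l"
      using tall_invariant[OF _ ab(3) l] cs by simp
    moreover have "d - 1 - (c - 1) + 1 = d - c + 1" by simp
    ultimately show ?thesis using False
      unfolding S path_stat.simps corresponding_rect.simps l_def by (simp only: not_False_eq_True if_True path_stat.simps)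
  qed
qed

section \<open>Volume, nonnegativity, polytopes and lattice points\<close>

lemma trop_iso_Omega_rect: "\<exists>g. trop_iso ({i1..i2} \<times> {j1..j2}) ({i1..i2} \<times> {j1..j2}) (Omega_rect (i1, i2, j1, j2)) g"
proof -
  let ?P = "{i1..i2} \<times> {j1..j2}"
  let ?\<sigma> = "\<lambda>(a, b). (a + i1 - 1, b + j1 - 1)" and ?\<tau> = "\<lambda>(i, j). (i - i1 + 1, j - j1 + 1)"
  have \<sigma>: "bij_betw ?\<sigma> (grid h w) ?P" by (rule bij_betw_byWitness[of _ ?\<tau>]) auto
  have \<tau>: "bij_betw ?\<tau> ?P (grid h w)" by (rule bij_betw_byWitness[of _ ?\<sigma>]) auto
  obtain g where g: "trop_iso (grid h w) (grid h w) (Omega_grid h w) g" using trop_iso_Omega by blast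
  have A: "trop_iso ?P (grid h w) (\<lambda>x. \<lambda>v\<in>grid h w. x (?\<sigma> v)) (\<lambda>y. \<lambda>v\<in>?P. y (inv_into (grid h w) ?\<sigma> v))"
    by (rule trop_iso_relabel[OF _ _ \<sigma>]) simp_all
  have B: "trop_iso (grid h w) ?P (\<lambda>x. \<lambda>v\<in>?P. x (?\<tau> v)) (\<lambda>y. \<lambda>v\<in>grid h w. y (inv_into ?P ?\<tau> v))"
    by (rule trop_iso_relabel[OF _ _ \<tau>]) simp_all
  have "(\<lambda>x. \<lambda>v\<in>?P. x (?\<tau> v)) \<circ> (Omega_grid h w \<circ> (\<lambda>x. \<lambda>v\<in>grid h w. x (?\<sigma> v))) = Omega_rect (i1, i2, j1, j2)"
    by (simp add: fun_eq_iff restrict_def Let_def case_prod_unfold)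
  with trop_iso_comp[OF B trop_iso_comp[OF g A]] show ?thesis by auto
qed

lemma Omega_rect_restrict: "Omega_rect (i1, i2, j1, j2) (restrict x ({i1..i2} \<times> {j1..j2})) = Omega_rect (i1, i2, j1, j2) x"
proof -
  have "local_labeling (restrict x ({i1..i2} \<times> {j1..j2})) i1 j1 h w = local_labeling x i1 j1 h w"
    by (auto simp: fun_eq_iff restrict_def)
  then show ?thesis unfolding Omega_rect.simps Let_def by (simp only:)
qed

text \<open>The map factors into its action on the labels of \<open>R\<close>, lifted to
  \<open>M\<close>, and a renaming of boxes that moves the outer rows.\<close>

theorem trop_iso_shift: "\<exists>g. trop_iso M N \<Omega> g"
proof -
  let ?P = "{i1..i2} \<times> {j1..j2}"
  let ?O = "Omega_rect (i1, i2, j1, j2)"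
  let ?\<sigma> = "\<lambda>(i, j). if i \<in> {i1..i2} then (i, j) else (i, j + 1)"
  let ?\<tau> = "\<lambda>(i, j). if i \<in> {i1..i2} then (i, j) else (i, j - 1)"
  let ?F = "\<lambda>x. \<lambda>v\<in>M. if v \<in> ?P then ?O (restrict x ?P) v else x v"
  let ?S = "\<lambda>x. \<lambda>w\<in>N. x (?\<sigma> w)"
  have \<sigma>: "bij_betw ?\<sigma> N M"
    by (rule bij_betw_byWitness[of _ ?\<tau>]) (auto simp: N_iff split: if_splits)
  obtain g where "trop_iso ?P ?P ?O g" using trop_iso_Omega_rect by blast
  from trop_iso_lift[OF finite_M R_sub this]
  obtain g' where g': "trop_iso M M ?F g'" by blast
  from trop_iso_comp[OF trop_iso_relabel[OF finite_M finite_N \<sigma>] this]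
  obtain g'' where g'': "trop_iso M N (?S \<circ> ?F) g''"
    by blast
  have eq: "(?S \<circ> ?F) x = \<Omega> x" for x
  proof
    fix v :: box
    obtain i j where v: "v = (i, j)" by (cases v)
    show "(?S \<circ> ?F) x v = \<Omega> x v"
    proof (cases "(i, j) \<in> N")
      case False
      then show ?thesis unfolding v by (simp add: Omega_shift_def)
    next
      case True
      show ?thesis
      proof (cases "i \<in> {i1..i2}")
        case i: True
        then have M: "(i, j) \<in> M" using True by (simp add: N_iff)
        show ?thesis
        proof (cases "j \<in> {j1..j2}")
          case j: True
          show ?thesis unfolding v Omega_in_R[OF i j] using i j M True
            by (simp del: Omega_rect.simps add: Omega_rect_restrict)
        next
          case False
          show ?thesis unfolding v Omega_wide[OF i False M] using i False M True
            by (auto simp del: Omega_rect.simps)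
        qed
      next
        case False
        then have M: "(i, j + 1) \<in> M" using True by (simp add: N_iff)
        show ?thesis unfolding v Omega_outer[OF False M] using False M True
          by (auto simp del: Omega_rect.simps)
      qed
    qed
  qed
  have "trop_iso M N \<Omega> g''" by (rule trop_iso_cong[OF g'' eq refl])
  then show ?thesis by (intro exI[of _ g''])
qed

text \<open>Both directions matter: surjectivity onto the dilate for \<open>N\<close> requires that
  preimages of nonnegative labelings are nonnegative.\<close>

lemma nonneg_iff:
  "(\<forall>v\<in>N. 0 \<le> \<Omega> x v) \<longleftrightarrow> (\<forall>v\<in>M. 0 \<le> x v)"
proof -
  let ?R = "{i1..i2} \<times> {j1..j2}"
  have R: "(\<forall>v\<in>?R. 0 \<le> \<Omega> x v) \<longleftrightarrow> (\<forall>v\<in>?R. 0 \<le> x v)"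
  proof -
    have sh: "(\<forall>v\<in>?R. Q (fst v - i1 + 1, snd v - j1 + 1)) \<longleftrightarrow> (\<forall>p\<in>grid h w. Q p)" for Q
    proof (intro iffI ballI)
      fix p assume *: "\<forall>v\<in>?R. Q (fst v - i1 + 1, snd v - j1 + 1)" and p: "p \<in> grid h w"
      have "(fst p + i1 - 1, snd p + j1 - 1) \<in> ?R" using p by auto
      from *[rule_format, OF this] show "Q p" by simp
    next
      fix v assume *: "\<forall>p\<in>grid h w. Q p" and "v \<in> ?R"
      then show "Q (fst v - i1 + 1, snd v - j1 + 1)" by (intro *[rule_format]) auto
    qed
    have "(\<forall>v\<in>?R. 0 \<le> \<Omega> x v) \<longleftrightarrow>
        (\<forall>v\<in>?R. 0 \<le> Omega_grid h w (window x) (fst v - i1 + 1, snd v - j1 + 1))"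
      by (rule ball_cong[OF refl]) (use Omega_in_R Omega_rect_eq in \<open>force simp del: Omega_rect.simps\<close>)
    also have "\<dots> \<longleftrightarrow> (\<forall>p\<in>grid h w. 0 \<le> Omega_grid h w (window x) p)" by (rule sh)
    also have "\<dots> \<longleftrightarrow> (\<forall>p\<in>grid h w. 0 \<le> window x p)" by (rule Omega_nonneg[OF window_in])
    also have "\<dots> \<longleftrightarrow> (\<forall>v\<in>?R. 0 \<le> window x (fst v - i1 + 1, snd v - j1 + 1))" by (rule sh[symmetric])
    also have "\<dots> \<longleftrightarrow> (\<forall>v\<in>?R. 0 \<le> x v)" by (rule ball_cong) auto
    finally show ?thesis .
  qed
  show ?thesis
  proof (intro iffI ballI)
    fix v assume *: "\<forall>v\<in>N. 0 \<le> \<Omega> x v" and v: "v \<in> M"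
    obtain i j where ij: "v = (i, j)" by (cases v)
    consider "i \<in> {i1..i2}" "j \<in> {j1..j2}" | "i \<in> {i1..i2}" "j \<notin> {j1..j2}" | "i \<notin> {i1..i2}" by blast
    then show "0 \<le> x v"
    proof cases
      case 1
      have "\<forall>v\<in>?R. 0 \<le> \<Omega> x v" using * R_sub by (auto simp: N_iff)
      with R 1 ij show ?thesis by blast
    next
      case 2
      with v ij have "(i, j) \<in> N" by (simp add: N_iff)
      with * Omega_wide[OF 2, of x] v ij show ?thesis by metis
    next
      case 3
      with v ij have "(i, j - 1) \<in> N" using N_out[OF 3, of "j - 1"] by simp
      with * Omega_outer[OF 3, of "j - 1" x] v ij show ?thesis by (metis diff_add_cancel)
    qed
  next
    fix v assume *: "\<forall>v\<in>M. 0 \<le> x v" and v: "v \<in> N"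
    obtain i j where ij: "v = (i, j)" by (cases v)
    consider "i \<in> {i1..i2}" "j \<in> {j1..j2}" | "i \<in> {i1..i2}" "j \<notin> {j1..j2}" | "i \<notin> {i1..i2}" by blast
    then show "0 \<le> \<Omega> x v"
    proof cases
      case 1
      have "\<forall>v\<in>?R. 0 \<le> x v" using * R_sub by auto
      with R 1 ij show ?thesis by blast
    next
      case 2
      with v ij have "(i, j) \<in> M" by (simp add: N_iff)
      with * Omega_wide[OF 2 this, of x] ij show ?thesis by simp
    next
      case 3
      with v ij have "(i, j + 1) \<in> M" using N_out[OF 3, of j] by simp
      with * Omega_outer[OF 3 this, of x] ij show ?thesis by simp
    qed
  qed
qed

text \<open>The families \<open>S\<close> and \<open>T\<close> correspond: wide rectangles are kept,
  tall ones move by one column, and the maximal weight of a single path is the same on both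
  sides.\<close>

lemma clique_sums_iff:
  assumes x: "\<And>v. v \<in> M \<Longrightarrow> 0 \<le> x v" and K: "0 \<le> K"
  shows "(\<forall>C. clique M C \<longrightarrow> (\<Sum>v\<in>C. x v) \<le> K) \<longleftrightarrow> (\<forall>C. clique N C \<longrightarrow> (\<Sum>v\<in>C. \<Omega> x v) \<le> K)"
proof -
  have y: "0 \<le> \<Omega> x v" if "v \<in> N" for v using nonneg_iff[of x] x that by blast
  define S where "S = {(a, b, c, d). {a..b} \<times> {c..d} \<subseteq> M \<and> (wide a b c d \<or> tall a b c d)}"
  define T where "T = {(a, b, c, d). {a..b} \<times> {c..d} \<subseteq> N \<and> (wide a b c d \<or> tall a b (c + 1) (d + 1))}"
  have "(\<forall>C. clique M C \<longrightarrow> (\<Sum>v\<in>C. x v) \<le> K) \<longleftrightarrow> (\<forall>a b c d. (a, b, c, d) \<in> S \<longrightarrow> max_path_sum (a, b, c, d) x 1 \<le> K)"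
  proof (rule clique_sums_by_rectangles[OF finite_M x K])
    show "a \<le> b \<and> c \<le> d \<and> {a..b} \<times> {c..d} \<subseteq> M" if "(a, b, c, d) \<in> S" for a b c d
      using that i12 j12 by (auto simp: S_def wide_def tall_def)
    show "\<exists>a' b' c' d'. (a', b', c', d') \<in> S \<and> a' \<le> a \<and> b \<le> b' \<and> c' \<le> c \<and> d \<le> d'"
      if "a \<le> b" "c \<le> d" "{a..b} \<times> {c..d} \<subseteq> M" for a b c d
      using extend_in_M[OF that] unfolding S_def by (auto split: if_splits)
  qed
  also have "\<dots> \<longleftrightarrow> (\<forall>a b c d. (a, b, c, d) \<in> T \<longrightarrow> max_path_sum (a, b, c, d) (\<Omega> x) 1 \<le> K)"
  proof (intro iffI allI impI)
    fix a b c d assume *: "\<forall>a b c d. (a, b, c, d) \<in> S \<longrightarrow> max_path_sum (a, b, c, d) x 1 \<le> K" and t: "(a, b, c, d) \<in> T"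
    then consider "wide a b c d" "{a..b} \<times> {c..d} \<subseteq> M" | "tall a b (c + 1) (d + 1)" "{a..b} \<times> {c + 1..d + 1} \<subseteq> M"
      unfolding T_def using wide_in_N[of a b c d] tall_in_N[of a b "c + 1" "d + 1"] by auto
    then show "max_path_sum (a, b, c, d) (\<Omega> x) 1 \<le> K"
    proof cases
      case 1
      then have "(a, b, c, d) \<in> S" by (simp add: S_def)
      moreover have "max_path_sum (a, b, c, d) x 1 = max_path_sum (a, b, c, d) (\<Omega> x) 1"
        by (rule wide_invariant[OF 1]) (use 1 j12 in \<open>simp_all add: wide_def\<close>)
      ultimately show ?thesis using *[rule_format, of a b c d] by simp
    next
      case 2
      then have "(a, b, c + 1, d + 1) \<in> S" by (simp add: S_def)
      moreover have "max_path_sum (a, b, c + 1, d + 1) x 1 = max_path_sum (a, b, c + 1 - 1, d + 1 - 1) (\<Omega> x) 1"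
        by (rule tall_invariant[OF 2]) (use 2 i12 in \<open>simp_all add: tall_def\<close>)
      ultimately show ?thesis using *[rule_format, of a b "c + 1" "d + 1"] by simp
    qed
  next
    fix a b c d assume *: "\<forall>a b c d. (a, b, c, d) \<in> T \<longrightarrow> max_path_sum (a, b, c, d) (\<Omega> x) 1 \<le> K" and s: "(a, b, c, d) \<in> S"
    then have M: "{a..b} \<times> {c..d} \<subseteq> M" and "wide a b c d \<or> tall a b c d" by (simp_all add: S_def)
    from this(2) show "max_path_sum (a, b, c, d) x 1 \<le> K"
    proof
      assume 1: "wide a b c d"
      then have "(a, b, c, d) \<in> T" using M wide_in_N[OF 1] by (simp add: T_def)
      moreover have "max_path_sum (a, b, c, d) x 1 = max_path_sum (a, b, c, d) (\<Omega> x) 1"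
        by (rule wide_invariant[OF 1 M]) (use 1 j12 in \<open>simp_all add: wide_def\<close>)
      ultimately show ?thesis using *[rule_format, of a b c d] by simp
    next
      assume 2: "tall a b c d"
      then have "(a, b, c - 1, d - 1) \<in> T" using M tall_in_N[OF 2] by (simp add: T_def)
      moreover have "max_path_sum (a, b, c, d) x 1 = max_path_sum (a, b, c - 1, d - 1) (\<Omega> x) 1"
        by (rule tall_invariant[OF 2 M]) (use 2 i12 in \<open>simp_all add: tall_def\<close>)
      ultimately show ?thesis using *[rule_format, of a b "c - 1" "d - 1"] by simp
    qed
  qed
  also have "\<dots> \<longleftrightarrow> (\<forall>C. clique N C \<longrightarrow> (\<Sum>v\<in>C. \<Omega> x v) \<le> K)"
  proof (rule sym, rule clique_sums_by_rectangles[OF finite_N y K])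
    show "a \<le> b \<and> c \<le> d \<and> {a..b} \<times> {c..d} \<subseteq> N" if "(a, b, c, d) \<in> T" for a b c d
      using that i12 j12 by (auto simp: T_def wide_def tall_def)
    show "\<exists>a' b' c' d'. (a', b', c', d') \<in> T \<and> a' \<le> a \<and> b \<le> b' \<and> c' \<le> c \<and> d \<le> d'"
      if "a \<le> b" "c \<le> d" "{a..b} \<times> {c..d} \<subseteq> N" for a b c d
      using extend_in_N[OF that] unfolding T_def by auto
  qed
  finally show ?thesis .
qed

theorem Omega_dilate: "\<Omega> ` dilate M k (QSTAB M) = dilate N k (QSTAB N)"
proof -
  obtain g where g: "trop_iso M N \<Omega> g" using trop_iso_shift by blast
  have iff: "x \<in> dilate M k (QSTAB M) \<longleftrightarrow> \<Omega> x \<in> dilate N k (QSTAB N)" if "x \<in> labelings M" for x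
  proof (cases "\<forall>v\<in>M. 0 \<le> x v")
    case True
    have "(\<forall>C. clique M C \<longrightarrow> (\<Sum>v\<in>C. x v) \<le> real k) \<longleftrightarrow> (\<forall>C. clique N C \<longrightarrow> (\<Sum>v\<in>C. \<Omega> x v) \<le> real k)"
      by (rule clique_sums_iff) (use True in simp_all)
    then show ?thesis using True nonneg_iff[of x] that trop_isoD(5)[OF g that]
      unfolding dilate_QSTAB[OF finite_M] dilate_QSTAB[OF finite_N] mem_Collect_eq by (simp only:)
  next
    case False
    then show ?thesis using nonneg_iff[of x]
      unfolding dilate_QSTAB[OF finite_M] dilate_QSTAB[OF finite_N] mem_Collect_eq by (simp only: simp_thms)
  qed
  show ?thesis
  proof (intro equalityI subsetI)
    fix y assume "y \<in> \<Omega> ` dilate M k (QSTAB M)"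
    then obtain x where x: "x \<in> dilate M k (QSTAB M)" "y = \<Omega> x" by blast
    then have "x \<in> labelings M" unfolding dilate_QSTAB[OF finite_M] by blast
    with x iff show "y \<in> dilate N k (QSTAB N)" by blast
  next
    fix y assume y: "y \<in> dilate N k (QSTAB N)"
    then have yN: "y \<in> labelings N" unfolding dilate_QSTAB[OF finite_N] by blast
    have "g y \<in> dilate M k (QSTAB M)"
      using iff[OF trop_isoD(6)[OF g yN]] trop_isoD(4)[OF g yN] y by simp
    then show "y \<in> \<Omega> ` dilate M k (QSTAB M)" using trop_isoD(4)[OF g yN] by (metis imageI)
  qed
qed

text \<open>The inverse \<open>g\<close> has max-min-plus coordinates as well, so integrality passes
  in both directions.\<close>

theorem Omega_lattice_points:
  "bij_betw \<Omega> (dilate M k (QSTAB M) \<inter> int_labelings M) (dilate N k (QSTAB N) \<inter> int_labelings N)"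
proof -
  obtain g where g: "trop_iso M N \<Omega> g" using trop_iso_shift by blast
  have M: "x \<in> labelings M" if "x \<in> dilate M k (QSTAB M)" for x using that unfolding dilate_QSTAB[OF finite_M] by blast
  have N: "y \<in> labelings N" if "y \<in> dilate N k (QSTAB N)" for y using that unfolding dilate_QSTAB[OF finite_N] by blast
  have gM: "g y \<in> dilate M k (QSTAB M)" if "y \<in> dilate N k (QSTAB N)" for y
  proof -
    from that obtain x where "x \<in> dilate M k (QSTAB M)" "y = \<Omega> x" unfolding Omega_dilate[symmetric] by blast
    then show ?thesis using trop_isoD(3)[OF g M] by simp
  qed
  show ?thesis
  proof (rule bij_betw_byWitness[of _ g])
    show "\<forall>x\<in>dilate M k (QSTAB M) \<inter> int_labelings M. g (\<Omega> x) = x" using trop_isoD(3)[OF g M] by blast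
    show "\<forall>y\<in>dilate N k (QSTAB N) \<inter> int_labelings N. \<Omega> (g y) = y" using trop_isoD(4)[OF g N] by blast
    show "\<Omega> ` (dilate M k (QSTAB M) \<inter> int_labelings M) \<subseteq> dilate N k (QSTAB N) \<inter> int_labelings N"
      using Omega_dilate trop_map_Ints[OF trop_isoD(1)[OF g]] by blast
    show "g ` (dilate N k (QSTAB N) \<inter> int_labelings N) \<subseteq> dilate M k (QSTAB M) \<inter> int_labelings M"
      using gM trop_map_Ints[OF trop_isoD(2)[OF g]] by blast
  qed
qed

theorem Omega_ehrhart: "ehrhart_series M (QSTAB M) = ehrhart_series N (QSTAB N)"
proof -
  have "ehrhart_count M (QSTAB M) k = ehrhart_count N (QSTAB N) k" for k
    using bij_betw_same_card[OF Omega_lattice_points] unfolding ehrhart_count_def by (simp add: Int_commute)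
  then show ?thesis unfolding ehrhart_series_def by simp
qed

end

theorem theorem4p4:
  fixes M N :: "box set" and R :: rect
  assumes "moon_polyomino M" and "moon_polyomino N"
    and "maximal_rect M R"
    and "obtained_by_shift M R N"
  shows "piecewise_linear M N (Omega_shift R N)
    \<and> volume_preserving M N (Omega_shift R N)
    \<and> continuous_labeling_map M N (Omega_shift R N)
    \<and> (\<forall>d::nat. \<forall>x\<in>labelings M. \<forall>S. maximal_rect M S \<longrightarrow>
         path_stat S x d = path_stat (corresponding_rect R S) (Omega_shift R N x) d)
    \<and> (\<forall>k::nat. Omega_shift R N ` dilate M k (QSTAB M) = dilate N k (QSTAB N))
    \<and> (\<forall>k::nat. bij_betw (Omega_shift R N)
         (dilate M k (QSTAB M) \<inter> int_labelings M) (dilate N k (QSTAB N) \<inter> int_labelings N))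
    \<and> ehrhart_series M (QSTAB M) = ehrhart_series N (QSTAB N)"
proof -
  obtain i1 i2 j1 j2 where R: "R = (i1, i2, j1, j2)" by (metis surj_pair)
  interpret moon_shift M N i1 i2 j1 j2
    by unfold_locales (use assms R in simp_all)
  obtain g where g: "trop_iso M N (Omega_shift R N) g" using trop_iso_shift unfolding R by blast
  show ?thesis
  proof (intro conjI allI ballI impI)
    show "piecewise_linear M N (Omega_shift R N)"
      by (rule trop_map_piecewise_linear[OF finite_M finite_N trop_isoD(1)[OF g]])
    show "volume_preserving M N (Omega_shift R N)" by (rule trop_iso_volume_preserving[OF g])
    show "continuous_labeling_map M N (Omega_shift R N)" by (rule trop_map_continuous[OF trop_isoD(1)[OF g]])
    show "path_stat S x d = path_stat (corresponding_rect R S) (Omega_shift R N x) d" if "maximal_rect M S" for d x S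
      unfolding R by (rule path_stat_invariant[OF that])
    show "Omega_shift R N ` dilate M k (QSTAB M) = dilate N k (QSTAB N)" for k
      unfolding R by (rule Omega_dilate)
    show "bij_betw (Omega_shift R N) (dilate M k (QSTAB M) \<inter> int_labelings M) (dilate N k (QSTAB N) \<inter> int_labelings N)" for k
      unfolding R by (rule Omega_lattice_points)
    show "ehrhart_series M (QSTAB M) = ehrhart_series N (QSTAB N)" by (rule Omega_ehrhart)
  qed
qed

end
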